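(* Let $(K_i)_{i\in I}$ be an arbitrary (possibly infinite) family of compact subsets of $\mathbb C$ with $\overline{\mathcal O}(K_i)=A_D(K_i)$ for every $i\in I$, and let $K=\prod_{i\in I}K_i$ with the product topology. For each $i\in I$ let $L_i\subset(\mathbb C\cup\{\infty\})\setminus K_i$ contain at least one point of each connected component of $(\mathbb C\cup\{\infty\})\setminus K_i$. Then the finite sums of finite products of rational functions of one variable $z_i$ (for finitely many $i\in I$) with poles in $L_i$ are uniformly dense in $A_D(K)$.
   Context: For a planar compact $K_i$: $\overline{\mathcal O}(K_i)$ is the closure in $C(K_i)$ of restrictions of functions holomorphic on a neighbourhood of $K_i$, and $A_D(K_i)=A(K_i)$ is the algebra of continuous functions on $K_i$ holomorphic on $K_i^\circ$. For $K=\prod_{i\in I}K_i$, $A_D(K)$ is the set of functions $f:K\to\mathbb C$ such that (a) $f$ is continuous for the product topology, and (b) for every $i_0\in I$ and every choice of $w_i\in K_i$ for $i\ne i_0$, the function $z\mapsto f((z_i(z))_{i\in I})$, with $z_{i_0}(z)=z$ and $z_i(z)=w_i$ for $i\ne i_0$, belongs to $A(K_{i_0})$. *)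

theory Defs
  imports "HOL-Analysis.Analysis" "HOL-Computational_Algebra.Polynomial"
begin

definition A_alg :: "complex set \<Rightarrow> (complex \<Rightarrow> complex) set" where
  "A_alg K = {g. continuous_on K g \<and> g holomorphic_on interior K}"

definition O_bar :: "complex set \<Rightarrow> (complex \<Rightarrow> complex) set" where
  "O_bar K = {g. continuous_on K g \<and>
     (\<forall>e>0. \<exists>U h. open U \<and> K \<subseteq> U \<and> h holomorphic_on U \<and>
        (\<forall>z\<in>K. cmod (g z - h z) < e))}"

definition A_D :: "'i set \<Rightarrow> ('i \<Rightarrow> complex set) \<Rightarrow> (('i \<Rightarrow> complex) \<Rightarrow> complex) set" where
  "A_D I K = {f. continuous_on (PiE I K) f \<and>
     (\<forall>i0\<in>I. \<forall>w\<in>PiE I K. (\<lambda>z. f (w(i0 := z))) \<in> A_alg (K i0))}"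

(* Points of the Riemann sphere: None = infinity, Some z = z.
   L meets every connected component of (C \<union> {\<infinity>}) - K, K compact:
   bounded components of C - K must contain a point of L; the component of
   \<infinity> is the unbounded component of C - K together with \<infinity>. *)
definition hits_components :: "complex set \<Rightarrow> complex option set \<Rightarrow> bool" where
  "hits_components K L \<longleftrightarrow>
     (\<forall>z. Some z \<in> L \<longrightarrow> z \<notin> K) \<and>
     (\<forall>C\<in>components (- K).
        (bounded C \<longrightarrow> (\<exists>z\<in>C. Some z \<in> L)) \<and>
        (\<not> bounded C \<longrightarrow> None \<in> L \<or> (\<exists>z\<in>C. Some z \<in> L)))"

definition rat_poles :: "complex option set \<Rightarrow> (complex \<Rightarrow> complex) \<Rightarrow> bool" where
  "rat_poles L r \<longleftrightarrow> (\<exists>p q :: complex poly. q \<noteq> 0 \<and>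
      (\<forall>z. poly q z = 0 \<longrightarrow> Some z \<in> L) \<and>
      (None \<notin> L \<longrightarrow> degree p \<le> degree q) \<and>
      r = (\<lambda>z. poly p z / poly q z))"

inductive_set rat_prods :: "'i set \<Rightarrow> ('i \<Rightarrow> complex option set) \<Rightarrow> (('i \<Rightarrow> complex) \<Rightarrow> complex) set"
  for I L where
  const: "(\<lambda>x. c) \<in> rat_prods I L"
| mult: "g \<in> rat_prods I L \<Longrightarrow> i \<in> I \<Longrightarrow> rat_poles (L i) r \<Longrightarrow>
         (\<lambda>x. r (x i) * g x) \<in> rat_prods I L"

inductive_set rat_sums :: "'i set \<Rightarrow> ('i \<Rightarrow> complex option set) \<Rightarrow> (('i \<Rightarrow> complex) \<Rightarrow> complex) set"
  for I L where
  zero: "(\<lambda>x. 0) \<in> rat_sums I L"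
| add: "g \<in> rat_prods I L \<Longrightarrow> h \<in> rat_sums I L \<Longrightarrow> (\<lambda>x. g x + h x) \<in> rat_sums I L"

end

theory Submission
  imports Defs "HOL-Complex_Analysis.Complex_Analysis"
begin

text \<open>
  By compactness a function in \<open>A_D(K)\<close> is uniformly close to one that depends on finitely many coordinates
  only, and these are removed one at a time. Removing a coordinate requires approximating
  \<open>z \<mapsto> f(z, w)\<close> on a planar compact set by finite sums \<open>\<Sum>\<^sub>k h\<^sub>k(z) b\<^sub>k(w)\<close> with \<open>h\<^sub>k\<close> holomorphic near the set and
  \<open>b\<^sub>k\<close> depending linearly on \<open>f(\<cdot>, w)\<close>, that is, a form of the approximation property of \<open>R(K)\<close>. It is obtained from
  Vitushkin's localization: \<open>f(\<cdot>, w)\<close> is split into pieces, each the Cauchy transform of a density supported in a small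
  disc off \<open>K\<close> and bounded by the oscillation of \<open>f\<close>. Subtracting a linear combination of three fixed Cauchy transforms of
  such densities, with coefficients determined by the first three moments of the piece, leaves a remainder that decays
  like the inverse fourth power of the distance, and these remainders have a small sum over a square grid. Finally, Cauchy
  transforms of densities supported off \<open>K\<close> are approximated by rational functions by Riemann sums and pole pushing.
\<close>

section \<open>Area Cauchy transforms\<close>

text \<open>For each fixed \<open>w\<close> the hypothesis \<open>O_bar (K i) = A_alg (K i)\<close>
  gives a function \<open>h\<close> holomorphic near \<open>K i\<close> and close to the slice, but
  \<open>h\<close> and its domain depend on \<open>w\<close> in an uncontrolled, nonlinear way.
  Coefficients read off from \<open>h\<close> would be useless as functions of \<open>w\<close>. The
  way out is that the localized scheme sees a function only through finitely many integrals against
  kernels that depend neither on \<open>w\<close> nor on \<open>h\<close>. Integration by parts puts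
  all derivatives on these kernels, so the integrals are stable under small uniform changes of the
  function. They can therefore be computed from a smooth approximant that is a finite linear
  combination of slices \<open>f p\<close> with \<open>p\<close> in the compact set; the
  coefficients then stay in any linear space containing the slices, which is what the induction on
  coordinates consumes. The function \<open>h\<close> survives only in the proof of the error bound,
  one \<open>w\<close> at a time. Three moments are cancelled because the resulting fourth-power
  decay is dominated on the grid by a product of two convergent sums of inverse squares, uniformly
  in the size of the grid.\<close>

definition Cc :: "(complex \<Rightarrow> complex) \<Rightarrow> bool" where
  "Cc \<rho> \<longleftrightarrow> continuous_on UNIV \<rho> \<and> bounded {z. \<rho> z \<noteq> 0}"

text \<open>\<open>gx\<close> and \<open>gy\<close> are the real partial derivatives, carried as
  explicit functions so that \<open>gx z + \<i> * gy z\<close>, twice the antiholomorphic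
  derivative, can serve directly as a density.\<close>

definition C1_on :: "complex set \<Rightarrow> (complex \<Rightarrow> complex) \<Rightarrow> (complex \<Rightarrow> complex) \<Rightarrow> (complex \<Rightarrow> complex) \<Rightarrow> bool" where
  "C1_on S g gx gy \<longleftrightarrow> continuous_on S gx \<and> continuous_on S gy \<and>
     (\<forall>z\<in>S. (g has_derivative (\<lambda>h. of_real (Re h) * gx z + of_real (Im h) * gy z)) (at z))"

text \<open>Unnormalized, with \<open>z - \<zeta>\<close> in the denominator; this is where the
  minus sign and \<open>pompeiu_const\<close> in \<open>cauchy_pompeiu\<close> come from. At
  \<open>z = \<zeta>\<close> the integrand is 0 by the convention for division.\<close>

definition cauchy :: "(complex \<Rightarrow> complex) \<Rightarrow> complex \<Rightarrow> complex" where
  "cauchy \<rho> \<zeta> = (LINT z|lborel. \<rho> z / (z - \<zeta>))"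

lemma Cc_integrable:
  assumes "Cc \<rho>" shows "integrable lborel \<rho>"
proof -
  obtain R where R: "\<And>z. \<rho> z \<noteq> 0 \<Longrightarrow> cmod z \<le> R"
    using assms unfolding Cc_def bounded_iff by blast
  have "integrable lborel (\<lambda>z. indicator (cball 0 R) z *\<^sub>R \<rho> z)"
    using assms by (intro borel_integrable_compact) (auto simp: Cc_def intro: continuous_on_subset)
  moreover have "(\<lambda>z. indicator (cball 0 R) z *\<^sub>R \<rho> z) = \<rho>"
    using R by (auto simp: fun_eq_iff indicator_def dist_norm)
  ultimately show ?thesis by simp
qed

lemma Cc_mult:
  assumes "Cc \<rho>" "continuous_on UNIV g" shows "Cc (\<lambda>z. \<rho> z * g z)" "Cc (\<lambda>z. g z * \<rho> z)"
  using assms unfolding Cc_def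
  by (auto intro!: continuous_intros elim: bounded_subset)

lemma Cc_add: "Cc f \<Longrightarrow> Cc g \<Longrightarrow> Cc (\<lambda>z. f z + g z)"
proof -
  assume "Cc f" "Cc g"
  moreover have "{z. f z + g z \<noteq> 0} \<subseteq> {z. f z \<noteq> 0} \<union> {z. g z \<noteq> 0}" by auto
  ultimately show ?thesis unfolding Cc_def
    by (auto intro!: continuous_intros elim: bounded_subset intro: bounded_subset[OF bounded_Un[THEN iffD2]])
qed

lemma Cc_cmult: "Cc f \<Longrightarrow> Cc (\<lambda>z. c * f z)"
  by (rule Cc_mult) auto

lemma Cc_zero: "Cc (\<lambda>z. 0)"
  by (simp add: Cc_def)

lemma Cc_bounded:
  assumes "Cc \<rho>" obtains B where "B > 0" "\<And>z. cmod (\<rho> z) \<le> B"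
proof -
  obtain R where R: "\<And>z. \<rho> z \<noteq> 0 \<Longrightarrow> cmod z \<le> R"
    using assms unfolding Cc_def bounded_iff by blast
  have "bounded (\<rho> ` cball 0 R)"
    using assms by (intro compact_imp_bounded compact_continuous_image) (auto simp: Cc_def intro: continuous_on_subset)
  then obtain B where B: "B > 0" "\<And>z. cmod z \<le> R \<Longrightarrow> cmod (\<rho> z) \<le> B"
    unfolding bounded_pos by (auto simp: dist_norm)
  have "cmod (\<rho> z) \<le> B" for z
    using B R[of z] by (cases "\<rho> z = 0") auto
  then show ?thesis using that B by blast
qed

section \<open>Area estimates for the Cauchy kernel\<close>

lemma square_measure:
  fixes a :: complex assumes "r \<ge> 0"
  shows "emeasure lborel (cbox (a - Complex r r) (a + Complex r r)) = ennreal (4 * r^2)"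
  using assms
  by (subst emeasure_lborel_cbox)
     (auto simp: Basis_complex_def inner_complex_def power2_eq_square algebra_simps)

lemma mem_square:
  "z \<in> cbox (a - Complex r r) (a + Complex r r) \<longleftrightarrow> \<bar>Re (z - a)\<bar> \<le> r \<and> \<bar>Im (z - a)\<bar> \<le> r"
  by (auto simp: Basis_complex_def inner_complex_def cbox_def)

lemma kernel_measurable [measurable]:
  "(\<lambda>z. indicator (cball a r) z / cmod (z - \<zeta>) :: real) \<in> borel_measurable borel"
  by (intro borel_measurable_divide borel_measurable_indicator) auto

text \<open>Dyadic shells: where \<open>r / 2^(k+1) < cmod (z - \<zeta>) \<le> r / 2^k\<close> the
  kernel is at most \<open>2 * 2^k / r\<close>, and the shell lies in a square of area
  \<open>4 * (r / 2^k)^2\<close>. The products \<open>8 * r / 2^k\<close> sum to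
  \<open>16 * r\<close>.\<close>

lemma nn_kernel_centered:
  fixes \<zeta> :: complex assumes r: "r > 0"
  shows "(\<integral>\<^sup>+ z. ennreal (indicator (cball \<zeta> r) z / cmod (z - \<zeta>)) \<partial>lborel) \<le> ennreal (16 * r)"
proof -
  define Q where "Q k = cbox (\<zeta> - Complex (r/2^k) (r/2^k)) (\<zeta> + Complex (r/2^k) (r/2^k))" for k :: nat
  have pt: "ennreal (indicator (cball \<zeta> r) z / cmod (z - \<zeta>)) \<le> (\<Sum>k. ennreal (2 * 2^k / r) * indicator (Q k) z)" for z
  proof (cases "z \<in> cball \<zeta> r \<and> z \<noteq> \<zeta>")
    case True
    define u where "u = cmod (z - \<zeta>)"
    have u: "0 < u" "u \<le> r" using True by (auto simp: u_def dist_norm norm_minus_commute)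
    have "\<exists>k. r / 2^k < u"
      using real_arch_pow[of 2 "r/u"] u by (auto simp: field_simps)
    then obtain k where k: "r / 2^k < u" "\<And>j. j < k \<Longrightarrow> \<not> r / 2^j < u"
      using exists_least_iff[of "\<lambda>k. r / 2^k < u"] by blast
    have "k \<noteq> 0" using k u by (cases k) auto
    then obtain m where m: "k = Suc m" by (cases k) auto
    have 1: "u \<le> r / 2^m" using k(2)[of m] m by auto
    have "z \<in> Q m" unfolding Q_def mem_square
      using 1 abs_Re_le_cmod[of "z-\<zeta>"] abs_Im_le_cmod[of "z-\<zeta>"] unfolding u_def by linarith
    moreover have "1 / u \<le> 2 * 2^m / r" using k(1) u r m by (simp add: field_simps)
    ultimately have "ennreal (indicator (cball \<zeta> r) z / cmod (z - \<zeta>)) \<le> ennreal (2 * 2^m / r) * indicator (Q m) z"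
      using True by (auto simp: u_def indicator_def intro!: ennreal_leI)
    also have "\<dots> \<le> (\<Sum>k. ennreal (2 * 2^k / r) * indicator (Q k) z)"
    proof -
      define g where "g k = ennreal (2 * 2^k / r) * indicator (Q k) z" for k
      have "sum g {m} \<le> suminf g" by (rule sum_le_suminf) (auto intro: summableI)
      then have "g m \<le> suminf g" by simp
      then show ?thesis unfolding g_def .
    qed
    finally show ?thesis .
  qed (auto simp: indicator_def)
  have "(\<integral>\<^sup>+ z. ennreal (indicator (cball \<zeta> r) z / cmod (z - \<zeta>)) \<partial>lborel)
      \<le> (\<integral>\<^sup>+ z. (\<Sum>k. ennreal (2 * 2^k / r) * indicator (Q k) z) \<partial>lborel)"
    by (intro nn_integral_mono pt)
  also have "\<dots> = (\<Sum>k. \<integral>\<^sup>+ z. ennreal (2 * 2^k / r) * indicator (Q k) z \<partial>lborel)"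
    by (intro nn_integral_suminf) (auto simp: Q_def)
  also have "\<dots> = (\<Sum>k. ennreal (2 * 2^k / r) * ennreal (4 * (r/2^k)^2))"
    using r by (subst nn_integral_cmult_indicator) (auto simp: Q_def square_measure)
  also have "\<dots> = (\<Sum>k. ennreal (8 * r * (1/2)^k))"
    using r by (intro suminf_cong) (auto simp: ennreal_mult[symmetric] power2_eq_square power_one_over field_simps intro!: arg_cong[where f=ennreal])
  also have "\<dots> = ennreal (\<Sum>k. 8 * r * (1/2)^k)"
    using r by (intro suminf_ennreal2 summable_mult summable_geometric) auto
  also have "(\<Sum>k. 8 * r * (1/2::real)^k) = 16 * r"
    by (subst suminf_mult) (auto simp: suminf_geometric)
  finally show ?thesis .
qed

text \<open>The pole may lie anywhere. The part of the disc within \<open>r\<close> of the pole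
  costs \<open>16 * r\<close> by the centred bound; elsewhere the kernel is at most
  \<open>1 / r\<close> on a square of area \<open>4 * r^2\<close>, which adds
  \<open>4 * r\<close>.\<close>

lemma nn_kernel:
  fixes \<zeta> a :: complex assumes r: "r > 0"
  shows "(\<integral>\<^sup>+ z. ennreal (indicator (cball a r) z / cmod (z - \<zeta>)) \<partial>lborel) \<le> ennreal (20 * r)"
proof -
  define Q where "Q = cbox (a - Complex r r) (a + Complex r r)"
  have Q: "z \<in> cball a r \<Longrightarrow> z \<in> Q" for z unfolding Q_def mem_square
    using abs_Re_le_cmod[of "z-a"] abs_Im_le_cmod[of "z-a"] by (auto simp: dist_norm norm_minus_commute)
  have "ennreal (indicator (cball a r) z / cmod (z - \<zeta>)) \<le>
     ennreal (indicator (cball \<zeta> r) z / cmod (z - \<zeta>)) + ennreal (1/r) * indicator Q z" for z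
  proof (cases "z \<in> cball a r \<and> z \<notin> cball \<zeta> r")
    case True
    then have "r \<le> cmod (z - \<zeta>)" by (auto simp: dist_norm norm_minus_commute)
    then have "1 / cmod (z - \<zeta>) \<le> 1 / r" using r by (intro frac_le) auto
    with True Q[of z] show ?thesis by (auto simp: indicator_def intro!: ennreal_leI)
  qed (auto simp: indicator_def)
  then have "(\<integral>\<^sup>+ z. ennreal (indicator (cball a r) z / cmod (z - \<zeta>)) \<partial>lborel) \<le>
     (\<integral>\<^sup>+ z. ennreal (indicator (cball \<zeta> r) z / cmod (z - \<zeta>)) + ennreal (1/r) * indicator Q z \<partial>lborel)"
    by (rule nn_integral_mono)
  also have "\<dots> = (\<integral>\<^sup>+ z. ennreal (indicator (cball \<zeta> r) z / cmod (z - \<zeta>)) \<partial>lborel) + ennreal (1/r) * ennreal (4 * r^2)"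
    using r by (subst nn_integral_add) (auto simp: Q_def nn_integral_cmult_indicator square_measure)
  also have "\<dots> \<le> ennreal (16 * r) + ennreal (4*r)"
    using r by (intro add_mono nn_kernel_centered) (auto simp: ennreal_mult[symmetric] power2_eq_square)
  also have "\<dots> = ennreal (20*r)" using r by (subst ennreal_plus[symmetric]) auto
  finally show ?thesis .
qed

lemma kernel_integrable:
  fixes \<zeta> a :: complex assumes r: "r > 0"
  shows "integrable lborel (\<lambda>z. indicator (cball a r) z / cmod (z - \<zeta>) :: real)"
    and "(LINT z|lborel. indicator (cball a r) z / cmod (z - \<zeta>)) \<le> 20 * r"
proof -
  show 1: "integrable lborel (\<lambda>z. indicator (cball a r) z / cmod (z - \<zeta>) :: real)"
    using le_less_trans[OF nn_kernel[OF r, of a \<zeta>] ennreal_less_top]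
    by (intro integrableI_nonneg) (auto simp: infinity_ennreal_def)
  show "(LINT z|lborel. indicator (cball a r) z / cmod (z - \<zeta>)) \<le> 20 * r"
    using nn_kernel[OF r, of a \<zeta>] r by (subst integral_eq_nn_integral) (auto intro!: enn2real_leI)
qed

lemma kernel_bound:
  assumes r: "r > 0" and m: "f \<in> borel_measurable lborel"
    and M: "\<And>z. cmod (f z) \<le> M" and s: "\<And>z. f z \<noteq> 0 \<Longrightarrow> z \<in> cball a r"
  shows "integrable lborel (\<lambda>z. f z / (z - \<zeta>))" "cmod (cauchy f \<zeta>) \<le> 20 * r * M"
    "integrable lborel (\<lambda>z. cmod (f z) / cmod (z - \<zeta>))"
proof -
  have M0: "M \<ge> 0" using M[of 0] norm_ge_zero order_trans by blast
  have le: "cmod (f z / (z - \<zeta>)) \<le> M * (indicator (cball a r) z / cmod (z - \<zeta>))" for z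
  proof (cases "f z = 0")
    case False
    then have "indicator (cball a r) z = (1::real)" using s by simp
    then show ?thesis using M[of z] by (simp add: norm_divide divide_right_mono)
  qed (use M0 in auto)
  have i: "integrable lborel (\<lambda>z. M * (indicator (cball a r) z / cmod (z - \<zeta>)))"
    by (intro integrable_mult_right kernel_integrable r)
  show 1: "integrable lborel (\<lambda>z. f z / (z - \<zeta>))"
    using m by (intro Bochner_Integration.integrable_bound[OF i]) (use le M0 in auto)
  then show "integrable lborel (\<lambda>z. cmod (f z) / cmod (z - \<zeta>))"
    by (simp flip: norm_divide)
  have "cmod (cauchy f \<zeta>) \<le> (LINT z|lborel. cmod (f z / (z - \<zeta>)))"
    unfolding cauchy_def by (rule integral_norm_bound)
  also have "\<dots> \<le> (LINT z|lborel. M * (indicator (cball a r) z / cmod (z - \<zeta>)))"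
    using 1 i le by (intro integral_mono) auto
  also have "\<dots> \<le> M * (20 * r)"
    using kernel_integrable(2)[OF r, of a \<zeta>] M0 by (subst integral_mult_right_zero) (auto intro: mult_left_mono)
  finally show "cmod (cauchy f \<zeta>) \<le> 20 * r * M" by (simp add: mult_ac)
qed

lemma Cc_measurable: "Cc f \<Longrightarrow> f \<in> borel_measurable borel"
  unfolding Cc_def by (auto intro: borel_measurable_continuous_onI)

lemma Cc_cauchy_integrable:
  assumes "Cc \<rho>" shows "integrable lborel (\<lambda>z. \<rho> z / (z - \<zeta>))" "integrable lborel (\<lambda>z. cmod (\<rho> z) / cmod (z - \<zeta>))"
proof -
  obtain B where B: "\<And>z. cmod (\<rho> z) \<le> B" using Cc_bounded[OF assms] by blast
  obtain R where R: "\<And>z. \<rho> z \<noteq> 0 \<Longrightarrow> cmod z \<le> R" "R > 0"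
    using assms unfolding Cc_def bounded_pos by blast
  have m: "\<rho> \<in> borel_measurable lborel" using Cc_measurable[OF assms] by simp
  note k = kernel_bound[OF R(2) m B, of 0 \<zeta>]
  show "integrable lborel (\<lambda>z. \<rho> z / (z - \<zeta>))" "integrable lborel (\<lambda>z. cmod (\<rho> z) / cmod (z - \<zeta>))"
    using k R(1) by auto
qed

lemma Cc_cauchy_bounded:
  assumes "Cc \<rho>" obtains B where "B > 0" "\<And>\<zeta>. cmod (cauchy \<rho> \<zeta>) \<le> B"
proof -
  obtain B where B: "\<And>z. cmod (\<rho> z) \<le> B" "B > 0" using Cc_bounded[OF assms] by blast
  obtain R where R: "\<And>z. \<rho> z \<noteq> 0 \<Longrightarrow> cmod z \<le> R" "R > 0"
    using assms unfolding Cc_def bounded_pos by blast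
  have m: "\<rho> \<in> borel_measurable lborel" using Cc_measurable[OF assms] by simp
  show ?thesis using kernel_bound(2)[OF R(2) m B(1), of 0] R B by (intro that[of "20*R*B"]) auto
qed

lemma cauchy_linear:
  assumes "Cc f" "Cc g"
  shows "cauchy (\<lambda>z. f z + c * g z) \<zeta> = cauchy f \<zeta> + c * cauchy g \<zeta>"
proof -
  have "(\<lambda>z. (f z + c * g z) / (z - \<zeta>)) = (\<lambda>z. f z / (z - \<zeta>) + c * (g z / (z - \<zeta>)))"
    by (auto simp: add_divide_distrib)
  then show ?thesis unfolding cauchy_def
    using Cc_cauchy_integrable(1)[OF assms(1), of \<zeta>] Cc_cauchy_integrable(1)[OF assms(2), of \<zeta>]
    by (simp only: integral_mult_right_zero Bochner_Integration.integral_add integrable_mult_right)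
qed

lemma cauchy_sum:
  assumes "\<And>i. i \<in> A \<Longrightarrow> Cc (f i)"
  shows "cauchy (\<lambda>z. \<Sum>i\<in>A. f i z) \<zeta> = (\<Sum>i\<in>A. cauchy (f i) \<zeta>)"
  unfolding cauchy_def sum_divide_distrib
  by (rule Bochner_Integration.integral_sum) (use assms Cc_cauchy_integrable in auto)

section \<open>Smooth functions of compact support\<close>

lemma C1_on_continuous: "C1_on S g gx gy \<Longrightarrow> continuous_on S g"
  unfolding C1_on_def by (meson has_derivative_continuous continuous_at_imp_continuous_on)

lemma C1_on_mult:
  assumes "C1_on S f fx fy" "C1_on S g gx gy"
  shows "C1_on S (\<lambda>z. f z * g z) (\<lambda>z. fx z * g z + f z * gx z) (\<lambda>z. fy z * g z + f z * gy z)"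
proof -
  have "((\<lambda>z. f z * g z) has_derivative
     (\<lambda>h. of_real (Re h) * (fx z * g z + f z * gx z) + of_real (Im h) * (fy z * g z + f z * gy z))) (at z)"
    if "z \<in> S" for z
  proof -
    have "((\<lambda>z. f z * g z) has_derivative (\<lambda>h. f z * (of_real (Re h) * gx z + of_real (Im h) * gy z)
        + (of_real (Re h) * fx z + of_real (Im h) * fy z) * g z)) (at z)"
      using assms that unfolding C1_on_def by (intro has_derivative_mult) auto
    then show ?thesis by (rule has_derivative_eq_rhs) (auto simp: algebra_simps fun_eq_iff)
  qed
  then show ?thesis using assms C1_on_continuous[OF assms(1)] C1_on_continuous[OF assms(2)]
    unfolding C1_on_def by (auto intro!: continuous_intros)
qed

lemma C1_on_add:
  assumes "C1_on S f fx fy" "C1_on S g gx gy"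
  shows "C1_on S (\<lambda>z. f z + g z) (\<lambda>z. fx z + gx z) (\<lambda>z. fy z + gy z)"
proof -
  have "((\<lambda>z. f z + g z) has_derivative
     (\<lambda>h. of_real (Re h) * (fx z + gx z) + of_real (Im h) * (fy z + gy z))) (at z)"
    if "z \<in> S" for z
  proof -
    have "((\<lambda>z. f z + g z) has_derivative (\<lambda>h. (of_real (Re h) * fx z + of_real (Im h) * fy z)
        + (of_real (Re h) * gx z + of_real (Im h) * gy z))) (at z)"
      using assms that unfolding C1_on_def by (intro has_derivative_add) auto
    then show ?thesis by (rule has_derivative_eq_rhs) (auto simp: algebra_simps fun_eq_iff)
  qed
  then show ?thesis using assms unfolding C1_on_def by (auto intro!: continuous_intros)
qed

lemma C1_on_const: "C1_on S (\<lambda>z. c) (\<lambda>z. 0) (\<lambda>z. 0)"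
  unfolding C1_on_def by auto

lemma C1_on_cmult:
  "C1_on S f fx fy \<Longrightarrow> C1_on S (\<lambda>z. c * f z) (\<lambda>z. c * fx z) (\<lambda>z. c * fy z)"
  using C1_on_mult[OF C1_on_const[of S c]] by fastforce

lemma C1_on_diff:
  assumes "C1_on S f fx fy" "C1_on S g gx gy"
  shows "C1_on S (\<lambda>z. f z - g z) (\<lambda>z. fx z - gx z) (\<lambda>z. fy z - gy z)"
  using C1_on_add[OF assms(1) C1_on_cmult[OF assms(2), of "-1"]] by simp

lemma C1_on_sum:
  "(\<And>i. i \<in> A \<Longrightarrow> C1_on S (f i) (fx i) (fy i)) \<Longrightarrow>
   C1_on S (\<lambda>z. \<Sum>i\<in>A. f i z) (\<lambda>z. \<Sum>i\<in>A. fx i z) (\<lambda>z. \<Sum>i\<in>A. fy i z)"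
  by (induction A rule: infinite_finite_induct) (auto intro: C1_on_const C1_on_add)

lemma C1_on_unique:
  assumes "C1_on S f fx fy" "z \<in> S" "(f has_derivative L) (at z)"
  shows "fx z = L 1" "fy z = L \<i>"
proof -
  have "(\<lambda>h. of_real (Re h) * fx z + of_real (Im h) * fy z) = L"
    using assms unfolding C1_on_def by (blast intro: has_derivative_unique)
  then show "fx z = L 1" "fy z = L \<i>"
    using fun_cong[of _ L 1] fun_cong[of _ L \<i>] by fastforce+
qed

text \<open>Partial derivatives depend only on the germ. This makes them vanish off a support and
  satisfy the Cauchy-Riemann equation where the function agrees with a holomorphic one.\<close>

lemma C1_on_eq_near:
  assumes "C1_on S f fx fy" "z \<in> S" "open U" "z \<in> U" "\<And>w. w \<in> U \<Longrightarrow> f w = h w" "(h has_derivative L) (at z)"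
  shows "fx z = L 1" "fy z = L \<i>"
proof -
  have "(f has_derivative L) (at z)"
    using has_derivative_transform_within_open[OF assms(6,3,4)] assms(5) by auto
  then show "fx z = L 1" "fy z = L \<i>" using C1_on_unique[OF assms(1,2)] by auto
qed

lemma C1_on_holomorphic:
  assumes "h holomorphic_on U" "open U"
  shows "C1_on U h (deriv h) (\<lambda>z. \<i> * deriv h z)"
proof -
  have "(h has_derivative (\<lambda>k. of_real (Re k) * deriv h z + of_real (Im k) * (\<i> * deriv h z))) (at z)" if "z \<in> U" for z
  proof -
    have "(h has_field_derivative deriv h z) (at z)"
      using assms that by (auto intro: holomorphic_derivI)
    then show ?thesis unfolding has_field_derivative_def
      by (rule has_derivative_eq_rhs) (auto simp: fun_eq_iff complex_eq_iff)
  qed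
  moreover have "continuous_on U (deriv h)"
    using assms by (intro holomorphic_on_imp_continuous_on holomorphic_deriv)
  ultimately show ?thesis unfolding C1_on_def by (auto intro!: continuous_intros)
qed

lemma C1_Cc_partials:
  assumes "C1_on UNIV g gx gy" "bounded {z. g z \<noteq> 0}"
  shows "Cc g" "Cc gx" "Cc gy"
proof -
  have 0: "gx z = 0 \<and> gy z = 0" if "z \<notin> closure {z. g z \<noteq> 0}" for z
  proof -
    have "g w = (\<lambda>_. 0) w" if "w \<in> - closure {z. g z \<noteq> 0}" for w
      using that closure_subset[of "{z. g z \<noteq> 0}"] by blast
    note near = C1_on_eq_near[OF assms(1) UNIV_I _ _ this has_derivative_const]
    have "open (- closure {z. g z \<noteq> 0})" "z \<in> - closure {z. g z \<noteq> 0}" using that by auto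
    then show ?thesis using near by blast
  qed
  have b: "bounded (closure {z. g z \<noteq> 0})" using assms(2) by (rule bounded_closure)
  show "Cc g" using assms C1_on_continuous unfolding Cc_def by blast
  show "Cc gx" "Cc gy" using assms(1) 0 unfolding Cc_def C1_on_def
    by (auto intro!: bounded_subset[OF b])
qed

section \<open>Vanishing integrals of derivatives\<close>

lemma integral_translate:
  fixes g :: "complex \<Rightarrow> complex"
  assumes "g \<in> borel_measurable borel"
  shows "(LINT z|lborel. g (z + a)) = (LINT z|lborel. g z)"
proof -
  have "(LINT z|lborel. g z) = (LINT z|distr lborel borel ((+) a). g z)"
    by (simp add: lborel_distr_plus)
  also have "\<dots> = (LINT z|lborel. g (a + z))"
    using assms by (subst integral_distr) auto
  finally show ?thesis by (simp add: add.commute)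
qed

lemma C1_lipschitz:
  assumes "C1_on UNIV g gx gy" "\<And>z. cmod (gx z) \<le> B" "\<And>z. cmod (gy z) \<le> B"
  shows "cmod (g x - g y) \<le> 2 * B * cmod (x - y)"
proof (rule differentiable_bound[of UNIV])
  show "(g has_derivative (\<lambda>h. of_real (Re h) * gx z + of_real (Im h) * gy z)) (at z within UNIV)" for z
    using assms(1) unfolding C1_on_def by auto
  show "onorm (\<lambda>h. of_real (Re h) * gx z + of_real (Im h) * gy z) \<le> 2 * B" for z
  proof (rule onorm_le)
    fix h
    have "cmod (of_real (Re h) * gx z + of_real (Im h) * gy z) \<le> \<bar>Re h\<bar> * cmod (gx z) + \<bar>Im h\<bar> * cmod (gy z)"
      by (rule norm_triangle_le) (simp add: norm_mult)
    also have "\<dots> \<le> cmod h * B + cmod h * B"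
      using assms(2,3)[of z] by (intro add_mono mult_mono abs_Re_le_cmod abs_Im_le_cmod) auto
    finally show "cmod (of_real (Re h) * gx z + of_real (Im h) * gy z) \<le> 2 * B * cmod h" by simp
  qed
qed auto

text \<open>Fubini is not needed here: the difference quotients of \<open>g\<close> have integral zero by translation
  invariance.\<close>
lemma C1_directional_integral_zero:
  assumes C: "C1_on UNIV g gx gy" and b: "bounded {z. g z \<noteq> 0}" and v: "cmod v = 1"
  shows "(LINT z|lborel. of_real (Re v) * gx z + of_real (Im v) * gy z) = 0"
proof -
  note cc = C1_Cc_partials[OF C b]
  obtain B1 where B1: "\<And>z. cmod (gx z) \<le> B1" using Cc_bounded[OF cc(2)] by blast
  obtain B2 where B2: "\<And>z. cmod (gy z) \<le> B2" using Cc_bounded[OF cc(3)] by blast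
  define B where "B = max B1 B2"
  have B: "\<And>z. cmod (gx z) \<le> B" "\<And>z. cmod (gy z) \<le> B" using B1 B2 by (auto simp: B_def le_max_iff_disj)
  have B0: "B \<ge> 0" using B(1)[of 0] norm_ge_zero order_trans by blast
  obtain R where R: "\<And>z. g z \<noteq> 0 \<Longrightarrow> cmod z \<le> R" using b unfolding bounded_iff by blast
  define t where "t n = (1 / (real n + 1))" for n
  have t: "t n > 0" "t n \<le> 1" for n by (auto simp: t_def)
  have t0: "t \<longlonglongrightarrow> 0" unfolding t_def using LIMSEQ_inverse_real_of_nat by (simp add: divide_inverse add.commute)
  define q where "q n z = (g (z + of_real (t n) * v) - g z) / of_real (t n)" for n z
  have gm: "g \<in> borel_measurable borel" using Cc_measurable[OF cc(1)] .
  have gi: "integrable lborel g" using Cc_integrable[OF cc(1)] .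
  have gi': "integrable lborel (\<lambda>z. g (z + a))" for a
  proof (rule Cc_integrable)
    have "{z. g (z + a) \<noteq> 0} \<subseteq> cball (-a) R"
      using R by (auto simp: dist_norm norm_minus_commute add.commute)
    then have "bounded {z. g (z + a) \<noteq> 0}" using bounded_cball bounded_subset by blast
    moreover have "continuous_on UNIV (\<lambda>z. g (z + a))"
      by (rule continuous_on_compose2[of UNIV g]) (use cc(1) in \<open>auto simp: Cc_def intro: continuous_intros\<close>)
    ultimately show "Cc (\<lambda>z. g (z + a))" unfolding Cc_def by blast
  qed
  have q0: "(LINT z|lborel. q n z) = 0" for n
    unfolding q_def using gi gi' integral_translate[OF gm] by simp
  have "(\<lambda>n. LINT z|lborel. q n z) \<longlonglongrightarrow> (LINT z|lborel. of_real (Re v) * gx z + of_real (Im v) * gy z)"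
  proof (rule integral_dominated_convergence)
    show "(\<lambda>z. complex_of_real (Re v) * gx z + of_real (Im v) * gy z) \<in> borel_measurable lborel"
      using cc Cc_measurable by auto
    show "q n \<in> borel_measurable lborel" for n
      unfolding q_def using gm gi gi' borel_measurable_integrable[OF gi'[of "of_real (t n) * v"]] by auto
    \<comment> \<open>Since \<open>t n \<le> 1\<close>, every difference quotient vanishes outside
      the disc of radius \<open>R + 1\<close>; inside it the Lipschitz constant \<open>2 * B\<close>
      is a majorant.\<close>
    show "integrable lborel (\<lambda>z. indicator (cball 0 (R+1)) z *\<^sub>R (2 * B))"
      by (intro borel_integrable_compact) auto
    show "AE z in lborel. (\<lambda>n. q n z) \<longlonglongrightarrow> of_real (Re v) * gx z + of_real (Im v) * gy z"
    proof (rule AE_I2)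
      fix z
      let ?L = "\<lambda>h. of_real (Re h) * gx z + of_real (Im h) * gy z"
      have d: "(g has_derivative ?L) (at z)" using C unfolding C1_on_def by auto
      show "(\<lambda>n. q n z) \<longlonglongrightarrow> ?L v"
      proof (rule LIMSEQ_I)
        fix e :: real assume e: "e > 0"
        obtain d where d: "d > 0" "\<And>y. cmod (y - z) < d \<Longrightarrow> cmod (g y - g z - ?L (y - z)) \<le> e/2 * cmod (y - z)"
          using d e unfolding has_derivative_at_alt by (meson half_gt_zero)
        obtain N where N: "\<And>n. n \<ge> N \<Longrightarrow> \<bar>t n\<bar> < d" using LIMSEQ_D[OF t0 d(1)] by auto
        have "cmod (q n z - ?L v) < e" if "n \<ge> N" for n
        proof -
          have 1: "cmod (of_real (t n) * v) = t n" using v t[of n] by (simp add: norm_mult)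
          have "cmod (g (z + of_real (t n) * v) - g z - ?L (of_real (t n) * v)) \<le> e/2 * t n"
            using d(2)[of "z + of_real (t n) * v"] N[OF that] 1 t[of n] by simp
          moreover have "q n z - ?L v = (g (z + of_real (t n) * v) - g z - ?L (of_real (t n) * v)) / of_real (t n)"
            using t[of n] by (auto simp: q_def field_simps)
          then have "cmod (q n z - ?L v) = cmod (g (z + of_real (t n) * v) - g z - ?L (of_real (t n) * v)) / t n"
            using t(1)[of n] by (simp only: norm_divide norm_of_real abs_of_pos)
          ultimately have "cmod (q n z - ?L v) \<le> e/2" using t(1)[of n]
            by (simp only: pos_divide_le_eq)
          then show ?thesis using e by auto
        qed
        then show "\<exists>N. \<forall>n\<ge>N. cmod (q n z - ?L v) < e" by blast
      qed
    qed
    show "AE z in lborel. cmod (q n z) \<le> indicator (cball 0 (R+1)) z *\<^sub>R (2 * B)" for n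
    proof (rule AE_I2)
      fix z
      have 1: "cmod (of_real (t n) * v) = t n" using v t[of n] by (simp add: norm_mult)
      show "cmod (q n z) \<le> indicator (cball 0 (R+1)) z *\<^sub>R (2 * B)"
      proof (cases "z \<in> cball 0 (R+1)")
        case True
        have "cmod (g (z + of_real (t n) * v) - g z) \<le> 2 * B * t n"
          using C1_lipschitz[OF C B, of "z + of_real (t n) * v" z] 1 by simp
        then show ?thesis using True t[of n] by (auto simp: q_def norm_divide field_simps)
      next
        case False
        have "cmod z \<le> cmod (z + of_real (t n) * v) + cmod (of_real (t n) * v)"
          using norm_triangle_ineq4[of "z + of_real (t n) * v" "of_real (t n) * v"] by simp
        then have "g (z + of_real (t n) * v) = 0" "g z = 0"
          using False R[of z] R[of "z + of_real (t n) * v"] t[of n] 1 by (force simp: dist_norm)+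
        then show ?thesis using B0 by (auto simp: q_def)
      qed
    qed
  qed
  then show ?thesis using q0 LIMSEQ_unique[OF _ tendsto_const] by simp
qed

lemma C1_dbar_integral_zero:
  assumes C: "C1_on UNIV g gx gy" and b: "bounded {z. g z \<noteq> 0}"
  shows "(LINT z|lborel. gx z + \<i> * gy z) = 0"
proof -
  have "(LINT z|lborel. gx z) = 0" "(LINT z|lborel. gy z) = 0"
    using C1_directional_integral_zero[OF assms, of 1] C1_directional_integral_zero[OF assms, of \<i>] by auto
  then show ?thesis using C1_Cc_partials[OF assms] by (subst Bochner_Integration.integral_add) (auto simp: Cc_integrable)
qed

section \<open>The Cauchy-Pompeiu formula\<close>

definition pompeiu_weight :: "complex \<Rightarrow> real" where
  "pompeiu_weight s = 2 / (1 + (cmod s)^2)^2"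

definition pompeiu_const :: real where
  "pompeiu_const = (LINT s|lborel. pompeiu_weight s)"

lemma pompeiu_weight_measurable [measurable]: "pompeiu_weight \<in> borel_measurable borel"
  unfolding pompeiu_weight_def by measurable

lemma pompeiu_weight_nonneg: "pompeiu_weight s \<ge> 0"
  by (simp add: pompeiu_weight_def)

text \<open>Growing dyadic squares: for the least \<open>k\<close> with
  \<open>cmod z \<le> 2^k\<close>, minimality gives \<open>cmod z \<ge> 2^(k-1)\<close> when
  \<open>k > 0\<close>, so the weight is at most \<open>2 / 16^(k-1) = 32 / 16^k\<close>. Against
  the area \<open>4 * 4^k\<close> this is a geometric series of ratio \<open>1/4\<close>.\<close>

lemma pompeiu_weight_integrable: "integrable lborel pompeiu_weight"
proof -
  define Q where "Q k = cbox (0 - Complex (2^k) (2^k)) (0 + Complex (2^k) (2^k))" for k :: nat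
  have pt: "ennreal (pompeiu_weight z) \<le> (\<Sum>k. ennreal (32 / 16^k) * indicator (Q k) z)" for z
  proof -
    define u where "u = cmod z"
    have u: "0 \<le> u" by (auto simp: u_def)
    have "\<exists>k. u \<le> 2^k"
      using real_arch_pow[of 2 "u"] by (auto intro: less_imp_le)
    then obtain k where k: "u \<le> 2^k" "\<And>j. j < k \<Longrightarrow> \<not> u \<le> 2^j"
      using exists_least_iff[of "\<lambda>k. u \<le> 2^k"] by blast
    have zQ: "z \<in> Q k" unfolding Q_def mem_square
      using k(1) abs_Re_le_cmod[of "z"] abs_Im_le_cmod[of "z"] unfolding u_def by simp
    have "2 / (1 + u^2)^2 \<le> 32 / 16^k"
    proof (cases k)
      case 0
      have "1 \<le> (1 + u^2)^2" by (simp add: one_le_power)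
      then have "2 / (1 + u^2)^2 \<le> 2 / 1" by (intro frac_le) auto
      then show ?thesis using 0 by simp
    next
      case (Suc m)
      have "2^m \<le> u" using k(2)[of m] Suc by auto
      then have "(2^m)^4 \<le> u^4" by (intro power_mono) auto
      moreover have "u^4 \<le> (1 + u^2)^2" by (simp add: power2_eq_square power4_eq_xxxx algebra_simps)
      moreover have "(2^m)^4 = ((2^4)^m :: real)" by (simp only: power_mult[symmetric] mult.commute)
      ultimately have "16^m \<le> (1 + u^2)^2" by simp
      then have "2 / (1 + u^2)^2 \<le> 2 / 16^m" by (intro frac_le) auto
      then show ?thesis using Suc by simp
    qed
    then have "ennreal (pompeiu_weight z) \<le> ennreal (32 / 16^k) * indicator (Q k) z"
      using zQ by (auto simp: pompeiu_weight_def u_def intro!: ennreal_leI)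
    also have "\<dots> \<le> (\<Sum>k. ennreal (32 / 16^k) * indicator (Q k) z)"
    proof -
      define g where "g k = ennreal (32 / 16^k) * indicator (Q k) z" for k
      have "sum g {k} \<le> suminf g" by (rule sum_le_suminf) (auto intro: summableI)
      then have "g k \<le> suminf g" by simp
      then show ?thesis unfolding g_def .
    qed
    finally show ?thesis .
  qed
  have "(\<integral>\<^sup>+ z. ennreal (pompeiu_weight z) \<partial>lborel)
      \<le> (\<integral>\<^sup>+ z. (\<Sum>k. ennreal (32 / 16^k) * indicator (Q k) z) \<partial>lborel)"
    by (intro nn_integral_mono pt)
  also have "\<dots> = (\<Sum>k. \<integral>\<^sup>+ z. ennreal (32 / 16^k) * indicator (Q k) z \<partial>lborel)"
    by (intro nn_integral_suminf) (auto simp: Q_def)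
  also have "\<dots> = (\<Sum>k. ennreal (32 / 16^k) * ennreal (4 * (2^k)^2))"
    unfolding Q_def by (subst nn_integral_cmult_indicator) (auto simp: square_measure[of "2^_" 0, simplified])
  also have "\<dots> = (\<Sum>k. ennreal (128 * (1/4)^k))"
  proof (intro suminf_cong)
    fix k :: nat
    have "(2^k)^2 = ((2^2)^k :: real)" by (simp only: power_mult[symmetric] mult.commute)
    moreover have "(16::real)^k = 4^k * 4^k" by (simp flip: power_mult_distrib)
    ultimately have "32 / 16^k * (4 * (2^k)^2) = 128 * (1/4::real)^k" by (simp add: power_one_over field_simps)
    then show "ennreal (32 / 16^k) * ennreal (4 * (2^k)^2) = ennreal (128 * (1/4)^k)"
      by (subst ennreal_mult[symmetric]) auto
  qed
  also have "\<dots> = ennreal (\<Sum>k. 128 * (1/4)^k)"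
    by (intro suminf_ennreal2 summable_mult summable_geometric) auto
  also have "\<dots> < \<infinity>" by simp
  finally show ?thesis by (intro integrableI_nonneg) (auto simp: pompeiu_weight_nonneg)
qed

lemma pompeiu_const_pos: "pompeiu_const > 0"
proof -
  have "pompeiu_const \<noteq> 0"
  proof
    assume "pompeiu_const = 0"
    then have "AE s in lborel. pompeiu_weight s = 0"
      using integral_nonneg_eq_0_iff_AE[OF pompeiu_weight_integrable] pompeiu_weight_nonneg
      unfolding pompeiu_const_def by auto
    moreover have "pompeiu_weight s \<noteq> 0" for s
    proof -
      have "1 + (cmod s)^2 > 0" by (simp add: add_pos_nonneg)
      then show ?thesis unfolding pompeiu_weight_def by auto
    qed
    ultimately have "AE s::complex in lborel. False" by simp
    then show False by (simp add: eventually_False ae_filter_eq_bot_iff)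
  qed
  moreover have "pompeiu_const \<ge> 0" unfolding pompeiu_const_def
    by (intro Bochner_Integration.integral_nonneg pompeiu_weight_nonneg)
  ultimately show ?thesis by simp
qed

lemma integral_affine:
  fixes f :: "complex \<Rightarrow> complex"
  assumes "f \<in> borel_measurable borel" "t > 0"
  shows "(LINT z|lborel. f z) = (LINT s|lborel. of_real (t^2) * f (a + of_real t * s))"
proof -
  have "lborel = density (distr lborel borel (\<lambda>x::complex. a + t *\<^sub>R x)) (\<lambda>_. ennreal (t^2))"
    using lborel_affine[of t a] assms(2) by (simp add: DIM_complex)
  then have "(LINT z|lborel. f z) = (LINT z|density (distr lborel borel (\<lambda>x::complex. a + t *\<^sub>R x)) (\<lambda>_. ennreal (t^2)). f z)"
    by simp
  also have "\<dots> = (LINT z|distr lborel borel (\<lambda>x::complex. a + t *\<^sub>R x). (t^2) *\<^sub>R f z)"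
    using assms(1) by (subst integral_density) auto
  also have "\<dots> = (LINT s|lborel. (t^2) *\<^sub>R f (a + t *\<^sub>R s))"
    using assms(1) by (subst integral_distr) auto
  finally show ?thesis by (simp add: scaleR_conv_of_real)
qed

text \<open>A smooth truncation of the Cauchy kernel; its \<open>(\<partial>\<^sub>x + i\<partial>\<^sub>y)\<close>-derivative is a rescaling of
  \<^const>\<open>pompeiu_weight\<close>, hence an approximate identity.\<close>
definition soft_kernel :: "real \<Rightarrow> complex \<Rightarrow> complex \<Rightarrow> complex" where
  "soft_kernel \<eta> \<zeta> z = cnj (z - \<zeta>) / ((z - \<zeta>) * cnj (z - \<zeta>) + of_real (\<eta>^2))"

lemma soft_kernel_denom: "(z - \<zeta>) * cnj (z - \<zeta>) + of_real (\<eta>^2) = complex_of_real ((cmod (z - \<zeta>))^2 + \<eta>^2)"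
  by (simp only: of_real_add complex_norm_square)

lemma C1_soft_kernel:
  fixes \<eta> \<zeta>
  defines "N \<equiv> \<lambda>z. (z - \<zeta>) * cnj (z - \<zeta>) + of_real (\<eta>^2)"
  assumes "\<eta> > 0"
  shows "C1_on UNIV (soft_kernel \<eta> \<zeta>)
    (\<lambda>z. 1 / N z - cnj (z - \<zeta>) * (cnj (z - \<zeta>) + (z - \<zeta>)) / (N z)^2)
    (\<lambda>z. - \<i> / N z - cnj (z - \<zeta>) * (\<i> * cnj (z - \<zeta>) - \<i> * (z - \<zeta>)) / (N z)^2)"
proof -
  have N0: "N z \<noteq> 0" for z
    unfolding N_def soft_kernel_denom of_real_eq_0_iff using assms(2)
    by (metis add_nonneg_pos less_irrefl zero_le_power2 zero_less_power)
  have Nc: "continuous_on UNIV N" unfolding N_def by (intro continuous_intros)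
  have "(soft_kernel \<eta> \<zeta> has_derivative
     (\<lambda>h. of_real (Re h) * (1 / N z - cnj (z - \<zeta>) * (cnj (z - \<zeta>) + (z - \<zeta>)) / (N z)^2) +
       of_real (Im h) * (- \<i> / N z - cnj (z - \<zeta>) * (\<i> * cnj (z - \<zeta>) - \<i> * (z - \<zeta>)) / (N z)^2))) (at z)" for z
  proof -
    have cd: "((\<lambda>z. cnj (z - \<zeta>)) has_derivative cnj) (at z)"
      using bounded_linear.has_derivative[OF bounded_linear_cnj, of "\<lambda>z. z - \<zeta>" "\<lambda>h. h"]
      by (simp add: has_derivative_diff[OF has_derivative_ident has_derivative_const, simplified])
    have "(N has_derivative (\<lambda>h. (z - \<zeta>) * cnj h + h * cnj (z - \<zeta>))) (at z)"
      unfolding N_def by (auto intro!: derivative_eq_intros cd)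
    from has_derivative_divide'[OF cd this N0]
    have f1: "((\<lambda>z. cnj (z - \<zeta>) / N z) has_derivative
      (\<lambda>h. (cnj h * N z - cnj (z - \<zeta>) * ((z - \<zeta>) * cnj h + h * cnj (z - \<zeta>))) / (N z * N z))) (at z)" .
    have f2: "soft_kernel \<eta> \<zeta> = (\<lambda>z. cnj (z - \<zeta>) / N z)" by (auto simp: soft_kernel_def N_def)
    have f3: "(cnj h * N z - cnj (z - \<zeta>) * ((z - \<zeta>) * cnj h + h * cnj (z - \<zeta>))) / (N z * N z)
      = of_real (Re h) * (1 / N z - cnj (z - \<zeta>) * (cnj (z - \<zeta>) + (z - \<zeta>)) / (N z)^2) +
       of_real (Im h) * (- \<i> / N z - cnj (z - \<zeta>) * (\<i> * cnj (z - \<zeta>) - \<i> * (z - \<zeta>)) / (N z)^2)" for h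
    proof -
      have h1: "cnj h = of_real (Re h) - \<i> * of_real (Im h)" by (simp add: complex_eq_iff)
      have h2: "h = of_real (Re h) + \<i> * of_real (Im h)" by (simp add: complex_eq_iff)
      have i: "\<i> * (\<i> * x) = - x" for x by (simp flip: mult.assoc)
      define a b n u c where abn: "a = complex_of_real (Re h)" "b = complex_of_real (Im h)" "n = N z" "u = z - \<zeta>" "c = cnj (z - \<zeta>)"
      have "((a - \<i> * b) * n - c * (u * (a - \<i> * b) + (a + \<i> * b) * c)) / (n * n) =
        a * (1 / n - c * (c + u) / n^2) + b * (- \<i> / n - c * (\<i> * c - \<i> * u) / n^2)"
        using N0[of z] unfolding abn(3)[symmetric] by (simp add: field_simps power2_eq_square)
      then show ?thesis using h1 h2 unfolding abn by metis
    qed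
    show ?thesis unfolding f2 by (rule has_derivative_eq_rhs[OF f1]) (intro ext f3)
  qed
  then show ?thesis unfolding C1_on_def
    using N0 by (auto intro!: continuous_intros Nc)
qed

lemma dbar_soft_kernel:
  fixes \<eta> \<zeta>
  defines "N \<equiv> \<lambda>z. (z - \<zeta>) * cnj (z - \<zeta>) + of_real (\<eta>^2)"
  assumes "\<eta> > 0"
  shows "(1 / N z - cnj (z - \<zeta>) * (cnj (z - \<zeta>) + (z - \<zeta>)) / (N z)^2)
    + \<i> * (- \<i> / N z - cnj (z - \<zeta>) * (\<i> * cnj (z - \<zeta>) - \<i> * (z - \<zeta>)) / (N z)^2) = 2 * of_real (\<eta>^2) / (N z)^2"
proof -
  have N0: "N z \<noteq> 0"
    unfolding N_def soft_kernel_denom of_real_eq_0_iff using assms(2)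
    by (metis add_nonneg_pos less_irrefl zero_le_power2 zero_less_power)
  define n u c where nuc: "n = N z" "u = z - \<zeta>" "c = cnj (z - \<zeta>)"
  have i: "\<i> * (\<i> * x) = - x" for x by (simp flip: mult.assoc)
  have "(1 / n - c * (c + u) / n^2) + \<i> * (- \<i> / n - c * (\<i> * c - \<i> * u) / n^2) = 2 * (n - u * c) / n^2"
    using N0 unfolding nuc(1)[symmetric] by (simp add: field_simps power2_eq_square i)
  moreover have "n - u * c = of_real (\<eta>^2)" unfolding nuc N_def by simp
  ultimately show ?thesis unfolding nuc by (simp only:)
qed

text \<open>The approximate-identity half of the Cauchy-Pompeiu formula: continuity of
  \<open>G\<close> at \<open>\<zeta>\<close> gives the pointwise limit, and boundedness of
  \<open>G\<close> gives a multiple of \<open>pompeiu_weight\<close> as majorant.\<close>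

lemma pompeiu_limit_average:
  assumes "Cc G"
  shows "(\<lambda>n. LINT s|lborel. G (\<zeta> + of_real (1 / real (Suc n)) * s) * of_real (pompeiu_weight s))
    \<longlonglongrightarrow> (LINT s|lborel. G \<zeta> * of_real (pompeiu_weight s))"
proof -
  obtain B where B: "\<And>z. cmod (G z) \<le> B" "B > 0" using Cc_bounded[OF assms] by blast
  have Gc: "continuous_on UNIV G" using assms unfolding Cc_def by auto
  have Gm [measurable]: "G \<in> borel_measurable borel" using Cc_measurable[OF assms] .
  show ?thesis
  proof (rule integral_dominated_convergence)
    show "integrable lborel (\<lambda>s. B * pompeiu_weight s)"
      by (intro integrable_mult_right pompeiu_weight_integrable)
    show "AE s in lborel. (\<lambda>n. G (\<zeta> + of_real (1 / real (Suc n)) * s) * of_real (pompeiu_weight s))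
        \<longlonglongrightarrow> G \<zeta> * of_real (pompeiu_weight s)"
    proof (rule AE_I2)
      fix s
      have "(\<lambda>n. 1 / real (Suc n)) \<longlonglongrightarrow> 0" using LIMSEQ_inverse_real_of_nat by (simp add: divide_inverse)
      then have "(\<lambda>n. \<zeta> + of_real (1 / real (Suc n)) * s) \<longlonglongrightarrow> \<zeta> + of_real 0 * s"
        by (intro tendsto_intros)
      then have "(\<lambda>n. \<zeta> + of_real (1 / real (Suc n)) * s) \<longlonglongrightarrow> \<zeta>" by simp
      then have "(\<lambda>n. G (\<zeta> + of_real (1 / real (Suc n)) * s)) \<longlonglongrightarrow> G \<zeta>"
        using Gc by (intro continuous_on_tendsto_compose[of UNIV G]) auto
      then show "(\<lambda>n. G (\<zeta> + of_real (1 / real (Suc n)) * s) * of_real (pompeiu_weight s))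
        \<longlonglongrightarrow> G \<zeta> * of_real (pompeiu_weight s)" by (intro tendsto_intros)
    qed
    show "AE s in lborel. cmod (G (\<zeta> + of_real (1 / real (Suc n)) * s) * of_real (pompeiu_weight s)) \<le> B * pompeiu_weight s" for n
      using B pompeiu_weight_nonneg by (intro AE_I2) (auto simp: norm_mult mult_right_mono)
  qed measurable
qed

text \<open>The modulus \<open>u / (u^2 + \<eta>^2)\<close> of the truncated kernel never exceeds
  \<open>1 / u\<close>, so the integrable true kernel dominates. At the pole both integrands are
  0.\<close>

lemma pompeiu_limit_kernel:
  assumes "Cc D"
  shows "(\<lambda>n. LINT z|lborel. D z * soft_kernel (1 / real (Suc n)) \<zeta> z) \<longlonglongrightarrow> cauchy D \<zeta>"
  unfolding cauchy_def
proof (rule integral_dominated_convergence)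
  have [measurable]: "D \<in> borel_measurable borel" using Cc_measurable[OF assms] .
  have sk: "soft_kernel \<eta> \<zeta> z = cnj (z - \<zeta>) / of_real ((cmod (z - \<zeta>))^2 + \<eta>^2)" for \<eta> z
    unfolding soft_kernel_def soft_kernel_denom ..
  show "(\<lambda>z. D z / (z - \<zeta>)) \<in> borel_measurable lborel" by measurable
  show "(\<lambda>z. D z * soft_kernel (1 / real (Suc n)) \<zeta> z) \<in> borel_measurable lborel" for n
    using C1_on_continuous[OF C1_soft_kernel[of "1 / real (Suc n)" \<zeta>]]
    by (intro borel_measurable_times) (auto intro: borel_measurable_continuous_onI)
  show "integrable lborel (\<lambda>z. cmod (D z) / cmod (z - \<zeta>))" by (rule Cc_cauchy_integrable[OF assms])
  show "AE z in lborel. (\<lambda>n. D z * soft_kernel (1 / real (Suc n)) \<zeta> z) \<longlonglongrightarrow> D z / (z - \<zeta>)"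
  proof (rule AE_I2)
    fix z
    show "(\<lambda>n. D z * soft_kernel (1 / real (Suc n)) \<zeta> z) \<longlonglongrightarrow> D z / (z - \<zeta>)"
    proof (cases "z = \<zeta>")
      case False
      have "(\<lambda>n. 1 / real (Suc n)) \<longlonglongrightarrow> 0" using LIMSEQ_inverse_real_of_nat by (simp add: divide_inverse)
      then have "(\<lambda>n. D z * (cnj (z - \<zeta>) / of_real ((cmod (z - \<zeta>))^2 + (1 / real (Suc n))^2))) \<longlonglongrightarrow>
          D z * (cnj (z - \<zeta>) / of_real ((cmod (z - \<zeta>))^2 + 0^2))"
        using False by (intro tendsto_intros) auto
      moreover have "cnj (z - \<zeta>) / of_real ((cmod (z - \<zeta>))^2 + 0^2) = 1 / (z - \<zeta>)"
      proof -
        have "complex_of_real ((cmod (z - \<zeta>))^2 + 0^2) = (z - \<zeta>) * cnj (z - \<zeta>)"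
          by (simp only: complex_norm_square power_zero_numeral add_0_right)
        moreover have "cnj (z - \<zeta>) \<noteq> 0" using False by (simp only: complex_cnj_zero_iff) simp
        ultimately show ?thesis by (simp only: mult.commute[of "z - \<zeta>"]) simp
      qed
      ultimately show ?thesis unfolding sk by (simp only: mult_1_right times_divide_eq_right)
    qed (simp add: soft_kernel_def)
  qed
  show "AE z in lborel. cmod (D z * soft_kernel (1 / real (Suc n)) \<zeta> z) \<le> cmod (D z) / cmod (z - \<zeta>)" for n
  proof (rule AE_I2)
    fix z
    define u e where ue: "u = cmod (z - \<zeta>)" "e = (1 / real (Suc n))^2"
    have e: "e > 0" by (simp add: ue)
    have "cmod (soft_kernel (1 / real (Suc n)) \<zeta> z) = u / (u^2 + e)"
      unfolding sk norm_divide complex_mod_cnj norm_of_real using e by (simp add: ue)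
    also have "\<dots> \<le> 1 / u"
    proof (cases "u = 0")
      case False
      then have u: "u > 0" by (simp add: ue)
      show ?thesis using u e by (simp add: divide_simps power2_eq_square add_pos_pos)
    qed auto
    finally have "cmod (D z) * cmod (soft_kernel (1 / real (Suc n)) \<zeta> z) \<le> cmod (D z) * (1 / u)"
      by (intro mult_left_mono) auto
    then show "cmod (D z * soft_kernel (1 / real (Suc n)) \<zeta> z) \<le> cmod (D z) / cmod (z - \<zeta>)"
      by (simp add: norm_mult ue)
  qed
qed

text \<open>The density is twice the usual antiholomorphic derivative, so \<^const>\<open>pompeiu_const\<close> is \<open>2\<pi>\<close>; only its positivity matters.\<close>
theorem cauchy_pompeiu:
  assumes C: "C1_on UNIV G gx gy" and b: "bounded {z. G z \<noteq> 0}"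
  shows "cauchy (\<lambda>z. gx z + \<i> * gy z) \<zeta> = - of_real pompeiu_const * G \<zeta>"
proof -
  note cc = C1_Cc_partials[OF C b]
  define D where "D z = gx z + \<i> * gy z" for z
  have D: "Cc D" unfolding D_def using Cc_add[OF cc(2) Cc_cmult[OF cc(3), of \<i>]] .
  define M where "M \<eta> z = 2 * of_real (\<eta>^2) / ((z - \<zeta>) * cnj (z - \<zeta>) + of_real (\<eta>^2))^2" for \<eta> z
  \<comment> \<open>Integration by parts: the integral of the derivative of
    \<open>G * soft_kernel\<close> vanishes. The substitution
    \<open>z = \<zeta> + \<eta> * s\<close>, with Jacobian \<open>\<eta>^2\<close>, then turns the
    derivative of the kernel into \<open>pompeiu_weight\<close>.\<close>
  have eq: "(LINT z|lborel. D z * soft_kernel \<eta> \<zeta> z) = - (LINT s|lborel. G (\<zeta> + of_real \<eta> * s) * of_real (pompeiu_weight s))"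
    if \<eta>: "\<eta> > 0" for \<eta>
  proof -
    note sk = C1_soft_kernel[OF \<eta>, of \<zeta>]
    note p = C1_on_mult[OF C sk]
    have kc: "continuous_on UNIV (soft_kernel \<eta> \<zeta>)" using C1_on_continuous[OF sk] .
    have N0: "(z - \<zeta>) * cnj (z - \<zeta>) + of_real (\<eta>^2) \<noteq> 0" for z
      unfolding soft_kernel_denom of_real_eq_0_iff using \<eta>
      by (metis add_nonneg_pos less_irrefl zero_le_power2 zero_less_power)
    have Mc: "continuous_on UNIV (M \<eta>)"
      unfolding M_def by (intro continuous_intros) (use N0 in auto)
    have "bounded {z. G z * soft_kernel \<eta> \<zeta> z \<noteq> 0}" by (rule bounded_subset[OF b]) auto
    from C1_dbar_integral_zero[OF p this]
    have "(LINT z|lborel. D z * soft_kernel \<eta> \<zeta> z + G z * M \<eta> z) = 0"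
      unfolding D_def M_def dbar_soft_kernel[OF \<eta>, symmetric] by (simp add: algebra_simps)
    moreover have "integrable lborel (\<lambda>z. D z * soft_kernel \<eta> \<zeta> z)" "integrable lborel (\<lambda>z. G z * M \<eta> z)"
      using Cc_integrable[OF Cc_mult(1)[OF D kc]] Cc_integrable[OF Cc_mult(1)[OF cc(1) Mc]] by auto
    ultimately have 1: "(LINT z|lborel. D z * soft_kernel \<eta> \<zeta> z) = - (LINT z|lborel. G z * M \<eta> z)"
      by (simp add: add_eq_0_iff2)
    have "(\<lambda>z. G z * M \<eta> z) \<in> borel_measurable borel"
      using Cc_measurable[OF Cc_mult(1)[OF cc(1) Mc]] .
    from integral_affine[OF this \<eta>, of \<zeta>]
    have 2: "(LINT z|lborel. G z * M \<eta> z) = (LINT s|lborel. of_real (\<eta>^2) * (G (\<zeta> + of_real \<eta> * s) * M \<eta> (\<zeta> + of_real \<eta> * s)))" .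
    have 3: "of_real (\<eta>^2) * (G (\<zeta> + of_real \<eta> * s) * M \<eta> (\<zeta> + of_real \<eta> * s))
        = G (\<zeta> + of_real \<eta> * s) * of_real (pompeiu_weight s)" for s
    proof -
      define n where "n = 1 + (cmod s)^2"
      have n0: "n > 0" unfolding n_def by (simp add: add_pos_nonneg)
      have "M \<eta> (\<zeta> + of_real \<eta> * s) = of_real (2 * \<eta>^2 / (\<eta>^2 * n)^2)"
        unfolding M_def soft_kernel_denom n_def using \<eta> by (simp add: norm_mult power_mult_distrib algebra_simps)
      also have "2 * \<eta>^2 / (\<eta>^2 * n)^2 = pompeiu_weight s / \<eta>^2"
        using \<eta> n0 unfolding pompeiu_weight_def n_def[symmetric] by (simp add: field_simps power2_eq_square)
      finally show ?thesis using \<eta> by simp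
    qed
    show ?thesis unfolding 1 2 3 ..
  qed
  have "(\<lambda>n. LINT z|lborel. D z * soft_kernel (1 / real (Suc n)) \<zeta> z) \<longlonglongrightarrow> cauchy D \<zeta>"
    by (rule pompeiu_limit_kernel[OF D])
  moreover have "(\<lambda>n. LINT z|lborel. D z * soft_kernel (1 / real (Suc n)) \<zeta> z) \<longlonglongrightarrow> - (LINT s|lborel. G \<zeta> * of_real (pompeiu_weight s))"
  proof -
    have pos: "1 / real (Suc n) > 0" for n by simp
    show ?thesis unfolding eq[OF pos] by (intro tendsto_minus pompeiu_limit_average[OF cc(1)])
  qed
  ultimately have "cauchy D \<zeta> = - (LINT s|lborel. G \<zeta> * of_real (pompeiu_weight s))"
    by (rule LIMSEQ_unique)
  also have "\<dots> = - (G \<zeta> * of_real pompeiu_const)"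
    unfolding pompeiu_const_def by (simp only: integral_mult_right_zero integral_complex_of_real)
  finally show ?thesis unfolding D_def by simp
qed

section \<open>Moments and decay of Cauchy transforms\<close>

definition moment :: "complex \<Rightarrow> nat \<Rightarrow> (complex \<Rightarrow> complex) \<Rightarrow> complex" where
  "moment a l \<rho> = (LINT z|lborel. \<rho> z * (z - a)^l)"

text \<open>Compact support inside \<open>V\<close>, rather than mere vanishing off
  \<open>V\<close>: for \<open>V = - K\<close> with \<open>K\<close> compact, it keeps the density
  at positive distance from \<open>K\<close>, so that its transform is holomorphic near
  \<open>K\<close>.\<close>

definition Cc_in :: "complex set \<Rightarrow> (complex \<Rightarrow> complex) \<Rightarrow> bool" where
  "Cc_in V \<rho> \<longleftrightarrow> continuous_on UNIV \<rho> \<and> (\<exists>S. compact S \<and> S \<subseteq> V \<and> (\<forall>z. z \<notin> S \<longrightarrow> \<rho> z = 0))"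

lemma Cc_in_Cc: "Cc_in V \<rho> \<Longrightarrow> Cc \<rho>"
  unfolding Cc_in_def Cc_def by (blast intro: bounded_subset[OF compact_imp_bounded])

lemma Cc_in_zero: "Cc_in V (\<lambda>z. 0)"
  unfolding Cc_in_def by (auto intro!: exI[of _ "{}"])

lemma Cc_in_linear:
  assumes "Cc_in V f" "Cc_in V g" shows "Cc_in V (\<lambda>z. f z + c * g z)"
proof -
  from assms obtain S T where "compact S" "S \<subseteq> V" "\<forall>z. z \<notin> S \<longrightarrow> f z = 0" "compact T" "T \<subseteq> V" "\<forall>z. z \<notin> T \<longrightarrow> g z = 0"
    unfolding Cc_in_def by blast
  then show ?thesis using assms unfolding Cc_in_def
    by (auto intro!: continuous_intros exI[of _ "S \<union> T"])
qed

lemma Cc_in_sum: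
  "(\<And>i. i \<in> A \<Longrightarrow> Cc_in V (f i)) \<Longrightarrow> Cc_in V (\<lambda>z. \<Sum>i\<in>A. c i * f i z)"
proof (induction A rule: infinite_finite_induct)
  case (insert x F)
  then have "Cc_in V (\<lambda>z. (\<Sum>i\<in>F. c i * f i z) + c x * f x z)" by (intro Cc_in_linear) auto
  then show ?case using insert by (simp add: add.commute)
qed (auto intro: Cc_in_zero)

lemma moment_integrable: "Cc \<rho> \<Longrightarrow> integrable lborel (\<lambda>z. \<rho> z * (z - a)^l)"
  by (intro Cc_integrable Cc_mult) (auto intro!: continuous_intros)

lemma moment_linear:
  assumes "Cc f" "Cc g" shows "moment a l (\<lambda>z. f z + c * g z) = moment a l f + c * moment a l g"
  using moment_integrable[OF assms(1), of a l] moment_integrable[OF assms(2), of a l]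
  unfolding moment_def by (simp add: algebra_simps)

text \<open>Finite geometric expansion of \<open>1 / (z - \<zeta>)\<close> about \<open>a\<close>,
  whose remainder is again a Cauchy transform. The condition \<open>\<rho> \<zeta> = 0\<close> makes
  the pointwise identity hold at \<open>z = \<zeta>\<close> too, where the quotients are 0 by
  convention.\<close>

lemma cauchy_expansion:
  assumes "Cc \<rho>" "\<rho> \<zeta> = 0"
  shows "(\<zeta> - a)^Suc k * cauchy \<rho> \<zeta> =
    - (\<Sum>l\<le>k. (\<zeta> - a)^(k - l) * moment a l \<rho>) + cauchy (\<lambda>z. \<rho> z * (z - a)^Suc k) \<zeta>"
proof -
  have pt: "(\<zeta> - a)^Suc k * (\<rho> z / (z - \<zeta>)) =
     \<rho> z * (z - a)^Suc k / (z - \<zeta>) - (\<Sum>l\<le>k. (\<zeta> - a)^(k - l) * (\<rho> z * (z - a)^l))" for z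
  proof (cases "z = \<zeta>")
    case False
    have "(z - a)^Suc k - (\<zeta> - a)^Suc k = (z - \<zeta>) * (\<Sum>l\<le>k. (\<zeta> - a)^(k - l) * (z - a)^l)"
      using power_diff_sumr2[of "z - a" "Suc k" "\<zeta> - a"] by (simp add: lessThan_Suc_atMost)
    then have "(\<Sum>l\<le>k. (\<zeta> - a)^(k - l) * (z - a)^l) = ((z - a)^Suc k - (\<zeta> - a)^Suc k) / (z - \<zeta>)"
      using False by simp
    moreover have "(\<Sum>l\<le>k. (\<zeta> - a)^(k - l) * (\<rho> z * (z - a)^l)) = \<rho> z * (\<Sum>l\<le>k. (\<zeta> - a)^(k - l) * (z - a)^l)"
      by (simp add: sum_distrib_left mult_ac)
    ultimately show ?thesis by (simp add: diff_divide_distrib right_diff_distrib mult_ac)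
  qed (use assms in auto)
  have i1: "integrable lborel (\<lambda>z. \<rho> z * (z - a)^Suc k / (z - \<zeta>))"
    by (intro Cc_cauchy_integrable Cc_mult assms) (auto intro!: continuous_intros)
  have i2: "integrable lborel (\<lambda>z. (\<zeta> - a)^(k - l) * (\<rho> z * (z - a)^l))" for l
    by (intro integrable_mult_right moment_integrable assms)
  have "(\<zeta> - a)^Suc k * cauchy \<rho> \<zeta> = (LINT z|lborel. (\<zeta> - a)^Suc k * (\<rho> z / (z - \<zeta>)))"
    unfolding cauchy_def by (rule integral_mult_right_zero[symmetric])
  also have "\<dots> = (LINT z|lborel. \<rho> z * (z - a)^Suc k / (z - \<zeta>)) - (LINT z|lborel. (\<Sum>l\<le>k. (\<zeta> - a)^(k - l) * (\<rho> z * (z - a)^l)))"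
    unfolding pt using i1 i2 by (intro Bochner_Integration.integral_diff Bochner_Integration.integrable_sum) auto
  also have "(LINT z|lborel. (\<Sum>l\<le>k. (\<zeta> - a)^(k - l) * (\<rho> z * (z - a)^l))) = (\<Sum>l\<le>k. (\<zeta> - a)^(k - l) * moment a l \<rho>)"
    using i2 by (subst Bochner_Integration.integral_sum) (auto simp: moment_def)
  finally show ?thesis by (simp add: cauchy_def)
qed

lemma cauchy_far_bound:
  assumes "Cc g" "\<And>z. g z \<noteq> 0 \<Longrightarrow> z \<in> ball a r" "cmod (\<zeta> - a) \<ge> 2 * r" "r > 0"
  shows "cmod (cauchy g \<zeta>) \<le> 2 / cmod (\<zeta> - a) * (LINT z|lborel. cmod (g z))"
proof -
  have "cmod (cauchy g \<zeta>) \<le> (LINT z|lborel. cmod (g z / (z - \<zeta>)))"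
    unfolding cauchy_def by (rule integral_norm_bound)
  also have "\<dots> \<le> (LINT z|lborel. 2 / cmod (\<zeta> - a) * cmod (g z))"
  proof (rule integral_mono)
    show "integrable lborel (\<lambda>z. cmod (g z / (z - \<zeta>)))"
      using Cc_cauchy_integrable[OF assms(1)] by (intro integrable_norm)
    show "integrable lborel (\<lambda>z. 2 / cmod (\<zeta> - a) * cmod (g z))"
      by (intro integrable_mult_right integrable_norm Cc_integrable assms)
    show "cmod (g z / (z - \<zeta>)) \<le> 2 / cmod (\<zeta> - a) * cmod (g z)" for z
    proof (cases "g z = 0")
      case False
      then have "cmod (z - a) < r" using assms(2)[OF False] by (simp add: dist_norm norm_minus_commute)
      moreover have "cmod (\<zeta> - a) \<le> cmod (z - a) + cmod (z - \<zeta>)"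
        using norm_triangle_ineq4[of "z - a" "z - \<zeta>"] by simp
      ultimately have h: "cmod (\<zeta> - a) / 2 \<le> cmod (z - \<zeta>)" using assms(3) by simp
      have "0 < cmod (\<zeta> - a)" using assms(3,4) by linarith
      then have "1 / cmod (z - \<zeta>) \<le> 1 / (cmod (\<zeta> - a) / 2)" by (intro frac_le h) auto
      then have "1 / cmod (z - \<zeta>) * cmod (g z) \<le> 2 / cmod (\<zeta> - a) * cmod (g z)" by (intro mult_right_mono) auto
      then show ?thesis by (simp add: norm_divide)
    qed auto
  qed
  finally show ?thesis by simp
qed

text \<open>The derivative is the integral of \<open>\<rho> z / (z - \<zeta>0)^2\<close>. The
  positive distance \<open>d\<close> from \<open>\<zeta>0\<close> to the support makes the error of
  the linear approximation quadratic in \<open>\<zeta> - \<zeta>0\<close>.\<close>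

lemma cauchy_holomorphic:
  assumes "continuous_on UNIV \<rho>" "compact S" "\<And>z. z \<notin> S \<Longrightarrow> \<rho> z = 0"
  shows "cauchy \<rho> holomorphic_on - S"
proof -
  have c: "Cc \<rho>" by (rule Cc_in_Cc[of S]) (use assms in \<open>auto simp: Cc_in_def\<close>)
  have "\<exists>D. (cauchy \<rho> has_field_derivative D) (at \<zeta>0)" if z0: "\<zeta>0 \<notin> S" for \<zeta>0
  proof -
    obtain d where d: "d > 0" "ball \<zeta>0 d \<subseteq> - S"
      using z0 assms(2) by (meson ComplI compact_imp_closed open_Compl openE)
    have far: "d \<le> cmod (z - \<zeta>0)" if "\<rho> z \<noteq> 0" for z
    proof -
      have "z \<in> S" using that assms(3) by blast
      then have "z \<notin> ball \<zeta>0 d" using d by blast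
      then show ?thesis by (simp add: dist_norm norm_minus_commute)
    qed
    define A where "A = (LINT z|lborel. \<rho> z / (z - \<zeta>0)^2)"
    define J where "J = (LINT z|lborel. cmod (\<rho> z))"
    have ni: "integrable lborel (\<lambda>z. cmod (\<rho> z))" by (intro integrable_norm Cc_integrable c)
    have J0: "J \<ge> 0" unfolding J_def by simp
    have [measurable]: "\<rho> \<in> borel_measurable borel" using Cc_measurable[OF c] .
    have Ai: "integrable lborel (\<lambda>z. \<rho> z / (z - \<zeta>0)^2)"
    proof (rule Bochner_Integration.integrable_bound)
      show "integrable lborel (\<lambda>z. cmod (\<rho> z) * (1 / d^2))" using ni by (intro integrable_mult_left)
      show "AE z in lborel. norm (\<rho> z / (z - \<zeta>0)^2) \<le> norm (cmod (\<rho> z) * (1 / d^2))"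
      proof (rule AE_I2)
        fix z show "norm (\<rho> z / (z - \<zeta>0)^2) \<le> norm (cmod (\<rho> z) * (1 / d^2))"
        proof (cases "\<rho> z = 0")
          case False
          then have "d^2 \<le> (cmod (z - \<zeta>0))^2" using far d by (intro power_mono) auto
          then have "cmod (\<rho> z) / (cmod (z - \<zeta>0))^2 \<le> cmod (\<rho> z) / d^2" using d by (intro frac_le) auto
          then show ?thesis by (simp add: norm_divide norm_power)
        qed auto
      qed
    qed measurable
    have est: "cmod (cauchy \<rho> \<zeta> - cauchy \<rho> \<zeta>0 - A * (\<zeta> - \<zeta>0)) \<le> 2 / d^3 * J * (cmod (\<zeta> - \<zeta>0))^2"
      if near: "cmod (\<zeta> - \<zeta>0) < d / 2" for \<zeta>
    proof -
      have eq: "cauchy \<rho> \<zeta> - cauchy \<rho> \<zeta>0 - A * (\<zeta> - \<zeta>0) =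
         (LINT z|lborel. \<rho> z / (z - \<zeta>) - \<rho> z / (z - \<zeta>0) - \<rho> z / (z - \<zeta>0)^2 * (\<zeta> - \<zeta>0))"
        unfolding cauchy_def A_def using Cc_cauchy_integrable(1)[OF c] Ai
        by (simp only: Bochner_Integration.integral_diff Bochner_Integration.integrable_diff integral_mult_left_zero integrable_mult_left)
      have "cmod (cauchy \<rho> \<zeta> - cauchy \<rho> \<zeta>0 - A * (\<zeta> - \<zeta>0)) \<le>
         (LINT z|lborel. cmod (\<rho> z / (z - \<zeta>) - \<rho> z / (z - \<zeta>0) - \<rho> z / (z - \<zeta>0)^2 * (\<zeta> - \<zeta>0)))"
        unfolding eq by (rule integral_norm_bound)
      also have "\<dots> \<le> (LINT z|lborel. 2 / d^3 * (cmod (\<zeta> - \<zeta>0))^2 * cmod (\<rho> z))"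
      proof (rule integral_mono)
        show "integrable lborel (\<lambda>z. cmod (\<rho> z / (z - \<zeta>) - \<rho> z / (z - \<zeta>0) - \<rho> z / (z - \<zeta>0)^2 * (\<zeta> - \<zeta>0)))"
          using Cc_cauchy_integrable(1)[OF c] Ai
          by (intro integrable_norm Bochner_Integration.integrable_diff integrable_mult_left) auto
        show "integrable lborel (\<lambda>z. 2 / d^3 * (cmod (\<zeta> - \<zeta>0))^2 * cmod (\<rho> z))"
          using ni by (intro integrable_mult_right)
        show "cmod (\<rho> z / (z - \<zeta>) - \<rho> z / (z - \<zeta>0) - \<rho> z / (z - \<zeta>0)^2 * (\<zeta> - \<zeta>0))
           \<le> 2 / d^3 * (cmod (\<zeta> - \<zeta>0))^2 * cmod (\<rho> z)" for z
        proof (cases "\<rho> z = 0")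
          case False
          define p q where "p = z - \<zeta>" and "q = z - \<zeta>0"
          have q: "d \<le> cmod q" using far[OF False] by (simp add: q_def)
          have "cmod q \<le> cmod p + cmod (\<zeta> - \<zeta>0)"
            using norm_triangle_ineq[of p "\<zeta> - \<zeta>0"] by (simp add: p_def q_def)
          then have p: "d / 2 \<le> cmod p" using q near by linarith
          have nz: "p \<noteq> 0" "q \<noteq> 0" using p q d by auto
          \<comment> \<open>Here \<open>q - p = \<zeta> - \<zeta>0\<close>, so this exact remainder
            carries the quadratic factor, while \<open>p\<close> and \<open>q\<close> are bounded
            below by \<open>d / 2\<close> and \<open>d\<close>.\<close>
          have "\<rho> z / p - \<rho> z / q - \<rho> z / q^2 * (q - p) = \<rho> z * (q - p)^2 / (p * q^2)"
            using nz by (simp add: field_simps power2_eq_square)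
          then have "cmod (\<rho> z / p - \<rho> z / q - \<rho> z / q^2 * (q - p)) = cmod (\<rho> z) * (cmod (q - p))^2 / (cmod p * (cmod q)^2)"
            by (simp add: norm_divide norm_mult norm_power)
          also have "\<dots> \<le> cmod (\<rho> z) * (cmod (q - p))^2 / (d / 2 * d^2)"
            using p q d by (intro divide_left_mono mult_mono power_mono mult_pos_pos) (auto simp: nz)
          also have "\<dots> = 2 / d^3 * (cmod (q - p))^2 * cmod (\<rho> z)"
            using d by (simp add: field_simps power2_eq_square power3_eq_cube)
          finally show ?thesis by (simp add: p_def q_def)
        qed auto
      qed
      also have "\<dots> = 2 / d^3 * J * (cmod (\<zeta> - \<zeta>0))^2" by (simp add: J_def)
      finally show ?thesis .
    qed
    have "(cauchy \<rho> has_field_derivative A) (at \<zeta>0)"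
      unfolding has_field_derivative_def has_derivative_at_alt
    proof (intro conjI allI impI)
      show "bounded_linear ((*) A)" by (rule bounded_linear_mult_right)
      fix e :: real assume e: "e > 0"
      define Q where "Q = 2 / d^3 * J + 1"
      have Q: "Q > 0" unfolding Q_def using J0 d by (intro add_nonneg_pos) auto
      show "\<exists>d>0. \<forall>y. cmod (y - \<zeta>0) < d \<longrightarrow> cmod (cauchy \<rho> y - cauchy \<rho> \<zeta>0 - A * (y - \<zeta>0)) \<le> e * cmod (y - \<zeta>0)"
      proof (intro exI[of _ "min (d/2) (e / Q)"] conjI allI impI)
        show "0 < min (d/2) (e / Q)" using d e Q by simp
        fix y assume y: "cmod (y - \<zeta>0) < min (d/2) (e / Q)"
        then have "Q * cmod (y - \<zeta>0) \<le> e" using Q by (simp add: field_simps)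
        then have "Q * cmod (y - \<zeta>0) * cmod (y - \<zeta>0) \<le> e * cmod (y - \<zeta>0)" by (intro mult_right_mono) auto
        moreover have "2 / d^3 * J * (cmod (y - \<zeta>0))^2 \<le> Q * (cmod (y - \<zeta>0))^2"
          by (intro mult_right_mono) (auto simp: Q_def)
        ultimately show "cmod (cauchy \<rho> y - cauchy \<rho> \<zeta>0 - A * (y - \<zeta>0)) \<le> e * cmod (y - \<zeta>0)"
          using est[of y] y by (simp add: power2_eq_square)
      qed
    qed
    then show ?thesis by blast
  qed
  then show ?thesis
    by (metis ComplD field_differentiable_at_within field_differentiable_def holomorphic_onI)
qed

text \<open>A Schwarz lemma at infinity. In the coordinate \<open>s = 1 / (\<zeta> - a)\<close> the
  vanishing moments give the transform a zero of order at least \<open>k + 1\<close> at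
  \<open>s = 0\<close>; the quotient \<open>w\<close> extends holomorphically with value
  \<open>- moment a k \<rho>\<close> there. The maximum principle on the disc of radius
  \<open>1 / r\<close> yields the decay, and its value at the centre yields the moment
  bound.\<close>

lemma cauchy_decay:
  assumes \<rho>: "Cc_in (ball a r) \<rho>" and r: "r > 0"
    and mom: "\<And>l. l < k \<Longrightarrow> moment a l \<rho> = 0" and M: "\<And>\<zeta>. cmod (cauchy \<rho> \<zeta>) \<le> M"
  shows "cmod (\<zeta> - a) \<ge> r \<Longrightarrow> cmod (cauchy \<rho> \<zeta>) \<le> M * (r / cmod (\<zeta> - a))^Suc k"
    and "cmod (moment a k \<rho>) \<le> M * r^Suc k"
proof -
  obtain S where S: "compact S" "S \<subseteq> ball a r" "\<And>z. z \<notin> S \<Longrightarrow> \<rho> z = 0" "continuous_on UNIV \<rho>"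
    using \<rho> unfolding Cc_in_def by blast
  note c = Cc_in_Cc[OF \<rho>]
  define g where "g z = \<rho> z * (z - a)^Suc k" for z
  have gc: "Cc g" unfolding g_def by (intro Cc_mult c) (auto intro!: continuous_intros)
  have ex: "(\<zeta> - a)^Suc k * cauchy \<rho> \<zeta> = - moment a k \<rho> + cauchy g \<zeta>" if "\<zeta> \<notin> S" for \<zeta>
  proof -
    have "(\<Sum>l\<le>k. (\<zeta> - a)^(k - l) * moment a l \<rho>) = (\<Sum>l\<in>{k}. (\<zeta> - a)^(k - l) * moment a l \<rho>)"
      by (rule sum.mono_neutral_right) (auto simp: mom)
    then show ?thesis using cauchy_expansion[OF c S(3)[OF that], of a k] by (simp add: g_def[abs_def])
  qed
  define w where "w s = (if s = 0 then - moment a k \<rho> else cauchy \<rho> (a + 1 / s) / s^Suc k)" for s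
  have out: "a + 1 / s \<notin> S" if "s \<noteq> 0" "cmod s \<le> 1 / r" for s
  proof -
    have "r \<le> cmod (1 / s)" using that r by (simp add: norm_divide field_simps)
    then have "a + 1 / s \<notin> ball a r" by (simp add: dist_norm)
    then show ?thesis using S by blast
  qed
  define U where "U = {s. s \<noteq> 0 \<and> a + 1 / s \<notin> S}"
  have comp: "(\<lambda>s. cauchy \<rho> (a + 1 / s) / s^Suc k) holomorphic_on U"
  proof -
    have "(cauchy \<rho> \<circ> (\<lambda>s. a + 1 / s)) holomorphic_on U"
      by (rule holomorphic_on_compose_gen[OF _ cauchy_holomorphic[OF S(4,1,3)]])
         (auto simp: U_def intro!: holomorphic_intros)
    then show ?thesis unfolding o_def by (intro holomorphic_intros) (auto simp: U_def)
  qed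
  have comp_c: "isCont w s" if "s \<noteq> 0" "cmod s \<le> 1 / r" for s
  proof -
    have cl: "closed S" using S(1) by (rule compact_imp_closed)
    have "open ((-{0}) \<inter> (\<lambda>s. a + 1 / s) -` (- S))"
      by (rule continuous_open_preimage) (use cl in \<open>auto intro!: continuous_intros\<close>)
    moreover have "(-{0}) \<inter> (\<lambda>s. a + 1 / s) -` (- S) = U" by (auto simp: U_def)
    ultimately have oU: "open U" by simp
    have sU: "s \<in> U" using that out by (auto simp: U_def)
    have "continuous_on U w"
      by (rule continuous_on_eq[OF holomorphic_on_imp_continuous_on[OF comp]]) (auto simp: U_def w_def)
    then show ?thesis using oU sU continuous_on_eq_continuous_at by blast
  qed
  define J where "J = (LINT z|lborel. cmod (g z))"
  have J0: "J \<ge> 0" unfolding J_def by simp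
  \<comment> \<open>By \<open>ex\<close>, \<open>w s\<close> differs from its value at 0 by a Cauchy
    transform evaluated at \<open>a + 1 / s\<close>, which is of order \<open>cmod s\<close>. The
    summand 1 in \<open>2 * J + 1\<close> only prevents division by zero.\<close>
  have w0: "isCont w 0"
    unfolding continuous_at_eps_delta
  proof (intro allI impI)
    fix e :: real assume e: "e > 0"
    show "\<exists>d>0. \<forall>s. dist s 0 < d \<longrightarrow> dist (w s) (w 0) < e"
    proof (intro exI[of _ "min (1 / (2 * r)) (e / (2 * J + 1))"] conjI allI impI)
      show "0 < min (1 / (2 * r)) (e / (2 * J + 1))" using r e J0 by auto
      fix s :: complex assume s: "dist s 0 < min (1 / (2 * r)) (e / (2 * J + 1))"
      show "dist (w s) (w 0) < e"
      proof (cases "s = 0")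
        case False
        have s1: "cmod s < 1 / (2 * r)" "cmod s < e / (2 * J + 1)" using s by auto
        have "1 / (2 * r) \<le> 1 / r" using r by (intro frac_le) auto
        then have "a + 1 / s \<notin> S" using out[OF False] s1 by simp
        from ex[OF this] have "w s = - moment a k \<rho> + cauchy g (a + 1 / s)"
          using False by (simp add: w_def power_one_over field_simps)
        then have "dist (w s) (w 0) = cmod (cauchy g (a + 1 / s))" by (simp add: w_def dist_norm)
        also have "\<dots> \<le> 2 / cmod (a + 1 / s - a) * J" unfolding J_def
        proof (rule cauchy_far_bound[OF gc _ _ r])
          show "z \<in> ball a r" if "g z \<noteq> 0" for z
          proof -
            have "\<rho> z \<noteq> 0" using that by (auto simp: g_def)
            then show ?thesis using S(2,3) by blast
          qed
          show "2 * r \<le> cmod (a + 1 / s - a)" using s1 r False by (simp add: norm_divide field_simps)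
        qed
        also have "\<dots> = cmod s * (2 * J)" by (simp add: norm_divide)
        also have "\<dots> \<le> cmod s * (2 * J + 1)" by (intro mult_left_mono) auto
        also have "\<dots> < e" using s1(2) J0 by (simp add: pos_less_divide_eq add_nonneg_pos)
        finally show ?thesis .
      qed (use e in auto)
    qed
  qed
  have cont: "continuous_on (cball 0 (1/r)) w"
    using comp_c w0 by (intro continuous_at_imp_continuous_on) (metis dist_0_norm mem_cball)
  have hol: "w holomorphic_on ball 0 (1/r)"
  proof (rule no_isolated_singularity[where K="{0}"])
    show "continuous_on (ball 0 (1/r)) w" using cont by (rule continuous_on_subset) auto
    have "w holomorphic_on U"
      by (rule holomorphic_transform[OF comp]) (auto simp: U_def w_def)
    moreover have "ball 0 (1/r) - {0} \<subseteq> U" using out by (auto simp: U_def)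
    ultimately show "w holomorphic_on ball 0 (1/r) - {0}" by (rule holomorphic_on_subset)
  qed auto
  have bd: "cmod (w s) \<le> M * r^Suc k" if "s \<in> cball 0 (1/r)" for s
  proof (rule maximum_modulus_frontier[of w "cball 0 (1/r)"])
    show "w holomorphic_on interior (cball 0 (1/r))" using hol by simp
    show "continuous_on (closure (cball 0 (1/r))) w" using cont by simp
    fix z assume "z \<in> frontier (cball (0::complex) (1/r))"
    then have z: "cmod z = 1 / r" using r by (auto simp: frontier_cball dist_norm)
    then have "z \<noteq> 0" using r by auto
    then have "cmod (w z) = cmod (cauchy \<rho> (a + 1 / z)) * r^Suc k"
      using z by (simp add: w_def norm_divide norm_mult norm_power power_one_over field_simps)
    also have "\<dots> \<le> M * r^Suc k" using M r by (intro mult_right_mono) auto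
    finally show "cmod (w z) \<le> M * r^Suc k" .
  qed (use that in auto)
  show "cmod (moment a k \<rho>) \<le> M * r^Suc k" using bd[of 0] r by (simp add: w_def)
  assume \<zeta>: "cmod (\<zeta> - a) \<ge> r"
  then have v0: "cmod (\<zeta> - a) > 0" using r by linarith
  define s where "s = 1 / (\<zeta> - a)"
  have "s \<noteq> 0" "a + 1 / s = \<zeta>" using v0 by (auto simp: s_def)
  moreover have "cmod s \<le> 1 / r" unfolding s_def norm_divide norm_one using \<zeta> r by (intro frac_le) auto
  ultimately have "cmod (cauchy \<rho> \<zeta>) / (cmod s)^Suc k \<le> M * r^Suc k"
    using bd[of s] by (simp add: w_def norm_divide norm_mult norm_power)
  moreover have "cmod s = 1 / cmod (\<zeta> - a)" by (simp add: s_def norm_divide)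
  ultimately show "cmod (cauchy \<rho> \<zeta>) \<le> M * (r / cmod (\<zeta> - a))^Suc k"
    using v0 by (simp add: power_divide field_simps)
qed

text \<open>Among densities in \<open>V\<close> with vanishing lower moments and transform bounded
  by 1, the \<open>k\<close>-th moment is bounded by \<open>cauchy_decay\<close>, so its supremum is
  finite. Choosing \<open>\<sigma>\<close> to reach half of it gives the factor 2; a general
  \<open>\<rho>\<close> is compared after division by \<open>M\<close>.\<close>

lemma near_extremal_density:
  assumes V: "V \<subseteq> ball a r" and r: "r > 0"
  obtains \<sigma> where "Cc_in V \<sigma>" "\<And>l. l < k \<Longrightarrow> moment a l \<sigma> = 0" "\<And>\<zeta>. cmod (cauchy \<sigma> \<zeta>) \<le> 1"
    "\<And>\<rho> M. Cc_in V \<rho> \<Longrightarrow> (\<And>l. l < k \<Longrightarrow> moment a l \<rho> = 0) \<Longrightarrow> (\<And>\<zeta>. cmod (cauchy \<rho> \<zeta>) \<le> M) \<Longrightarrow>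
      cmod (moment a k \<rho>) \<le> 2 * M * cmod (moment a k \<sigma>)"
proof -
  define P where "P \<rho> M \<longleftrightarrow> Cc_in V \<rho> \<and> (\<forall>l<k. moment a l \<rho> = 0) \<and> (\<forall>\<zeta>. cmod (cauchy \<rho> \<zeta>) \<le> M)" for \<rho> M
  define Z where "Z = {cmod (moment a k \<rho>) |\<rho>. P \<rho> 1}"
  have inb: "Cc_in V \<rho> \<Longrightarrow> Cc_in (ball a r) \<rho>" for \<rho> using V unfolding Cc_in_def by blast
  have ub: "cmod (moment a k \<rho>) \<le> M * r^Suc k" if "P \<rho> M" for \<rho> M
    using cauchy_decay(2)[OF inb r, of \<rho> k M] that unfolding P_def by blast
  have bdd: "bdd_above Z" unfolding Z_def using ub[of _ 1] by (intro bdd_aboveI[of _ "1 * r^Suc k"]) blast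
  have P0: "P (\<lambda>z. 0) M" if "M \<ge> 0" for M
    unfolding P_def using that by (simp add: Cc_in_zero moment_def cauchy_def)
  have 0: "0 \<in> Z" unfolding Z_def using P0[of 1] by (auto simp: moment_def intro!: exI[of _ "\<lambda>z. 0"])
  define s where "s = Sup Z"
  have s0: "s \<ge> 0" unfolding s_def using cSup_upper[OF 0 bdd] .
  have scale: "cmod (moment a k \<rho>) \<le> M * s" if p: "P \<rho> M" for \<rho> M
  proof -
    have M0: "M \<ge> 0" using p norm_ge_zero order_trans unfolding P_def by blast
    show ?thesis
    proof (cases "M = 0")
      \<comment> \<open>Normalization by \<open>M\<close> is impossible here, but the a priori bound
        already forces the moment to be 0.\<close>
      case True then show ?thesis using ub[OF p] by simp
    next
      case False
      with M0 have Mp: "M > 0" by simp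
      define c where "c = complex_of_real (1 / M)"
      have cc: "Cc \<rho>" using p Cc_in_Cc unfolding P_def by blast
      have cl: "cauchy (\<lambda>z. 0 + c * \<rho> z) \<zeta> = 0 + c * cauchy \<rho> \<zeta>" for \<zeta>
        using cauchy_linear[OF Cc_zero cc] by (simp add: cauchy_def)
      have ml: "moment a l (\<lambda>z. 0 + c * \<rho> z) = 0 + c * moment a l \<rho>" for l
        using moment_linear[OF Cc_zero cc] by (simp add: moment_def)
      have "P (\<lambda>z. 0 + c * \<rho> z) 1"
        unfolding P_def cl ml
      proof (intro conjI allI impI)
        show "Cc_in V (\<lambda>z. 0 + c * \<rho> z)" using p by (intro Cc_in_linear Cc_in_zero) (auto simp: P_def)
        show "0 + c * moment a l \<rho> = 0" if "l < k" for l using p that by (simp add: P_def)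
        show "cmod (0 + c * cauchy \<rho> \<zeta>) \<le> 1" for \<zeta>
          using p Mp unfolding P_def c_def by (simp add: norm_mult norm_divide field_simps)
      qed
      then have "cmod (moment a k (\<lambda>z. 0 + c * \<rho> z)) \<le> s"
        unfolding s_def by (intro cSup_upper[OF _ bdd]) (auto simp: Z_def)
      then have "cmod (0 + c * moment a k \<rho>) \<le> s" unfolding ml .
      then show ?thesis unfolding c_def using Mp by (simp add: norm_mult norm_divide field_simps)
    qed
  qed
  obtain \<sigma> where \<sigma>: "P \<sigma> 1" "s \<le> 2 * cmod (moment a k \<sigma>)"
  proof (cases "s = 0")
    case True
    then show ?thesis using that[of "\<lambda>z. 0"] P0[of 1] by auto
  next
    case False
    then have "s / 2 < Sup Z" using s0 unfolding s_def by simp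
    then obtain x where "x \<in> Z" "s / 2 < x" using less_cSupD[of Z "s/2"] 0 by blast
    then show ?thesis using that unfolding Z_def by force
  qed
  show ?thesis
  proof
    show "Cc_in V \<sigma>" "\<And>l. l < k \<Longrightarrow> moment a l \<sigma> = 0" "\<And>\<zeta>. cmod (cauchy \<sigma> \<zeta>) \<le> 1" using \<sigma> by (auto simp: P_def)
    fix \<rho> M assume h: "Cc_in V \<rho>" "\<And>l. l < k \<Longrightarrow> moment a l \<rho> = 0" "\<And>\<zeta>. cmod (cauchy \<rho> \<zeta>) \<le> M"
    then have "P \<rho> M" by (simp add: P_def)
    then have "cmod (moment a k \<rho>) \<le> M * s" by (rule scale)
    also have "\<dots> \<le> M * (2 * cmod (moment a k \<sigma>))"
      using \<sigma>(2) order_trans[OF norm_ge_zero h(3)[of 0]] by (intro mult_left_mono)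
    finally show "cmod (moment a k \<rho>) \<le> 2 * M * cmod (moment a k \<sigma>)" by simp
  qed
qed

text \<open>The correction \<open>q\<close> depends on \<open>\<rho>\<close> only through its first \<open>k\<close> moments. No capacity estimate is needed:
  near-extremal densities in \<open>V\<close> serve as correctors, and \<open>\<rho>\<close> itself competes in the extremal problem.\<close>
lemma moment_correctors:
  assumes V: "V \<subseteq> ball a r" and r: "r > 0"
  shows "\<exists>q. (\<forall>l<k. Cc_in V (q l)) \<and> (\<forall>\<rho> M. Cc_in V \<rho> \<longrightarrow> (\<forall>\<zeta>. cmod (cauchy \<rho> \<zeta>) \<le> M) \<longrightarrow>
     (\<forall>j<k. moment a j (\<lambda>z. \<rho> z - (\<Sum>l<k. moment a l \<rho> * q l z)) = 0) \<and>
     (\<forall>\<zeta>. cmod (cauchy (\<lambda>z. \<rho> z - (\<Sum>l<k. moment a l \<rho> * q l z)) \<zeta>) \<le> 3^k * M))"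
proof (induction k)
  case 0
  show ?case by simp
next
  case (Suc k)
  then obtain q where q0: "\<forall>l<k. Cc_in V (q l)" and q1: "\<forall>\<rho> M. Cc_in V \<rho> \<longrightarrow> (\<forall>\<zeta>. cmod (cauchy \<rho> \<zeta>) \<le> M) \<longrightarrow>
     (\<forall>j<k. moment a j (\<lambda>z. \<rho> z - (\<Sum>l<k. moment a l \<rho> * q l z)) = 0) \<and>
     (\<forall>\<zeta>. cmod (cauchy (\<lambda>z. \<rho> z - (\<Sum>l<k. moment a l \<rho> * q l z)) \<zeta>) \<le> 3^k * M)"
    by (elim exE conjE)
  have q: "\<And>l. l < k \<Longrightarrow> Cc_in V (q l)" using q0 by blast
  have qm: "\<And>\<rho> M j. Cc_in V \<rho> \<Longrightarrow> (\<And>\<zeta>. cmod (cauchy \<rho> \<zeta>) \<le> M) \<Longrightarrow> j < k \<Longrightarrow>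
       moment a j (\<lambda>z. \<rho> z - (\<Sum>l<k. moment a l \<rho> * q l z)) = 0"
    using q1 by blast
  have qc: "\<And>\<rho> M \<zeta>. Cc_in V \<rho> \<Longrightarrow> (\<And>\<zeta>. cmod (cauchy \<rho> \<zeta>) \<le> M) \<Longrightarrow>
       cmod (cauchy (\<lambda>z. \<rho> z - (\<Sum>l<k. moment a l \<rho> * q l z)) \<zeta>) \<le> 3^k * M"
    using q1 by blast
  obtain \<sigma> where \<sigma>: "Cc_in V \<sigma>" "\<And>l. l < k \<Longrightarrow> moment a l \<sigma> = 0" "\<And>\<zeta>. cmod (cauchy \<sigma> \<zeta>) \<le> 1"
    "\<And>\<rho> M. Cc_in V \<rho> \<Longrightarrow> (\<And>l. l < k \<Longrightarrow> moment a l \<rho> = 0) \<Longrightarrow> (\<And>\<zeta>. cmod (cauchy \<rho> \<zeta>) \<le> M) \<Longrightarrow>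
      cmod (moment a k \<rho>) \<le> 2 * M * cmod (moment a k \<sigma>)"
    by (rule near_extremal_density[OF V r, of k]) blast
  define m where "m = moment a k \<sigma>"
  \<comment> \<open>The aim is to subtract from the corrected density \<open>\<rho>'\<close> the
    multiple of \<open>\<sigma>\<close> that kills its \<open>k\<close>-th moment. That moment is
    \<open>moment a k \<rho>\<close> minus a linear combination of the lower moments of
    \<open>\<rho>\<close>; distributing its coefficients over the moments of \<open>\<rho>\<close>
    gives \<open>q'\<close>.\<close>
  define q' where "q' l = (if l < k then (\<lambda>z. q l z + (- moment a k (q l) / m) * \<sigma> z) else (\<lambda>z. 0 + (1 / m) * \<sigma> z))" for l
  show ?case
  proof (intro exI[of _ q'] conjI allI impI)
    show "Cc_in V (q' l)" for l
      unfolding q'_def using q[of l] \<sigma>(1) by (cases "l < k") (simp_all only: if_True if_False Cc_in_linear Cc_in_zero)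
    fix \<rho> M assume \<rho>: "Cc_in V \<rho>" and M: "\<forall>\<zeta>. cmod (cauchy \<rho> \<zeta>) \<le> M"
    define \<rho>' where "\<rho>' z = \<rho> z - (\<Sum>l<k. moment a l \<rho> * q l z)" for z
    define t where "t = moment a k \<rho>' / m"
    have sumin: "Cc_in V (\<lambda>z. \<Sum>l<k. moment a l \<rho> * q l z)" by (rule Cc_in_sum) (use q in auto)
    have \<rho>'in: "Cc_in V \<rho>'"
      unfolding \<rho>'_def using Cc_in_linear[OF \<rho> sumin, of "-1"] by simp
    have m': "moment a j \<rho>' = moment a j \<rho> - (\<Sum>l<k. moment a l \<rho> * moment a j (q l))" for j
    proof -
      have "moment a j (\<lambda>z. \<Sum>l<k. moment a l \<rho> * q l z) = (\<Sum>l<k. moment a l \<rho> * moment a j (q l))"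
      proof -
        have "integrable lborel (\<lambda>z. moment a l \<rho> * (q l z * (z - a)^j))" if "l < k" for l
          using q[OF that] by (intro integrable_mult_right moment_integrable Cc_in_Cc)
        then show ?thesis unfolding moment_def sum_distrib_right mult.assoc
          by (subst Bochner_Integration.integral_sum) (auto simp: moment_def)
      qed
      then show ?thesis unfolding \<rho>'_def
        using moment_linear[OF Cc_in_Cc[OF \<rho>] Cc_in_Cc[OF sumin], of a j "-1"] by simp
    qed
    have k0: "moment a j \<rho>' = 0" if "j < k" for j
      unfolding \<rho>'_def using qm[OF \<rho> _ that] M by blast
    have kc: "cmod (cauchy \<rho>' \<zeta>) \<le> 3^k * M" for \<zeta>
      unfolding \<rho>'_def using qc[OF \<rho>] M by blast
    have mk: "cmod (moment a k \<rho>') \<le> 2 * (3^k * M) * cmod m"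
      unfolding m_def using \<sigma>(4)[OF \<rho>'in k0 kc] .
    have M0: "M \<ge> 0" using M norm_ge_zero order_trans by blast
    \<comment> \<open>If \<open>m = 0\<close>, then \<open>t = 0\<close> by the convention for
      division; the identity survives because \<open>mk\<close> forces the moment of
      \<open>\<rho>'\<close> to vanish.\<close>
    have tm: "t * m = moment a k \<rho>'" using mk by (cases "m = 0") (auto simp: t_def)
    have tb: "cmod t \<le> 2 * (3^k * M)"
      using mk M0 by (cases "m = 0") (auto simp: t_def norm_divide divide_le_eq)
    have eq: "(\<lambda>z. \<rho> z - (\<Sum>l<Suc k. moment a l \<rho> * q' l z)) = (\<lambda>z. \<rho>' z + (-t) * \<sigma> z)"
    proof
      fix z
      have "(\<Sum>l<k. moment a l \<rho> * q' l z) = (\<Sum>l<k. moment a l \<rho> * q l z - moment a l \<rho> * moment a k (q l) * (\<sigma> z / m))"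
        by (intro sum.cong) (auto simp: q'_def algebra_simps)
      also have "\<dots> = (\<Sum>l<k. moment a l \<rho> * q l z) - (\<Sum>l<k. moment a l \<rho> * moment a k (q l)) * (\<sigma> z / m)"
        by (simp only: sum_subtractf sum_distrib_right)
      finally have "(\<Sum>l<Suc k. moment a l \<rho> * q' l z) = (\<Sum>l<k. moment a l \<rho> * q l z) + moment a k \<rho>' * (\<sigma> z / m)"
        unfolding m' by (simp add: q'_def algebra_simps)
      then show "\<rho> z - (\<Sum>l<Suc k. moment a l \<rho> * q' l z) = \<rho>' z + (-t) * \<sigma> z"
        by (simp add: \<rho>'_def t_def)
    qed
    note c1 = Cc_in_Cc[OF \<rho>'in] and c2 = Cc_in_Cc[OF \<sigma>(1)]
    show "moment a j (\<lambda>z. \<rho> z - (\<Sum>l<Suc k. moment a l \<rho> * q' l z)) = 0" if "j < Suc k" for j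
      unfolding eq moment_linear[OF c1 c2]
      using that k0[of j] \<sigma>(2)[of j] tm unfolding m_def by (cases "j = k") auto
    fix \<zeta>
    have "cmod (cauchy \<rho>' \<zeta> + (-t) * cauchy \<sigma> \<zeta>) \<le> cmod (cauchy \<rho>' \<zeta>) + cmod t * cmod (cauchy \<sigma> \<zeta>)"
      by (rule norm_triangle_le) (simp add: norm_mult)
    \<comment> \<open>Each stage multiplies the bound by \<open>1 + 2\<close>, the 2 being the loss
      from a near-extremal \<open>\<sigma>\<close>.\<close>
    also have "\<dots> \<le> 3^k * M + 2 * (3^k * M) * 1"
      using M0 by (intro add_mono mult_mono kc tb \<sigma>(3)) auto
    finally show "cmod (cauchy (\<lambda>z. \<rho> z - (\<Sum>l<Suc k. moment a l \<rho> * q' l z)) \<zeta>) \<le> 3^Suc k * M"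
      unfolding eq cauchy_linear[OF c1 c2] by (simp add: mult_ac)
  qed
qed

text \<open>The case \<open>k = 3\<close>: \<open>27 = 3^3\<close>, and three vanishing moments give
  decay of order 4. By linearity of \<open>cauchy\<close> the correction can be stated for
  transforms instead of densities, with the same fixed functions \<open>q l\<close> for every
  \<open>\<rho>\<close>.\<close>

lemma localized_correctors:
  assumes V: "V \<subseteq> ball a r" and r: "r > 0"
  obtains q where "\<And>l::nat. l < 3 \<Longrightarrow> Cc_in V (q l)"
    "\<And>\<rho> M \<zeta>. Cc_in V \<rho> \<Longrightarrow> (\<And>\<zeta>. cmod (cauchy \<rho> \<zeta>) \<le> M) \<Longrightarrow>
      cmod (cauchy \<rho> \<zeta> - (\<Sum>l<3. moment a l \<rho> * cauchy (q l) \<zeta>)) \<le> 27 * M"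
    "\<And>\<rho> M \<zeta>. Cc_in V \<rho> \<Longrightarrow> (\<And>\<zeta>. cmod (cauchy \<rho> \<zeta>) \<le> M) \<Longrightarrow> cmod (\<zeta> - a) \<ge> r \<Longrightarrow>
      cmod (cauchy \<rho> \<zeta> - (\<Sum>l<3. moment a l \<rho> * cauchy (q l) \<zeta>)) \<le> 27 * M * (r / cmod (\<zeta> - a))^4"
proof -
  obtain q where q0: "\<forall>l<3. Cc_in V (q l)" and q1: "\<forall>\<rho> M. Cc_in V \<rho> \<longrightarrow> (\<forall>\<zeta>. cmod (cauchy \<rho> \<zeta>) \<le> M) \<longrightarrow>
     (\<forall>j<3. moment a j (\<lambda>z. \<rho> z - (\<Sum>l<3. moment a l \<rho> * q l z)) = 0) \<and>
     (\<forall>\<zeta>. cmod (cauchy (\<lambda>z. \<rho> z - (\<Sum>l<3. moment a l \<rho> * q l z)) \<zeta>) \<le> 3^3 * M)"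
    using moment_correctors[OF V r, of 3] by (elim exE conjE)
  have q: "\<And>l. l < 3 \<Longrightarrow> Cc_in V (q l)" using q0 by blast
  have qm: "\<And>\<rho> M j. Cc_in V \<rho> \<Longrightarrow> (\<And>\<zeta>. cmod (cauchy \<rho> \<zeta>) \<le> M) \<Longrightarrow> j < 3 \<Longrightarrow>
       moment a j (\<lambda>z. \<rho> z - (\<Sum>l<3. moment a l \<rho> * q l z)) = 0"
    using q1 by blast
  have qc: "\<And>\<rho> M \<zeta>. Cc_in V \<rho> \<Longrightarrow> (\<And>\<zeta>. cmod (cauchy \<rho> \<zeta>) \<le> M) \<Longrightarrow>
       cmod (cauchy (\<lambda>z. \<rho> z - (\<Sum>l<3. moment a l \<rho> * q l z)) \<zeta>) \<le> 3^3 * M"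
    using q1 by blast
  have sumin: "Cc_in V (\<lambda>z. \<Sum>l<3. moment a l \<rho> * q l z)" for \<rho> by (rule Cc_in_sum) (use q in auto)
  have eq: "cauchy (\<lambda>z. \<rho> z - (\<Sum>l<3. moment a l \<rho> * q l z)) \<zeta> = cauchy \<rho> \<zeta> - (\<Sum>l<3. moment a l \<rho> * cauchy (q l) \<zeta>)"
    if "Cc_in V \<rho>" for \<rho> \<zeta>
  proof -
    have "cauchy (\<lambda>z. \<Sum>l<3. moment a l \<rho> * q l z) \<zeta> = (\<Sum>l<3. moment a l \<rho> * cauchy (q l) \<zeta>)"
    proof -
      have "cauchy (\<lambda>z. c * q l z) \<zeta> = c * cauchy (q l) \<zeta>" if "l < 3" for l c
        using cauchy_linear[OF Cc_zero Cc_in_Cc[OF q[OF that]], of c \<zeta>] by (simp add: cauchy_def)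
      then show ?thesis using q by (subst cauchy_sum) (auto intro!: Cc_cmult intro: Cc_in_Cc)
    qed
    then show ?thesis using cauchy_linear[OF Cc_in_Cc[OF that] Cc_in_Cc[OF sumin], of "-1"] by simp
  qed
  show ?thesis
  proof
    show "Cc_in V (q l)" if "l < 3" for l using q that .
    fix \<rho> M \<zeta> assume h: "Cc_in V \<rho>" "\<And>\<zeta>. cmod (cauchy \<rho> \<zeta>) \<le> M"
    show "cmod (cauchy \<rho> \<zeta> - (\<Sum>l<3. moment a l \<rho> * cauchy (q l) \<zeta>)) \<le> 27 * M"
      using qc[OF h] unfolding eq[OF h(1)] by simp
    assume far: "cmod (\<zeta> - a) \<ge> r"
    have "Cc_in V (\<lambda>z. \<rho> z - (\<Sum>l<3. moment a l \<rho> * q l z))"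
      using Cc_in_linear[OF h(1) sumin, of "-1"] by simp
    then have "Cc_in (ball a r) (\<lambda>z. \<rho> z - (\<Sum>l<3. moment a l \<rho> * q l z))"
      using V unfolding Cc_in_def by blast
    then have "cmod (cauchy (\<lambda>z. \<rho> z - (\<Sum>l<3. moment a l \<rho> * q l z)) \<zeta>) \<le> 3^3 * M * (r / cmod (\<zeta> - a))^Suc 3"
      by (rule cauchy_decay(1)[OF _ r _ _ far]) (use qm[OF h] qc[OF h] in blast)+
    then show "cmod (cauchy \<rho> \<zeta> - (\<Sum>l<3. moment a l \<rho> * cauchy (q l) \<zeta>)) \<le> 27 * M * (r / cmod (\<zeta> - a))^4"
      unfolding eq[OF h(1)] by (simp add: numeral_eq_Suc)
  qed
qed

section \<open>A smooth partition of unity on a square grid\<close>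

text \<open>A quadratic spline rising from 0 to 1 on the unit interval; its derivative is the hat
  function with peak 2 at \<open>1/2\<close>. It is explicit and has the one continuous derivative
  that \<open>C1_on\<close> asks for.\<close>

definition step :: "real \<Rightarrow> real" where
  "step x = 2 * (max 0 x)^2 - 4 * (max 0 (x - 1/2))^2 + 2 * (max 0 (x - 1))^2"

definition step' :: "real \<Rightarrow> real" where
  "step' x = 4 * max 0 x - 8 * max 0 (x - 1/2) + 4 * max 0 (x - 1)"

text \<open>A difference of neighbouring translates of \<open>step\<close>, so that sums over
  integer translates telescope; this is what makes the partition of unity exact.\<close>

definition bump :: "real \<Rightarrow> real" where "bump x = step (x + 1) - step x"

definition bump' :: "real \<Rightarrow> real" where "bump' x = step' (x + 1) - step' x"

lemma has_real_derivative_pos_part_square: "((\<lambda>x::real. (max 0 x)^2) has_real_derivative 2 * max 0 x) (at x)"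
proof -
  consider "x > 0" | "x < 0" | "x = 0" by linarith
  then show ?thesis
  proof cases
    case 1
    have "((\<lambda>x::real. x^2) has_real_derivative 2 * max 0 x) (at x)"
      using 1 by (auto intro!: derivative_eq_intros)
    then show ?thesis
      by (rule has_field_derivative_transform_within_open[where S="{0<..}"]) (use 1 in auto)
  next
    case 2
    have "((\<lambda>x::real. 0) has_real_derivative 2 * max 0 x) (at x)" using 2 by simp
    then show ?thesis
      by (rule has_field_derivative_transform_within_open[where S="{..<0}"]) (use 2 in auto)
  next
    case 3
    have "((\<lambda>x::real. (max 0 x)^2) has_derivative (\<lambda>h. 0)) (at 0)"
      unfolding has_derivative_at_alt
    proof (intro conjI allI impI)
      fix e :: real assume e: "e > 0"
      show "\<exists>d>0. \<forall>y::real. norm (y - 0) < d \<longrightarrow> norm ((max 0 y)^2 - (max 0 0)^2 - 0) \<le> e * norm (y - 0)"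
      proof (intro exI[of _ e] conjI allI impI)
        show "0 < e" by (rule e)
        fix y :: real assume y: "norm (y - 0) < e"
        have "(max 0 y)^2 \<le> \<bar>y\<bar> * \<bar>y\<bar>" by (auto simp: max_def power2_eq_square)
        also have "\<dots> \<le> e * \<bar>y\<bar>" using y by (intro mult_right_mono) auto
        finally show "norm ((max 0 y)^2 - (max 0 0)^2 - 0) \<le> e * norm (y - 0)" by simp
      qed
    qed simp
    moreover have "(*) 0 = (\<lambda>h::real. 0)" by auto
    ultimately show ?thesis using 3 by (simp add: has_field_derivative_def)
  qed
qed

lemma has_real_derivative_step: "(step has_real_derivative step' x) (at x)"
proof -
  have sh: "((\<lambda>x. (max 0 (x - c))^2) has_real_derivative 2 * max 0 (x - c)) (at x)" for c
    using has_real_derivative_pos_part_square[of "x + - c"] unfolding DERIV_shift by simp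
  show ?thesis unfolding step_def[abs_def] step'_def
    by (rule DERIV_cong, (rule DERIV_add DERIV_diff DERIV_cmult sh[of 0, simplified] sh)+, simp)
qed

lemma has_real_derivative_bump: "(bump has_real_derivative bump' x) (at x)"
  unfolding bump_def[abs_def] bump'_def
  using has_real_derivative_step[of "x + 1", unfolded DERIV_shift] has_real_derivative_step[of x]
  by (auto intro!: derivative_eq_intros)

lemma step'_range: "0 \<le> step' x" "step' x \<le> 2"
  by (auto simp: step'_def max_def)

lemma step_mono: "x \<le> y \<Longrightarrow> step x \<le> step y"
  using has_real_derivative_step step'_range(1) by (intro DERIV_nonneg_imp_nondecreasing[of x y step]) blast+

lemma step_0: "x \<le> 0 \<Longrightarrow> step x = 0"
  by (simp add: step_def)

lemma step_1: "x \<ge> 1 \<Longrightarrow> step x = 1"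
  by (simp add: step_def max_def power2_eq_square algebra_simps)

lemma step_range: "0 \<le> step x" "step x \<le> 1"
  using step_mono[of x "max x 1"] step_1[of "max x 1"] step_mono[of "min x 0" x] step_0[of "min x 0"] by auto

lemma bump_range: "0 \<le> bump x" "bump x \<le> 1"
  unfolding bump_def using step_mono[of x "x+1"] step_range[of x] step_range[of "x+1"] by auto

lemma bump_support: "\<bar>x\<bar> \<ge> 1 \<Longrightarrow> bump x = 0"
  unfolding bump_def using step_0[of x] step_0[of "x+1"] step_1[of x] step_1[of "x+1"] by (auto simp: abs_if split: if_splits)

lemma bump'_support: "\<bar>x\<bar> \<ge> 1 \<Longrightarrow> bump' x = 0"
  by (auto simp: bump'_def step'_def max_def abs_if split: if_splits)

lemma bump'_bound: "\<bar>bump' x\<bar> \<le> 2"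
  unfolding bump'_def using step'_range[of x] step'_range[of "x+1"] by auto

lemma continuous_bump': "continuous_on S bump'"
  unfolding bump'_def[abs_def] step'_def by (intro continuous_intros)

text \<open>Telescoping of \<open>bump (x - m) = step (x - m + 1) - step (x - m)\<close>.\<close>

lemma sum_bump: "(\<Sum>m\<in>{- int N..int N}. bump (x - of_int m)) = step (x + real N + 1) - step (x - real N)"
proof (induction N)
  case (Suc N)
  have "{- int (Suc N)..int (Suc N)} = insert (int (Suc N)) (insert (- int (Suc N)) {- int N..int N})" by auto
  then show ?case using Suc by (simp add: bump_def algebra_simps)
qed (simp add: bump_def)

section \<open>The partition of unity in the plane\<close>

definition grid :: "nat \<Rightarrow> (int \<times> int) set" where
  "grid N = {- int N..int N} \<times> {- int N..int N}"

definition gridpt :: "real \<Rightarrow> int \<times> int \<Rightarrow> complex" where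
  "gridpt \<delta> j = Complex (\<delta> * of_int (fst j)) (\<delta> * of_int (snd j))"

definition pou :: "real \<Rightarrow> int \<times> int \<Rightarrow> complex \<Rightarrow> real" where
  "pou \<delta> j z = bump (Re z / \<delta> - of_int (fst j)) * bump (Im z / \<delta> - of_int (snd j))"

definition poux :: "real \<Rightarrow> int \<times> int \<Rightarrow> complex \<Rightarrow> complex" where
  "poux \<delta> j z = of_real (bump' (Re z / \<delta> - of_int (fst j)) * bump (Im z / \<delta> - of_int (snd j)) / \<delta>)"

definition pouy :: "real \<Rightarrow> int \<times> int \<Rightarrow> complex \<Rightarrow> complex" where
  "pouy \<delta> j z = of_real (bump (Re z / \<delta> - of_int (fst j)) * bump' (Im z / \<delta> - of_int (snd j)) / \<delta>)"

lemma finite_grid [simp]: "finite (grid N)" by (simp add: grid_def)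

lemma pou_nonneg: "0 \<le> pou \<delta> j z" by (simp add: pou_def bump_range)

lemma pou_support_box:
  assumes "\<delta> > 0" "pou \<delta> j z \<noteq> 0 \<or> poux \<delta> j z \<noteq> 0 \<or> pouy \<delta> j z \<noteq> 0"
  shows "\<bar>Re (z - gridpt \<delta> j)\<bar> < \<delta>" "\<bar>Im (z - gridpt \<delta> j)\<bar> < \<delta>"
proof -
  have a: "\<bar>Re z / \<delta> - of_int (fst j)\<bar> < 1" "\<bar>Im z / \<delta> - of_int (snd j)\<bar> < 1"
    using assms bump_support bump'_support unfolding pou_def poux_def pouy_def
    by (metis mult_zero_left mult_zero_right div_0 of_real_0 not_le)+
  show "\<bar>Re (z - gridpt \<delta> j)\<bar> < \<delta>" "\<bar>Im (z - gridpt \<delta> j)\<bar> < \<delta>"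
  proof -
    have "Re (z - gridpt \<delta> j) = \<delta> * (Re z / \<delta> - of_int (fst j))" "Im (z - gridpt \<delta> j) = \<delta> * (Im z / \<delta> - of_int (snd j))"
      using assms(1) by (simp_all add: gridpt_def field_simps)
    then show "\<bar>Re (z - gridpt \<delta> j)\<bar> < \<delta>" "\<bar>Im (z - gridpt \<delta> j)\<bar> < \<delta>"
      using a assms(1) by (simp_all only: abs_mult) auto
  qed
qed

lemma pou_support:
  assumes "\<delta> > 0" "pou \<delta> j z \<noteq> 0 \<or> poux \<delta> j z \<noteq> 0 \<or> pouy \<delta> j z \<noteq> 0"
  shows "cmod (z - gridpt \<delta> j) < 2 * \<delta>"
  using pou_support_box[OF assms] cmod_le[of "z - gridpt \<delta> j"] by linarith

lemma C1_pou:
  assumes "\<delta> > 0"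
  shows "C1_on UNIV (\<lambda>z. of_real (pou \<delta> j z)) (poux \<delta> j) (pouy \<delta> j)"
proof -
  have bc: "continuous_on UNIV bump"
    using has_real_derivative_bump by (meson DERIV_continuous continuous_at_imp_continuous_on)
  have bc': "continuous_on S (\<lambda>z. bump (f z))" if "continuous_on S f" for S and f :: "complex \<Rightarrow> real"
    using continuous_on_compose2[OF bc that] by auto
  have bd': "continuous_on S (\<lambda>z. bump' (f z))" if "continuous_on S f" for S and f :: "complex \<Rightarrow> real"
    using continuous_on_compose2[OF continuous_bump' that] by auto
  have cx: "continuous_on UNIV (poux \<delta> j)" "continuous_on UNIV (pouy \<delta> j)"
    unfolding poux_def[abs_def] pouy_def[abs_def] using assms by (intro continuous_intros bc' bd'; simp)+
  have "((\<lambda>z. complex_of_real (pou \<delta> j z)) has_derivative (\<lambda>h. of_real (Re h) * poux \<delta> j z + of_real (Im h) * pouy \<delta> j z)) (at z)" for z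
  proof -
    let ?u = "\<lambda>z. Re z / \<delta> - of_int (fst j)" and ?v = "\<lambda>z. Im z / \<delta> - of_int (snd j)"
    have u: "((\<lambda>z. bump (?u z)) has_derivative (\<lambda>h. bump' (?u z) * (Re h / \<delta>))) (at z)"
    proof (rule has_derivative_compose[of ?u "\<lambda>h. Re h / \<delta>" z UNIV bump "(*) (bump' (?u z))"])
      show "(?u has_derivative (\<lambda>h. Re h / \<delta>)) (at z)"
        using \<open>\<delta> > 0\<close> by (auto intro!: derivative_eq_intros)
      show "(bump has_derivative (*) (bump' (?u z))) (at (?u z))"
        using has_real_derivative_bump[of "?u z"] unfolding has_field_derivative_def .
    qed
    have v: "((\<lambda>z. bump (?v z)) has_derivative (\<lambda>h. bump' (?v z) * (Im h / \<delta>))) (at z)"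
    proof (rule has_derivative_compose[of ?v "\<lambda>h. Im h / \<delta>" z UNIV bump "(*) (bump' (?v z))"])
      show "(?v has_derivative (\<lambda>h. Im h / \<delta>)) (at z)"
        using \<open>\<delta> > 0\<close> by (auto intro!: derivative_eq_intros)
      show "(bump has_derivative (*) (bump' (?v z))) (at (?v z))"
        using has_real_derivative_bump[of "?v z"] unfolding has_field_derivative_def .
    qed
    have "((\<lambda>z. complex_of_real (bump (?u z) * bump (?v z))) has_derivative
       (\<lambda>h. of_real (bump (?u z) * (bump' (?v z) * (Im h / \<delta>)) + bump' (?u z) * (Re h / \<delta>) * bump (?v z)))) (at z)"
      by (intro has_derivative_of_real has_derivative_mult u v)
    then show ?thesis unfolding pou_def[abs_def]
      by (rule has_derivative_eq_rhs) (auto simp: poux_def pouy_def fun_eq_iff algebra_simps)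
  qed
  then show ?thesis unfolding C1_on_def using cx by auto
qed

lemma pou_dbar_bound:
  assumes "\<delta> > 0" shows "cmod (poux \<delta> j z + \<i> * pouy \<delta> j z) \<le> 4 / \<delta>"
proof -
  have b: "\<bar>bump' x * bump y / \<delta>\<bar> \<le> 2 / \<delta>" "\<bar>bump y * bump' x / \<delta>\<bar> \<le> 2 / \<delta>" for x y
  proof -
    have "\<bar>bump' x\<bar> * \<bar>bump y\<bar> \<le> 2 * 1" using bump'_bound[of x] bump_range[of y] by (intro mult_mono) auto
    then show "\<bar>bump' x * bump y / \<delta>\<bar> \<le> 2 / \<delta>" using assms by (simp add: abs_mult divide_right_mono)
    then show "\<bar>bump y * bump' x / \<delta>\<bar> \<le> 2 / \<delta>" by (simp add: mult.commute)
  qed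
  have "cmod (poux \<delta> j z + \<i> * pouy \<delta> j z) \<le> cmod (poux \<delta> j z) + cmod (pouy \<delta> j z)"
    by (rule norm_triangle_le) (simp add: norm_mult)
  also have "\<dots> \<le> 2 / \<delta> + 2 / \<delta>"
    unfolding poux_def pouy_def norm_of_real by (intro add_mono b)
  finally show ?thesis by simp
qed

lemma sum_pou:
  "(\<Sum>j\<in>grid N. pou \<delta> j z) = (step (Re z / \<delta> + real N + 1) - step (Re z / \<delta> - real N)) *
     (step (Im z / \<delta> + real N + 1) - step (Im z / \<delta> - real N))"
  unfolding grid_def pou_def sum_bump[symmetric]
  by (simp add: sum_product sum.cartesian_product case_prod_beta)

lemma sum_pou_eq_1:
  assumes "\<delta> > 0" "cmod z \<le> real N * \<delta>" shows "(\<Sum>j\<in>grid N. pou \<delta> j z) = 1"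
proof -
  have "\<bar>Re z\<bar> \<le> real N * \<delta>" "\<bar>Im z\<bar> \<le> real N * \<delta>"
    using assms(2) abs_Re_le_cmod[of z] abs_Im_le_cmod[of z] by linarith+
  then have "\<bar>Re z / \<delta>\<bar> \<le> N" "\<bar>Im z / \<delta>\<bar> \<le> N"
    using assms(1) by (simp_all add: abs_divide pos_divide_le_eq)
  then have "Re z / \<delta> + real N + 1 \<ge> 1" "Im z / \<delta> + real N + 1 \<ge> 1" "Re z / \<delta> - real N \<le> 0" "Im z / \<delta> - real N \<le> 0"
    by linarith+
  then show ?thesis unfolding sum_pou by (simp only: step_0 step_1) simp
qed

lemma sum_pou_le_1:
  assumes "A \<subseteq> grid N" shows "(\<Sum>j\<in>A. pou \<delta> j z) \<le> 1"
proof -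
  have "(\<Sum>j\<in>A. pou \<delta> j z) \<le> (\<Sum>j\<in>grid N. pou \<delta> j z)"
    using assms by (intro sum_mono2) (auto simp: pou_nonneg)
  also have "\<dots> \<le> 1 * 1"
    unfolding sum_pou
    using step_range[of "Re z / \<delta> + real N + 1"] step_range[of "Re z / \<delta> - real N"]
      step_range[of "Im z / \<delta> + real N + 1"] step_range[of "Im z / \<delta> - real N"]
      step_mono[of "Re z / \<delta> - real N" "Re z / \<delta> + real N + 1"] step_mono[of "Im z / \<delta> - real N" "Im z / \<delta> + real N + 1"]
    by (intro mult_mono) auto
  finally show ?thesis by simp
qed

text \<open>The subtracted term \<open>4 / (n + 1)\<close> carries the induction: the two new terms
  add at most \<open>4 / ((n + 1) * (n + 2))\<close>, exactly the increase of the right-hand side.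
  At \<open>n = 0\<close> there is equality.\<close>

lemma sum_inverse_squares_le: "(\<Sum>k\<in>{- int n..int n}. 1 / (1 + (of_int k)^2)) \<le> (5 - 4 / (real n + 1) :: real)"
proof (induction n)
  case (Suc n)
  have "{- int (Suc n)..int (Suc n)} = insert (int (Suc n)) (insert (- int (Suc n)) {- int n..int n})" by auto
  then have "(\<Sum>k\<in>{- int (Suc n)..int (Suc n)}. 1 / (1 + (of_int k)^2)) =
      2 / (1 + (real n + 1)^2) + (\<Sum>k\<in>{- int n..int n}. 1 / (1 + (of_int k)^2) :: real)"
    by (simp add: power2_eq_square algebra_simps)
  also have "2 / (1 + (real n + 1)^2) \<le> 4 / ((real n + 1) * (real n + 2))"
  proof -
    have "(real n + 1) * (real n + 2) \<le> 2 * (1 + (real n + 1)^2)" by (simp add: power2_eq_square algebra_simps)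
    moreover have "2 / Y \<le> 4 / P" if "0 < Y" "0 < P" "P \<le> 2 * Y" for P Y :: real
      using that by (simp add: divide_simps)
    ultimately show ?thesis by (simp add: add_pos_nonneg)
  qed
  also have "4 / ((real n + 1) * (real n + 2)) = 4 / (real n + 1) - 4 / (real n + 2)"
    by (simp add: field_simps)
  finally show ?case using Suc by (simp add: add.commute)
qed simp

text \<open>Replacing \<open>x\<close> by its floor costs a factor 3: with fractional part
  \<open>f \<le> 1\<close>, \<open>k^2 \<le> 2 * (k - f)^2 + 2 * f^2\<close> gives
  \<open>1 + k^2 \<le> 3 * (1 + (k - f)^2)\<close>. Hence \<open>15 = 3 * 5\<close>.\<close>

lemma sum_shifted_inverse_squares_le:
  assumes "finite A" shows "(\<Sum>m\<in>A. 1 / (1 + (x - of_int m)^2)) \<le> (15 :: real)"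
proof -
  define B where "B = (\<lambda>m. m - \<lfloor>x\<rfloor>) ` A"
  have fB: "finite B" using assms by (simp add: B_def)
  define n where "n = nat (Max (insert 0 (abs ` B)))"
  have "B \<subseteq> {- int n..int n}"
  proof
    fix k assume "k \<in> B"
    then have "\<bar>k\<bar> \<le> Max (insert 0 (abs ` B))" using fB by (intro Max_ge) auto
    then show "k \<in> {- int n..int n}" by (auto simp: n_def)
  qed
  have "1 / (1 + (x - of_int m)^2) \<le> 3 * (1 / (1 + (of_int (m - \<lfloor>x\<rfloor>))^2))" for m
  proof -
    define f k where "f = x - of_int \<lfloor>x\<rfloor>" and "k = real_of_int (m - \<lfloor>x\<rfloor>)"
    have f: "0 \<le> f" "f \<le> 1" unfolding f_def by linarith+
    have "f * f \<le> 1 * 1" using f by (intro mult_mono) auto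
    moreover have "k^2 \<le> 2 * (k - f)^2 + 2 * f^2"
      using zero_le_power2[of "k - 2 * f"] by (simp add: power2_eq_square algebra_simps)
    ultimately have "1 + k^2 \<le> 3 * (1 + (k - f)^2)"
      using zero_le_power2[of "k - f"] by (simp only: power2_eq_square[of f] distrib_left)
    moreover have "(k - f)^2 = (x - of_int m)^2" by (simp add: k_def f_def power2_commute)
    ultimately have "1 + k^2 \<le> 3 * (1 + (x - of_int m)^2)" by simp
    moreover have "1 / Y \<le> 3 * (1 / P)" if "0 < Y" "0 < P" "P \<le> 3 * Y" for P Y :: real
      using that by (simp add: divide_simps)
    ultimately show ?thesis by (simp add: k_def add_pos_nonneg)
  qed
  then have "(\<Sum>m\<in>A. 1 / (1 + (x - of_int m)^2)) \<le> (\<Sum>m\<in>A. 3 * (1 / (1 + (of_int (m - \<lfloor>x\<rfloor>))^2)))"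
    by (intro sum_mono)
  also have "\<dots> = 3 * (\<Sum>k\<in>B. 1 / (1 + (of_int k)^2))"
    unfolding B_def by (subst sum.reindex) (auto simp: inj_on_def sum_distrib_left)
  also have "(\<Sum>k\<in>B. 1 / (1 + (of_int k)^2)) \<le> (\<Sum>k\<in>{- int n..int n}. 1 / (1 + (of_int k)^2) :: real)"
    using \<open>B \<subseteq> _\<close> by (intro sum_mono2) auto
  also have "\<dots> \<le> 5" using sum_inverse_squares_le[of n] by (smt (verit) divide_nonneg_nonneg of_nat_0_le_iff)
  finally show ?thesis by simp
qed

text \<open>With \<open>u\<close> the distance in units of \<open>\<delta>\<close> and
  \<open>a\<close>, \<open>b\<close> its coordinates,
  \<open>(1 + a^2) * (1 + b^2) \<le> (1 + u^2)^2\<close>, so inverse fourth powers are dominated by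
  a product of one-dimensional terms. The factor 25 serves both ranges:
  \<open>(1 + u^2)^2 \<le> 25\<close> for \<open>u < 2\<close>, and
  \<open>16 / u^4 \<le> 25 / (1 + u^2)^2\<close> for \<open>u \<ge> 2\<close>. Finally
  \<open>5625 = 25 * 15 * 15\<close>.\<close>

lemma sum_grid_decay:
  fixes t :: "int \<times> int \<Rightarrow> real"
  assumes \<delta>: "\<delta> > 0" and M: "M \<ge> 0" and t1: "\<And>j. j \<in> grid N \<Longrightarrow> t j \<le> M"
    and t2: "\<And>j. j \<in> grid N \<Longrightarrow> cmod (\<zeta> - gridpt \<delta> j) \<ge> 2 * \<delta> \<Longrightarrow> t j \<le> M * (2 * \<delta> / cmod (\<zeta> - gridpt \<delta> j))^4"
  shows "(\<Sum>j\<in>grid N. t j) \<le> 5625 * M"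
proof -
  define a b where "a j = Re \<zeta> / \<delta> - of_int (fst j)" and "b j = Im \<zeta> / \<delta> - of_int (snd j)" for j :: "int \<times> int"
  have pt: "t j \<le> 25 * M * ((1 / (1 + (a j)^2)) * (1 / (1 + (b j)^2)))" if j: "j \<in> grid N" for j
  proof -
    define u where "u = cmod (\<zeta> - gridpt \<delta> j) / \<delta>"
    have u0: "u \<ge> 0" using \<delta> by (simp add: u_def)
    have u2: "u^2 = (a j)^2 + (b j)^2"
    proof -
      have "\<zeta> - gridpt \<delta> j = of_real \<delta> * Complex (a j) (b j)"
        using \<delta> by (simp add: complex_eq_iff gridpt_def a_def b_def field_simps)
      then have "u = cmod (Complex (a j) (b j))" using \<delta> by (simp add: u_def norm_mult)
      then show ?thesis by (simp add: cmod_def)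
    qed
    define p where "p = (1 + (a j)^2) * (1 + (b j)^2)"
    have p0: "p > 0" unfolding p_def by (intro mult_pos_pos add_pos_nonneg) auto
    have "(1 + A) * (1 + B) \<le> (1 + (A + B))^2" if "A \<ge> 0" "B \<ge> 0" for A B :: real
      using that mult_nonneg_nonneg[OF that] by (simp add: power2_eq_square algebra_simps)
    then have pu: "p \<le> (1 + u^2)^2" unfolding p_def u2 by simp
    have "t j \<le> M * (25 / p)"
    proof (cases "u \<ge> 2")
      case False
      have "u * u \<le> 2 * 2" using False u0 by (intro mult_mono) auto
      then have "(1 + u^2)^2 \<le> 5^2" by (intro power_mono) (auto simp: power2_eq_square)
      then have "p \<le> 25" using pu by simp
      then have "1 \<le> 25 / p" using p0 by simp
      then have "M * 1 \<le> M * (25 / p)" using M by (intro mult_left_mono)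
      then show ?thesis using t1[OF j] by simp
    next
      case True
      have "2 * 2 \<le> u * u" using True by (intro mult_mono) auto
      then have "1 + u^2 \<le> 5/4 * u^2" by (simp add: power2_eq_square)
      then have "(1 + u^2)^2 \<le> (5/4 * u^2)^2" by (intro power_mono) auto
      also have "\<dots> = 25/16 * u^4" by (simp add: power2_eq_square power4_eq_xxxx)
      finally have "p \<le> 25/16 * u^4" using pu by simp
      then have "25 / (25/16 * u^4) \<le> 25 / p" using p0 by (intro frac_le) auto
      then have "16 / u^4 \<le> 25 / p" by simp
      moreover have "(2 * \<delta> / cmod (\<zeta> - gridpt \<delta> j))^4 = 16 / u^4"
        using \<delta> by (simp add: u_def power_divide power_mult_distrib)
      moreover have "cmod (\<zeta> - gridpt \<delta> j) \<ge> 2 * \<delta>" using True \<delta> by (simp add: u_def field_simps)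
      ultimately show ?thesis using t2[OF j] M by (smt (verit) mult_left_mono)
    qed
    then show ?thesis by (simp add: p_def mult.commute)
  qed
  have "(\<Sum>j\<in>grid N. t j) \<le> (\<Sum>j\<in>grid N. 25 * M * ((1 / (1 + (a j)^2)) * (1 / (1 + (b j)^2))))"
    by (intro sum_mono pt)
  also have "\<dots> = 25 * M * ((\<Sum>m\<in>{- int N..int N}. 1 / (1 + (Re \<zeta> / \<delta> - of_int m)^2)) * (\<Sum>n\<in>{- int N..int N}. 1 / (1 + (Im \<zeta> / \<delta> - of_int n)^2)))"
  proof -
    have "(\<Sum>j\<in>A \<times> B. F (fst j) * G (snd j)) = (\<Sum>m\<in>A. F m) * (\<Sum>n\<in>B. G n)" for A B :: "int set" and F G :: "int \<Rightarrow> real"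
      by (simp add: sum_product sum.cartesian_product case_prod_beta)
    from this[of "\<lambda>m. 1 / (1 + (Re \<zeta> / \<delta> - of_int m)^2)" "\<lambda>m. 1 / (1 + (Im \<zeta> / \<delta> - of_int m)^2)"]
    show ?thesis unfolding sum_distrib_left[symmetric] a_def b_def grid_def by (simp only:)
  qed
  also have "\<dots> \<le> 25 * M * (15 * 15)"
    using M by (intro mult_left_mono mult_mono sum_shifted_inverse_squares_le sum_nonneg) auto
  finally show ?thesis by simp
qed

section \<open>Vitushkin localization\<close>

text \<open>Sampling with partition-of-unity weights: the sum is smooth in \<open>z\<close> on the
  whole plane and linear in \<open>f\<close>, and its sample points do not depend on
  \<open>w\<close>. The weights sum to 1 on \<open>K\<close>, which gives the approximation, and to
  at most 1 everywhere, which gives the bound \<open>M\<close> also off \<open>K\<close>.\<close>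

lemma finite_rank_approx:
  fixes f :: "complex \<Rightarrow> 'w \<Rightarrow> complex"
  assumes K: "compact K" and M: "M \<ge> 0" and \<epsilon>: "\<epsilon> > 0"
    and equi: "\<And>e. e > 0 \<Longrightarrow> \<exists>d>0. \<forall>z\<in>K. \<forall>z'\<in>K. cmod (z - z') < d \<longrightarrow> (\<forall>w\<in>W. cmod (f z w - f z' w) \<le> e)"
    and bd: "\<And>z w. z \<in> K \<Longrightarrow> w \<in> W \<Longrightarrow> cmod (f z w) \<le> M"
  obtains \<delta> A p where "0 < \<delta>" "finite A" "\<And>j. j \<in> A \<Longrightarrow> p j \<in> K"
    "\<And>j z. j \<in> A \<Longrightarrow> pou \<delta> j z \<noteq> 0 \<Longrightarrow> cmod (z - p j) < 1"
    "\<And>z w. z \<in> K \<Longrightarrow> w \<in> W \<Longrightarrow> cmod (f z w - (\<Sum>j\<in>A. of_real (pou \<delta> j z) * f (p j) w)) \<le> \<epsilon>"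
    "\<And>z w. w \<in> W \<Longrightarrow> cmod (\<Sum>j\<in>A. of_real (pou \<delta> j z) * f (p j) w) \<le> M"
proof -
  obtain d where d: "d > 0" "\<And>z z' w. z \<in> K \<Longrightarrow> z' \<in> K \<Longrightarrow> cmod (z - z') < d \<Longrightarrow> w \<in> W \<Longrightarrow> cmod (f z w - f z' w) \<le> \<epsilon>"
    using equi[OF \<epsilon>] by blast
  \<comment> \<open>Two points of one patch are less than \<open>4 * \<delta>\<close> apart. The
    bound by \<open>d\<close> makes \<open>f\<close> vary by at most \<open>\<epsilon>\<close> on a
    patch; the bound by 1 keeps the approximant supported within distance 1 of
    \<open>K\<close>.\<close>
  define \<delta> where "\<delta> = min d 1 / 4"
  have \<delta>: "\<delta> > 0" "4 * \<delta> \<le> d" "4 * \<delta> \<le> 1" using d by (auto simp: \<delta>_def)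
  obtain R where R: "\<And>z. z \<in> K \<Longrightarrow> cmod z \<le> R" using compact_imp_bounded[OF K] unfolding bounded_iff by blast
  obtain N :: nat where N: "R / \<delta> \<le> N" using real_arch_simple by blast
  have RN: "R \<le> real N * \<delta>" using N \<delta>(1) by (simp add: field_simps)
  define A where "A = {j \<in> grid N. \<exists>z\<in>K. pou \<delta> j z \<noteq> 0}"
  define p where "p j = (SOME z. z \<in> K \<and> pou \<delta> j z \<noteq> 0)" for j
  have p: "p j \<in> K" "pou \<delta> j (p j) \<noteq> 0" if "j \<in> A" for j
    using that someI_ex[of "\<lambda>z. z \<in> K \<and> pou \<delta> j z \<noteq> 0"] unfolding A_def p_def by blast+
  have near: "cmod (z - p j) < 4 * \<delta>" if "j \<in> A" "pou \<delta> j z \<noteq> 0" for j z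
    using pou_support[OF \<delta>(1), of j z] pou_support[OF \<delta>(1), of j "p j"] p[OF that(1)] that(2)
      norm_triangle_ineq4[of "z - gridpt \<delta> j" "p j - gridpt \<delta> j"] by auto
  have AN: "A \<subseteq> grid N" by (auto simp: A_def)
  have sum1: "(\<Sum>j\<in>A. pou \<delta> j z) = 1" if "z \<in> K" for z
  proof -
    have "(\<Sum>j\<in>A. pou \<delta> j z) = (\<Sum>j\<in>grid N. pou \<delta> j z)"
      using that by (intro sum.mono_neutral_left) (auto simp: A_def)
    then show ?thesis using sum_pou_eq_1[OF \<delta>(1)] R[OF that] RN by auto
  qed
  show ?thesis
  proof (rule that[of \<delta> A p])
    show "0 < \<delta>" "finite A" using \<delta> AN finite_subset[OF AN] by auto
    show "p j \<in> K" if "j \<in> A" for j using p that by auto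
    show "cmod (z - p j) < 1" if "j \<in> A" "pou \<delta> j z \<noteq> 0" for j z using near[OF that] \<delta> by auto
    show "cmod (f z w - (\<Sum>j\<in>A. of_real (pou \<delta> j z) * f (p j) w)) \<le> \<epsilon>" if z: "z \<in> K" and w: "w \<in> W" for z w
    proof -
      have "f z w = (\<Sum>j\<in>A. of_real (pou \<delta> j z)) * f z w" using sum1[OF z] by (simp flip: of_real_sum)
      then have "f z w - (\<Sum>j\<in>A. of_real (pou \<delta> j z) * f (p j) w) = (\<Sum>j\<in>A. of_real (pou \<delta> j z) * (f z w - f (p j) w))"
        by (simp add: sum_distrib_right right_diff_distrib sum_subtractf)
      also have "cmod \<dots> \<le> (\<Sum>j\<in>A. pou \<delta> j z * \<epsilon>)"
      proof (rule sum_norm_le)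
        fix j assume j: "j \<in> A"
        show "cmod (of_real (pou \<delta> j z) * (f z w - f (p j) w)) \<le> pou \<delta> j z * \<epsilon>"
        proof (cases "pou \<delta> j z = 0")
          case False
          then have "cmod (f z w - f (p j) w) \<le> \<epsilon>"
            using near[OF j False] \<delta>(2) p[OF j] by (intro d(2) z w) auto
          then show ?thesis by (simp add: norm_mult pou_nonneg mult_left_mono)
        qed simp
      qed
      also have "\<dots> = \<epsilon>" using sum1[OF z] by (simp flip: sum_distrib_right)
      finally show ?thesis .
    qed
    show "cmod (\<Sum>j\<in>A. of_real (pou \<delta> j z) * f (p j) w) \<le> M" if w: "w \<in> W" for z w
    proof -
      have "cmod (\<Sum>j\<in>A. of_real (pou \<delta> j z) * f (p j) w) \<le> (\<Sum>j\<in>A. pou \<delta> j z * M)"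
        using bd[OF p(1) w] by (intro sum_norm_le) (simp add: norm_mult pou_nonneg mult_left_mono)
      also have "\<dots> = (\<Sum>j\<in>A. pou \<delta> j z) * M" by (simp add: sum_distrib_right)
      also have "\<dots> \<le> 1 * M" using sum_pou_le_1[OF AN] M by (intro mult_right_mono)
      finally show ?thesis by simp
    qed
  qed
qed

text \<open>The sum of the patches centred within \<open>3 * \<delta>\<close> of \<open>K\<close>. A
  patch active at a point within \<open>\<delta>\<close> of \<open>K\<close> is among them, so the
  sum is 1 there; their supports reach at most \<open>2 * \<delta> + 3 * \<delta> = e\<close> away
  from \<open>K\<close>.\<close>

lemma smooth_cutoff:
  fixes K V :: "complex set"
  assumes K: "compact K" and V: "open V" "K \<subseteq> V"
  obtains \<psi> :: "complex \<Rightarrow> real" and \<psi>x \<psi>y V0 T where "C1_on UNIV (\<lambda>z. of_real (\<psi> z)) \<psi>x \<psi>y"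
    "\<And>z. 0 \<le> \<psi> z" "\<And>z. \<psi> z \<le> 1" "open V0" "K \<subseteq> V0" "\<And>z. z \<in> V0 \<Longrightarrow> \<psi> z = 1"
    "compact T" "T \<subseteq> V" "\<And>z. z \<notin> T \<Longrightarrow> \<psi> z = 0"
proof -
  obtain e where e: "e > 0" "(\<Union>x\<in>K. cball x e) \<subseteq> V"
    using compact_subset_open_imp_cball_epsilon_subset[OF K V] by blast
  define \<delta> where "\<delta> = e / 5"
  have \<delta>: "\<delta> > 0" using e by (simp add: \<delta>_def)
  obtain R where R: "\<And>z. z \<in> K \<Longrightarrow> cmod z \<le> R" using compact_imp_bounded[OF K] unfolding bounded_iff by blast
  obtain N :: nat where N: "(R + \<delta>) / \<delta> \<le> N" using real_arch_simple by blast
  have RN: "R + \<delta> \<le> real N * \<delta>" using N \<delta>(1) by (simp add: field_simps)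
  define A where "A = {j \<in> grid N. \<exists>x\<in>K. cmod (x - gridpt \<delta> j) < 3 * \<delta>}"
  have AN: "A \<subseteq> grid N" by (auto simp: A_def)
  have fA: "finite A" using finite_subset[OF AN] by auto
  define \<psi> where "\<psi> z = (\<Sum>j\<in>A. pou \<delta> j z)" for z
  define V0 where "V0 = (\<Union>x\<in>K. ball x \<delta>)"
  define T where "T = (\<Union>j\<in>A. cball (gridpt \<delta> j) (2 * \<delta>))"
  show ?thesis
  proof (rule that[of \<psi> "\<lambda>z. \<Sum>j\<in>A. poux \<delta> j z" "\<lambda>z. \<Sum>j\<in>A. pouy \<delta> j z" V0 T])
    show "C1_on UNIV (\<lambda>z. of_real (\<psi> z)) (\<lambda>z. \<Sum>j\<in>A. poux \<delta> j z) (\<lambda>z. \<Sum>j\<in>A. pouy \<delta> j z)"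
      unfolding \<psi>_def of_real_sum by (intro C1_on_sum C1_pou \<delta>)
    show "0 \<le> \<psi> z" "\<psi> z \<le> 1" for z unfolding \<psi>_def using sum_pou_le_1[OF AN] by (auto intro: sum_nonneg pou_nonneg)
    show "open V0" "K \<subseteq> V0" using \<delta> by (auto simp: V0_def)
    show "\<psi> z = 1" if "z \<in> V0" for z
    proof -
      obtain x where x: "x \<in> K" "cmod (z - x) < \<delta>" using \<open>z \<in> V0\<close> by (auto simp: V0_def dist_norm norm_minus_commute)
      have "cmod z \<le> R + \<delta>" using R[OF x(1)] x(2) norm_triangle_ineq2[of z x] by linarith
      then have "(\<Sum>j\<in>grid N. pou \<delta> j z) = 1" using RN by (intro sum_pou_eq_1 \<delta>) auto
      moreover have "\<psi> z = (\<Sum>j\<in>grid N. pou \<delta> j z)"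
        unfolding \<psi>_def
      proof (rule sum.mono_neutral_left)
        show "\<forall>j\<in>grid N - A. pou \<delta> j z = 0"
        proof (intro ballI, rule ccontr)
          fix j assume j: "j \<in> grid N - A" "pou \<delta> j z \<noteq> 0"
          then have "cmod (z - gridpt \<delta> j) < 2 * \<delta>" using pou_support[OF \<delta>] by blast
          then have "cmod (x - gridpt \<delta> j) < 3 * \<delta>"
            using x(2) norm_triangle_ineq[of "x - z" "z - gridpt \<delta> j"] by (simp add: norm_minus_commute)
          then show False using j x by (auto simp: A_def)
        qed
      qed (use AN in auto)
      ultimately show ?thesis by simp
    qed
    show "compact T" unfolding T_def using fA by auto
    show "T \<subseteq> V"
    proof
      fix z assume "z \<in> T"
      then obtain j x where j: "j \<in> A" "cmod (z - gridpt \<delta> j) \<le> 2 * \<delta>" "x \<in> K" "cmod (x - gridpt \<delta> j) < 3 * \<delta>"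
        by (auto simp: T_def A_def dist_norm norm_minus_commute)
      then have "cmod (x - z) \<le> e"
        using norm_triangle_ineq4[of "x - gridpt \<delta> j" "z - gridpt \<delta> j"] by (simp add: \<delta>_def)
      then have "z \<in> cball x e" by (simp add: dist_norm)
      then show "z \<in> V" using e(2) j(3) by blast
    qed
    show "\<psi> z = 0" if "z \<notin> T" for z
      unfolding \<psi>_def
    proof (intro sum.neutral ballI, rule ccontr)
      fix j assume "j \<in> A" "pou \<delta> j z \<noteq> 0"
      then show False using pou_support[OF \<delta>, of j z] that by (auto simp: T_def dist_norm norm_minus_commute)
    qed
  qed
qed

lemma C1_on_cong:
  assumes "C1_on S g gx gy" "open S" "\<And>z. z \<in> S \<Longrightarrow> g z = h z" "\<And>z. z \<in> S \<Longrightarrow> gx z = hx z" "\<And>z. z \<in> S \<Longrightarrow> gy z = hy z"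
  shows "C1_on S h hx hy"
proof -
  have "(h has_derivative (\<lambda>k. of_real (Re k) * hx z + of_real (Im k) * hy z)) (at z)" if z: "z \<in> S" for z
  proof -
    have "(g has_derivative (\<lambda>k. of_real (Re k) * hx z + of_real (Im k) * hy z)) (at z)"
      using assms(1,4,5) z unfolding C1_on_def by auto
    then show ?thesis by (rule has_derivative_transform_within_open[OF _ assms(2) z assms(3)])
  qed
  moreover have "continuous_on S hx" "continuous_on S hy"
    using assms(1,4,5) unfolding C1_on_def by (auto intro: continuous_on_eq)
  ultimately show ?thesis unfolding C1_on_def by blast
qed

lemma C1_on_Un:
  assumes "C1_on S g gx gy" "C1_on T g gx gy" "open S" "open T"
  shows "C1_on (S \<union> T) g gx gy"
  using assms unfolding C1_on_def by (auto intro: continuous_on_open_Un)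

lemma C1_on_subset: "C1_on S g gx gy \<Longrightarrow> T \<subseteq> S \<Longrightarrow> C1_on T g gx gy"
  unfolding C1_on_def by (auto intro: continuous_on_subset)

text \<open>Nothing is known about \<open>h\<close> outside \<open>U\<close>, so the correction is
  used only there. As the cutoff vanishes off the compact \<open>T\<close>, the two formulas agree
  on the overlap of the open sets \<open>U\<close> and \<open>- T\<close>, which cover the
  plane.\<close>

lemma C1_paste_holomorphic:
  assumes \<psi>: "C1_on UNIV \<psi> \<psi>x \<psi>y" and T: "compact T" "T \<subseteq> U" "\<And>z. z \<notin> T \<Longrightarrow> \<psi> z = 0"
    and U: "open U" and h: "h holomorphic_on U" and F: "C1_on UNIV F Fx Fy"
  obtains gx gy where "C1_on UNIV (\<lambda>z. if z \<in> U then F z + \<psi> z * (h z - F z) else F z) gx gy"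
proof -
  define g where "g z = (if z \<in> U then F z + \<psi> z * (h z - F z) else F z)" for z
  define gx where "gx z = (if z \<in> U then Fx z + (\<psi>x z * (h z - F z) + \<psi> z * (deriv h z - Fx z)) else Fx z)" for z
  define gy where "gy z = (if z \<in> U then Fy z + (\<psi>y z * (h z - F z) + \<psi> z * (\<i> * deriv h z - Fy z)) else Fy z)" for z
  have oT: "open (- T)" using T(1) compact_imp_closed by blast
  have FU: "C1_on U F Fx Fy" and \<psi>U: "C1_on U \<psi> \<psi>x \<psi>y" using F \<psi> by (auto intro: C1_on_subset)
  have "C1_on U (\<lambda>z. F z + \<psi> z * (h z - F z)) (\<lambda>z. Fx z + (\<psi>x z * (h z - F z) + \<psi> z * (deriv h z - Fx z)))
     (\<lambda>z. Fy z + (\<psi>y z * (h z - F z) + \<psi> z * (\<i> * deriv h z - Fy z)))"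
    by (intro C1_on_add FU C1_on_mult \<psi>U C1_on_diff C1_on_holomorphic h U)
  then have 1: "C1_on U g gx gy" by (rule C1_on_cong[OF _ U]) (auto simp: g_def gx_def gy_def)
  have 0: "\<psi>x z = 0" "\<psi>y z = 0" if "z \<in> - T" for z
    using C1_on_eq_near[OF \<psi> UNIV_I oT that _ has_derivative_const[of 0]] T(3) by auto
  have 2: "C1_on (- T) g gx gy"
    by (rule C1_on_cong[OF C1_on_subset[OF F] oT]) (use T 0 in \<open>auto simp: g_def gx_def gy_def\<close>)
  have "U \<union> - T = UNIV" using T by auto
  then show ?thesis using that[of gx gy] C1_on_Un[OF 1 2 U oT] unfolding g_def[abs_def] by simp
qed

section \<open>Localized pieces of a smooth compactly supported function\<close>

definition pou_dbar :: "real \<Rightarrow> int \<times> int \<Rightarrow> complex \<Rightarrow> complex" where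
  "pou_dbar \<delta> j z = poux \<delta> j z + \<i> * pouy \<delta> j z"

lemma bounded_pou_support:
  assumes "\<delta> > 0" shows "bounded {z. pou \<delta> j z \<noteq> 0}"
proof (rule bounded_subset[OF bounded_ball[of "gridpt \<delta> j" "2 * \<delta>"]], rule subsetI)
  fix z assume "z \<in> {z. pou \<delta> j z \<noteq> 0}"
  then have "cmod (z - gridpt \<delta> j) < 2 * \<delta>" using pou_support[OF assms] by blast
  then show "z \<in> ball (gridpt \<delta> j) (2 * \<delta>)" by (simp add: dist_norm norm_minus_commute)
qed

lemma Cc_pou:
  assumes "\<delta> > 0" shows "Cc (\<lambda>z. of_real (pou \<delta> j z))" "Cc (pou_dbar \<delta> j)"
proof -
  have b: "bounded {z. complex_of_real (pou \<delta> j z) \<noteq> 0}" using bounded_pou_support[OF assms, of j] by simp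
  note c = C1_Cc_partials[OF C1_pou[OF assms] b]
  show "Cc (\<lambda>z. of_real (pou \<delta> j z))" by (rule c(1))
  show "Cc (pou_dbar \<delta> j)" unfolding pou_dbar_def[abs_def] by (intro Cc_add Cc_cmult c)
qed

locale smooth_compact =
  fixes G gx gy :: "complex \<Rightarrow> complex"
  assumes C1: "C1_on UNIV G gx gy" and bounded: "bounded {z. G z \<noteq> 0}"
begin

definition dbar :: "complex \<Rightarrow> complex" where "dbar z = gx z + \<i> * gy z"

lemma Cc: "Cc G" "Cc gx" "Cc gy" "Cc dbar"
  using C1_Cc_partials[OF C1 bounded] Cc_add[OF _ Cc_cmult[of gy "\<i>"], of gx] unfolding dbar_def[abs_def] by blast+

lemma dbar_zero:
  assumes "open V" "\<And>z. z \<in> V \<Longrightarrow> G z = h z" "h holomorphic_on V" "z \<in> V"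
  shows "dbar z = 0"
proof -
  have "(h has_derivative (*) (deriv h z)) (at z)"
    using holomorphic_derivI[OF assms(3,1,4)] unfolding has_field_derivative_def .
  from C1_on_eq_near[OF C1 UNIV_I assms(1,4,2) this]
  have "gx z = deriv h z" "gy z = deriv h z * \<i>" by auto
  then show ?thesis by (simp add: dbar_def mult.left_commute[of \<i>])
qed

definition piece :: "real \<Rightarrow> int \<times> int \<Rightarrow> complex \<Rightarrow> complex" where
  "piece \<delta> j z = of_real (pou \<delta> j z) * dbar z"

lemma Cc_piece: "\<delta> > 0 \<Longrightarrow> Cc (piece \<delta> j)"
  unfolding piece_def[abs_def] using Cc(4) Cc_pou(1) by (intro Cc_mult) (auto simp: Cc_def)

text \<open>Where the partition does not sum to 1, \<open>G\<close> vanishes locally and so does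
  \<open>dbar\<close>; the pieces therefore add up to \<open>dbar\<close> everywhere, and
  Cauchy-Pompeiu recovers \<open>G\<close>.\<close>

lemma sum_cauchy_piece:
  assumes \<delta>: "\<delta> > 0" and N: "\<And>z. G z \<noteq> 0 \<Longrightarrow> cmod z \<le> real N * \<delta>"
  shows "(\<Sum>j\<in>grid N. cauchy (piece \<delta> j) \<zeta>) = - of_real pompeiu_const * G \<zeta>"
proof -
  have "dbar z = (\<Sum>j\<in>grid N. piece \<delta> j z)" for z
  proof (cases "cmod z \<le> real N * \<delta>")
    case True
    then show ?thesis unfolding piece_def sum_distrib_right[symmetric] of_real_sum[symmetric]
      using sum_pou_eq_1[OF \<delta> True] by simp
  next
    case False
    have "open (- cball 0 (real N * \<delta>))" by auto
    then have "dbar z = 0" by (rule dbar_zero[where h="\<lambda>_. 0"]) (use N False in auto)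
    then show ?thesis by (simp add: piece_def)
  qed
  then have "cauchy (\<lambda>z. \<Sum>j\<in>grid N. piece \<delta> j z) \<zeta> = cauchy dbar \<zeta>" by presburger
  also have "\<dots> = - of_real pompeiu_const * G \<zeta>"
    unfolding dbar_def[abs_def] by (rule cauchy_pompeiu[OF C1 bounded])
  finally show ?thesis using Cc_piece[OF \<delta>] by (simp add: cauchy_sum)
qed

text \<open>Subtracting the value at the centre of the patch replaces the size of \<open>G\<close> by its oscillation.\<close>
lemma cauchy_piece_bound:
  assumes \<delta>: "\<delta> > 0" and \<omega>: "\<And>z. cmod (z - gridpt \<delta> j) < 2 * \<delta> \<Longrightarrow> cmod (G z - G (gridpt \<delta> j)) \<le> \<omega>"
  shows "cmod (cauchy (piece \<delta> j) \<zeta>) \<le> (pompeiu_const + 160) * \<omega>"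
proof -
  define c where "c = G (gridpt \<delta> j)"
  have \<omega>0: "\<omega> \<ge> 0" using \<omega>[of "gridpt \<delta> j"] \<delta> by simp
  note p = C1_pou[OF \<delta>, of j]
  have d: "C1_on UNIV (\<lambda>z. G z - c) gx gy" using C1_on_diff[OF C1 C1_on_const, of c] by simp
  have b: "bounded {z. of_real (pou \<delta> j z) * (G z - c) \<noteq> 0}"
    by (rule bounded_subset[OF bounded_pou_support[OF \<delta>, of j]]) auto
  define g where "g z = pou_dbar \<delta> j z * (G z - c)" for z
  have gC: "Cc g" unfolding g_def using C1_on_continuous[OF d] Cc_pou(2)[OF \<delta>] by (intro Cc_mult)
  \<comment> \<open>Cauchy-Pompeiu for \<open>pou * (G - c)\<close>: by the product rule its density
    is the piece plus \<open>g\<close>, in which the derivative falls on the partition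
    function.\<close>
  have "cauchy (\<lambda>z. piece \<delta> j z + 1 * g z) \<zeta> = - of_real pompeiu_const * (of_real (pou \<delta> j \<zeta>) * (G \<zeta> - c))"
    using cauchy_pompeiu[OF C1_on_mult[OF p d] b, of \<zeta>]
    by (simp add: piece_def g_def pou_dbar_def dbar_def algebra_simps)
  then have "cauchy (piece \<delta> j) \<zeta> = - of_real pompeiu_const * (of_real (pou \<delta> j \<zeta>) * (G \<zeta> - c)) - cauchy g \<zeta>"
    unfolding cauchy_linear[OF Cc_piece[OF \<delta>] gC] by (simp add: algebra_simps)
  then have "cmod (cauchy (piece \<delta> j) \<zeta>) \<le> cmod (of_real pompeiu_const * (of_real (pou \<delta> j \<zeta>) * (G \<zeta> - c))) + cmod (cauchy g \<zeta>)"
    using norm_triangle_ineq4[of "- of_real pompeiu_const * (of_real (pou \<delta> j \<zeta>) * (G \<zeta> - c))" "cauchy g \<zeta>"] by simp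
  also have "cmod (of_real pompeiu_const * (of_real (pou \<delta> j \<zeta>) * (G \<zeta> - c))) \<le> pompeiu_const * \<omega>"
  proof (cases "pou \<delta> j \<zeta> = 0")
    case False
    then have "cmod (G \<zeta> - c) \<le> \<omega>" unfolding c_def using pou_support[OF \<delta>] by (intro \<omega>) blast
    moreover have "pou \<delta> j \<zeta> \<le> 1" unfolding pou_def using bump_range by (intro mult_le_one)
    ultimately have "pou \<delta> j \<zeta> * cmod (G \<zeta> - c) \<le> 1 * \<omega>" by (intro mult_mono) auto
    then show ?thesis using pompeiu_const_pos by (simp add: norm_mult pou_nonneg)
  qed (use \<omega>0 pompeiu_const_pos in auto)
  \<comment> \<open>The density has size \<open>4 / \<delta> * \<omega>\<close> on a disc of radius
    \<open>2 * \<delta>\<close>; the powers of \<open>\<delta>\<close> cancel, so the bound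
    \<open>160 * \<omega>\<close> does not depend on the scale.\<close>
  also have "cmod (cauchy g \<zeta>) \<le> 20 * (2 * \<delta>) * (4 / \<delta> * \<omega>)"
  proof (rule kernel_bound(2)[where a="gridpt \<delta> j"])
    show "g \<in> borel_measurable lborel" using Cc_measurable[OF gC] by simp
    show "z \<in> cball (gridpt \<delta> j) (2 * \<delta>)" if "g z \<noteq> 0" for z
    proof -
      have "poux \<delta> j z \<noteq> 0 \<or> pouy \<delta> j z \<noteq> 0" using that by (auto simp: g_def pou_dbar_def)
      then have "cmod (z - gridpt \<delta> j) < 2 * \<delta>" using pou_support[OF \<delta>] by blast
      then show ?thesis by (simp add: dist_norm norm_minus_commute)
    qed
    show "cmod (g z) \<le> 4 / \<delta> * \<omega>" for z
    proof (cases "pou_dbar \<delta> j z = 0")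
      case False
      then have "poux \<delta> j z \<noteq> 0 \<or> pouy \<delta> j z \<noteq> 0" by (auto simp: pou_dbar_def)
      then have "cmod (G z - c) \<le> \<omega>" unfolding c_def using pou_support[OF \<delta>] by (intro \<omega>) blast
      then show ?thesis using pou_dbar_bound[OF \<delta>, of j z] \<delta>
        unfolding g_def norm_mult pou_dbar_def by (intro mult_mono) auto
    qed (use \<omega>0 \<delta> in \<open>auto simp: g_def\<close>)
  qed (use \<delta> in auto)
  also have "20 * (2 * \<delta>) * (4 / \<delta> * \<omega>) = 160 * \<omega>" using \<delta> by simp
  finally show ?thesis by (simp add: algebra_simps)
qed

text \<open>The patch is supported in a closed square of half-side \<open>\<delta>\<close>, which
  fits into the open disc of radius \<open>2 * \<delta>\<close> because its half-diagonal is
  \<open>sqrt 2 * \<delta>\<close>. Removing the open set \<open>V\<close>, where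
  \<open>dbar\<close> vanishes, leaves a compact set disjoint from \<open>K\<close>.\<close>

lemma Cc_in_piece:
  assumes \<delta>: "\<delta> > 0" and V: "open V" "K \<subseteq> V" "\<And>z. z \<in> V \<Longrightarrow> dbar z = 0"
  shows "Cc_in (ball (gridpt \<delta> j) (2 * \<delta>) - K) (piece \<delta> j)"
  unfolding Cc_in_def
proof (intro conjI exI[of _ "cbox (gridpt \<delta> j - Complex \<delta> \<delta>) (gridpt \<delta> j + Complex \<delta> \<delta>) - V"] allI impI)
  show "continuous_on UNIV (piece \<delta> j)" using Cc_piece[OF \<delta>] by (simp add: Cc_def)
  show "compact (cbox (gridpt \<delta> j - Complex \<delta> \<delta>) (gridpt \<delta> j + Complex \<delta> \<delta>) - V)"
    using V by (intro compact_diff) auto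
  show "cbox (gridpt \<delta> j - Complex \<delta> \<delta>) (gridpt \<delta> j + Complex \<delta> \<delta>) - V \<subseteq> ball (gridpt \<delta> j) (2 * \<delta>) - K"
  proof
    fix z assume z: "z \<in> cbox (gridpt \<delta> j - Complex \<delta> \<delta>) (gridpt \<delta> j + Complex \<delta> \<delta>) - V"
    define u where "u = z - gridpt \<delta> j"
    have "\<bar>Re u\<bar> \<le> \<delta>" "\<bar>Im u\<bar> \<le> \<delta>" using z unfolding u_def by (auto simp only: mem_square Diff_iff)
    then have "(Re u)^2 \<le> \<delta>^2" "(Im u)^2 \<le> \<delta>^2"
      using power_mono[of "\<bar>Re u\<bar>" \<delta> 2] power_mono[of "\<bar>Im u\<bar>" \<delta> 2] by simp_all
    moreover have "(cmod u)^2 = (Re u)^2 + (Im u)^2" by (rule cmod_power2)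
    moreover have "(2 * \<delta>)^2 = 4 * \<delta>^2" "\<delta>^2 > 0" using \<delta> by (auto simp: power_mult_distrib)
    ultimately have "(cmod u)^2 < (2 * \<delta>)^2" by linarith
    then have "cmod u < 2 * \<delta>" by (rule power2_less_imp_less) (use \<delta> in simp)
    then have "z \<in> ball (gridpt \<delta> j) (2 * \<delta>)" unfolding u_def by (simp add: dist_norm norm_minus_commute)
    then show "z \<in> ball (gridpt \<delta> j) (2 * \<delta>) - K" using z V by blast
  qed
  fix z assume "z \<notin> cbox (gridpt \<delta> j - Complex \<delta> \<delta>) (gridpt \<delta> j + Complex \<delta> \<delta>) - V"
  then consider "z \<in> V" | "\<not> (\<bar>Re (z - gridpt \<delta> j)\<bar> \<le> \<delta> \<and> \<bar>Im (z - gridpt \<delta> j)\<bar> \<le> \<delta>)"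
    by (auto simp only: mem_square Diff_iff)
  then show "piece \<delta> j z = 0"
  proof cases
    case 1 then show ?thesis using V by (simp add: piece_def)
  next
    case 2 then have "pou \<delta> j z = 0" using pou_support_box[OF \<delta>, of j z] by fastforce
    then show ?thesis by (simp add: piece_def)
  qed
qed

text \<open>Integration by parts against the holomorphic factor \<open>(z - a)^l\<close> moves the
  derivative from \<open>G\<close> to the partition function. The moments become integrals of
  \<open>G\<close> itself against fixed kernels, hence are controlled by uniform closeness, unlike
  \<open>dbar\<close>.\<close>

lemma moment_piece:
  assumes \<delta>: "\<delta> > 0"
  shows "moment a l (piece \<delta> j) = - (LINT z|lborel. G z * (pou_dbar \<delta> j z * (z - a)^l))"
proof -
  have h: "(\<lambda>z. (z - a)^l) holomorphic_on UNIV" by (intro holomorphic_intros)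
  define h' where "h' = deriv (\<lambda>z. (z - a)^l)"
  note m = C1_on_mult[OF C1_on_mult[OF C1_pou[OF \<delta>, of j] C1] C1_on_holomorphic[OF h open_UNIV, folded h'_def]]
  have b: "bounded {z. of_real (pou \<delta> j z) * G z * (z - a)^l \<noteq> 0}"
    by (rule bounded_subset[OF bounded]) auto
  have "0 = (LINT z|lborel. piece \<delta> j z * (z - a)^l + G z * (pou_dbar \<delta> j z * (z - a)^l))"
    unfolding C1_dbar_integral_zero[OF m b, symmetric]
    by (rule Bochner_Integration.integral_cong) (auto simp: piece_def pou_dbar_def dbar_def algebra_simps)
  also have "\<dots> = moment a l (piece \<delta> j) + (LINT z|lborel. G z * (pou_dbar \<delta> j z * (z - a)^l))"
    unfolding moment_def
  proof (rule Bochner_Integration.integral_add)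
    show "integrable lborel (\<lambda>z. piece \<delta> j z * (z - a)^l)" by (rule moment_integrable[OF Cc_piece[OF \<delta>]])
    show "integrable lborel (\<lambda>z. G z * (pou_dbar \<delta> j z * (z - a)^l))"
      using Cc_pou(2)[OF \<delta>, of j] Cc(1) by (intro Cc_integrable Cc_mult continuous_intros) (auto simp: Cc_def)
  qed
  finally show ?thesis by (simp add: eq_neg_iff_add_eq_0)
qed

end

context smooth_compact begin

text \<open>By \<open>sum_cauchy_piece\<close> the quantity is minus the sum of the corrected
  pieces. Each is bounded by a multiple of the oscillation \<open>\<omega>\<close> and has
  fourth-power decay, so \<open>sum_grid_decay\<close> gives a constant independent of
  \<open>\<delta>\<close> and \<open>N\<close>.\<close>

lemma vitushkin_estimate:
  assumes \<delta>: "\<delta> > 0" and N: "\<And>z. G z \<noteq> 0 \<Longrightarrow> cmod z \<le> real N * \<delta>"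
    and \<omega>: "\<And>z z'. cmod (z - z') < 2 * \<delta> \<Longrightarrow> cmod (G z - G z') \<le> \<omega>"
    and V: "open V" "K \<subseteq> V" "\<And>z. z \<in> V \<Longrightarrow> dbar z = 0"
    and q1: "\<And>j \<rho> M \<zeta>. Cc_in (ball (gridpt \<delta> j) (2 * \<delta>) - K) \<rho> \<Longrightarrow> (\<And>\<zeta>. cmod (cauchy \<rho> \<zeta>) \<le> M) \<Longrightarrow>
      cmod (cauchy \<rho> \<zeta> - (\<Sum>l<3. moment (gridpt \<delta> j) l \<rho> * cauchy (q j l) \<zeta>)) \<le> 27 * M"
    and q2: "\<And>j \<rho> M \<zeta>. Cc_in (ball (gridpt \<delta> j) (2 * \<delta>) - K) \<rho> \<Longrightarrow> (\<And>\<zeta>. cmod (cauchy \<rho> \<zeta>) \<le> M) \<Longrightarrow>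
      cmod (\<zeta> - gridpt \<delta> j) \<ge> 2 * \<delta> \<Longrightarrow>
      cmod (cauchy \<rho> \<zeta> - (\<Sum>l<3. moment (gridpt \<delta> j) l \<rho> * cauchy (q j l) \<zeta>)) \<le> 27 * M * (2 * \<delta> / cmod (\<zeta> - gridpt \<delta> j))^4"
  shows "cmod (of_real pompeiu_const * G \<zeta> + (\<Sum>j\<in>grid N. \<Sum>l<3. moment (gridpt \<delta> j) l (piece \<delta> j) * cauchy (q j l) \<zeta>))
    \<le> 5625 * (27 * ((pompeiu_const + 160) * \<omega>))"
proof -
  let ?M = "(pompeiu_const + 160) * \<omega>"
  let ?t = "\<lambda>j. cauchy (piece \<delta> j) \<zeta> - (\<Sum>l<3. moment (gridpt \<delta> j) l (piece \<delta> j) * cauchy (q j l) \<zeta>)"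
  have b: "cmod (cauchy (piece \<delta> j) \<zeta>) \<le> ?M" for j \<zeta>
    by (rule cauchy_piece_bound[OF \<delta> \<omega>])
  have M0: "0 \<le> ?M" using b[of undefined undefined] norm_ge_zero order_trans by blast
  note inV = Cc_in_piece[OF \<delta> V]
  have "of_real pompeiu_const * G \<zeta> + (\<Sum>j\<in>grid N. \<Sum>l<3. moment (gridpt \<delta> j) l (piece \<delta> j) * cauchy (q j l) \<zeta>)
     = - (\<Sum>j\<in>grid N. ?t j)"
    using sum_cauchy_piece[OF \<delta> N, of \<zeta>] by (simp add: sum_subtractf)
  then have "cmod (of_real pompeiu_const * G \<zeta> + (\<Sum>j\<in>grid N. \<Sum>l<3. moment (gridpt \<delta> j) l (piece \<delta> j) * cauchy (q j l) \<zeta>))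
     = cmod (\<Sum>j\<in>grid N. ?t j)" by (simp only: norm_minus_cancel)
  also have "\<dots> \<le> (\<Sum>j\<in>grid N. cmod (?t j))" by (rule norm_sum)
  also have "\<dots> \<le> 5625 * (27 * ?M)"
    by (rule sum_grid_decay[OF \<delta>]) (use M0 q1[OF inV b] q2[OF inV b] in auto)
  finally show ?thesis .
qed

end

section \<open>Finite-rank approximation with linear coefficients\<close>

lemma pou_lipschitz:
  assumes "\<delta> > 0" obtains B where "B \<ge> 0" "\<And>z z'. cmod (of_real (pou \<delta> j z) - of_real (pou \<delta> j z')) \<le> B * cmod (z - z')"
proof -
  have b: "bounded {z. complex_of_real (pou \<delta> j z) \<noteq> 0}" using bounded_pou_support[OF assms, of j] by simp
  note c = C1_Cc_partials[OF C1_pou[OF assms] b]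
  obtain B1 where B1: "\<And>z. cmod (poux \<delta> j z) \<le> B1" using Cc_bounded[OF c(2)] by blast
  obtain B2 where B2: "\<And>z. cmod (pouy \<delta> j z) \<le> B2" using Cc_bounded[OF c(3)] by blast
  have "cmod (poux \<delta> j z) \<le> max B1 B2" "cmod (pouy \<delta> j z) \<le> max B1 B2" for z using B1[of z] B2[of z] by auto
  note L = C1_lipschitz[OF C1_pou[OF assms] this]
  show ?thesis
    by (rule that[OF _ L]) (use B1[of 0] norm_ge_zero[of "poux \<delta> j 0"] in linarith)
qed

lemma finite_rank_lipschitz:
  assumes "\<delta> > 0" "finite A" "\<And>j w. j \<in> A \<Longrightarrow> w \<in> W \<Longrightarrow> cmod (b j w) \<le> M" "M \<ge> 0"
  obtains L where "L > 0" "\<And>z z' w. w \<in> W \<Longrightarrow>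
    cmod ((\<Sum>j\<in>A. of_real (pou \<delta> j z) * b j w) - (\<Sum>j\<in>A. of_real (pou \<delta> j z') * b j w)) \<le> L * cmod (z - z')"
proof -
  have "\<forall>j. \<exists>B. B \<ge> 0 \<and> (\<forall>z z'. cmod (of_real (pou \<delta> j z) - of_real (pou \<delta> j z')) \<le> B * cmod (z - z'))"
    using pou_lipschitz[OF assms(1)] by metis
  then obtain B where B: "\<And>j. B j \<ge> 0" "\<And>j z z'. cmod (of_real (pou \<delta> j z) - of_real (pou \<delta> j z')) \<le> B j * cmod (z - z')"
    by metis
  show ?thesis
  \<comment> \<open>The added 1 keeps \<open>L\<close> positive, since the grid scale is later
    obtained by dividing by it.\<close>
  proof (rule that[of "(\<Sum>j\<in>A. B j * M) + 1"])
    show "0 < (\<Sum>j\<in>A. B j * M) + 1" using B assms(4) by (intro add_nonneg_pos sum_nonneg) auto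
    fix z z' w assume w: "w \<in> W"
    have "(\<Sum>j\<in>A. of_real (pou \<delta> j z) * b j w) - (\<Sum>j\<in>A. of_real (pou \<delta> j z') * b j w)
       = (\<Sum>j\<in>A. (of_real (pou \<delta> j z) - of_real (pou \<delta> j z')) * b j w)"
      by (simp add: sum_subtractf left_diff_distrib)
    also have "cmod \<dots> \<le> (\<Sum>j\<in>A. (B j * cmod (z - z')) * M)"
    proof (rule sum_norm_le)
      fix j assume "j \<in> A"
      then show "cmod ((of_real (pou \<delta> j z) - of_real (pou \<delta> j z')) * b j w) \<le> (B j * cmod (z - z')) * M"
        unfolding norm_mult by (intro mult_mono B assms(3) w mult_nonneg_nonneg norm_ge_zero)
    qed
    also have "\<dots> = (\<Sum>j\<in>A. B j * M) * cmod (z - z')" by (simp add: sum_distrib_left sum_distrib_right mult_ac)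
    also have "\<dots> \<le> ((\<Sum>j\<in>A. B j * M) + 1) * cmod (z - z')" by (intro mult_right_mono) auto
    finally show "cmod ((\<Sum>j\<in>A. of_real (pou \<delta> j z) * b j w) - (\<Sum>j\<in>A. of_real (pou \<delta> j z') * b j w))
      \<le> ((\<Sum>j\<in>A. B j * M) + 1) * cmod (z - z')" .
  qed
qed

text \<open>The integral is exhibited as a linear combination of the \<open>b j\<close> with
  coefficients independent of \<open>b\<close>; this is the source of membership of the final
  coefficients in \<open>X\<close>.\<close>

lemma integral_finite_rank:
  assumes "\<delta> > 0" "Cc k"
  shows "integrable lborel (\<lambda>z. (\<Sum>j\<in>A. of_real (pou \<delta> j z) * b j) * k z)"
    "(LINT z|lborel. (\<Sum>j\<in>A. of_real (pou \<delta> j z) * b j) * k z) = (\<Sum>j\<in>A. (LINT z|lborel. of_real (pou \<delta> j z) * k z) * b j)"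
proof -
  have i: "integrable lborel (\<lambda>z. of_real (pou \<delta> j z) * k z * b j)" for j
    using Cc_pou(1)[OF assms(1), of j] assms(2)
    by (intro integrable_mult_left Cc_integrable Cc_mult) (auto simp: Cc_def)
  have e: "(\<Sum>j\<in>A. of_real (pou \<delta> j z) * b j) * k z = (\<Sum>j\<in>A. of_real (pou \<delta> j z) * k z * b j)" for z
    by (simp add: sum_distrib_left sum_distrib_right mult_ac)
  show "integrable lborel (\<lambda>z. (\<Sum>j\<in>A. of_real (pou \<delta> j z) * b j) * k z)"
    unfolding e using i by (intro Bochner_Integration.integrable_sum)
  show "(LINT z|lborel. (\<Sum>j\<in>A. of_real (pou \<delta> j z) * b j) * k z) = (\<Sum>j\<in>A. (LINT z|lborel. of_real (pou \<delta> j z) * k z) * b j)"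
    unfolding e using i by (subst Bochner_Integration.integral_sum) simp_all
qed

text \<open>Vitushkin's scheme, run with coefficients that depend linearly on the function, so that it preserves the
  dependence on the parameter \<open>w\<close>. The order of choices matters: the scale \<open>\<delta>\<close> comes from a first approximation
  \<open>G\<^sub>1\<close>; the correctors \<open>q\<close> depend on \<open>\<delta>\<close>; and the error \<open>\<epsilon>'\<close> of the second approximation \<open>G\<^sub>1 + G\<^sub>2\<close>, from which the
  coefficients are computed, depends on the correctors.\<close>
theorem planar_finite_rank:
  fixes f :: "complex \<Rightarrow> 'w \<Rightarrow> complex" and X :: "('w \<Rightarrow> complex) set"
  assumes K: "compact K" and e: "e > 0"
    and X0: "(\<lambda>w. 0) \<in> X" and Xl: "\<And>g h c. g \<in> X \<Longrightarrow> h \<in> X \<Longrightarrow> (\<lambda>w. g w + c * h w) \<in> X"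
    and equi: "\<And>e. e > 0 \<Longrightarrow> \<exists>d>0. \<forall>z\<in>K. \<forall>z'\<in>K. cmod (z - z') < d \<longrightarrow> (\<forall>w\<in>W. cmod (f z w - f z' w) \<le> e)"
    and bd: "\<And>z w. z \<in> K \<Longrightarrow> w \<in> W \<Longrightarrow> cmod (f z w) \<le> M"
    and fX: "\<And>z. z \<in> K \<Longrightarrow> f z \<in> X"
    and fO: "\<And>w. w \<in> W \<Longrightarrow> (\<lambda>z. f z w) \<in> O_bar K"
  obtains J :: "((int \<times> int) \<times> nat) set" and \<rho> b where "finite J"
    "\<And>k. k \<in> J \<Longrightarrow> Cc_in (- K) (\<rho> k)" "\<And>k. k \<in> J \<Longrightarrow> b k \<in> X"
    "\<And>z w. z \<in> K \<Longrightarrow> w \<in> W \<Longrightarrow> cmod (f z w - (\<Sum>k\<in>J. cauchy (\<rho> k) z * b k w)) \<le> e"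
proof -
  let ?pc = pompeiu_const
  note pc = pompeiu_const_pos
  define C2 where "C2 = 5625 * (27 * (?pc + 160))"
  have C2: "C2 > 0" using pc by (simp add: C2_def)
  \<comment> \<open>Chosen so that the final budget closes exactly at \<open>e\<close>:
    \<open>\<epsilon>\<close> for passing from \<open>f\<close> to \<open>h\<close>, and, after
    division by \<open>pompeiu_const\<close>, \<open>7 * C2 * \<epsilon>\<close> for the
    localization at oscillation \<open>7 * \<epsilon>\<close> plus \<open>\<epsilon>\<close> for
    perturbing the coefficients.\<close>
  define \<epsilon> where "\<epsilon> = e / (1 + (7 * C2 + 1) / ?pc)"
  have den: "1 + (7 * C2 + 1) / ?pc > 0" using pc C2 by (intro add_pos_pos divide_pos_pos) auto
  have \<epsilon>: "\<epsilon> > 0" using e den by (simp add: \<epsilon>_def)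
  have \<epsilon>e: "\<epsilon> + (7 * C2 * \<epsilon> + \<epsilon>) / ?pc = e"
  proof -
    have "\<epsilon> + (7 * C2 * \<epsilon> + \<epsilon>) / ?pc = \<epsilon> * (1 + (7 * C2 + 1) / ?pc)" by (simp add: algebra_simps add_divide_distrib)
    then show ?thesis using den by (simp add: \<epsilon>_def)
  qed
  define M' where "M' = max M 0"
  have M': "M' \<ge> 0" and bd': "\<And>z w. z \<in> K \<Longrightarrow> w \<in> W \<Longrightarrow> cmod (f z w) \<le> M'"
    using bd by (auto simp: M'_def le_max_iff_disj)
  have Xsum: "(\<lambda>w. \<Sum>k\<in>A. c k * g k w) \<in> X" if "finite A" "\<And>k. k \<in> A \<Longrightarrow> g k \<in> X"
    for A :: "(int \<times> int) set" and c g
    using that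
  proof (induction A rule: finite_induct)
    case (insert x F)
    then have "(\<lambda>w. (\<Sum>k\<in>F. c k * g k w) + c x * g x w) \<in> X" by (intro Xl) auto
    then show ?case using insert by (simp add: add.commute)
  qed (simp add: X0)
  obtain \<delta>1 A1 p1 where \<delta>1: "0 < \<delta>1" and A1: "finite A1" and p1: "\<And>j. j \<in> A1 \<Longrightarrow> p1 j \<in> K"
    and s1: "\<And>j z. j \<in> A1 \<Longrightarrow> pou \<delta>1 j z \<noteq> 0 \<Longrightarrow> cmod (z - p1 j) < 1"
    and a1: "\<And>z w. z \<in> K \<Longrightarrow> w \<in> W \<Longrightarrow> cmod (f z w - (\<Sum>j\<in>A1. of_real (pou \<delta>1 j z) * f (p1 j) w)) \<le> \<epsilon>"
    by (rule finite_rank_approx[OF K M' \<epsilon> equi bd']) blast+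
  define G1 where "G1 z w = (\<Sum>j\<in>A1. of_real (pou \<delta>1 j z) * f (p1 j) w)" for z w
  obtain L where L: "L > 0" "\<And>z z' w. w \<in> W \<Longrightarrow> cmod (G1 z w - G1 z' w) \<le> L * cmod (z - z')"
    unfolding G1_def by (rule finite_rank_lipschitz[OF \<delta>1 A1 bd'[OF p1] M']) blast+
  \<comment> \<open>At distances below \<open>2 * \<delta>\<close>, the radius of a patch,
    \<open>G1\<close> oscillates by at most \<open>\<epsilon>\<close>, uniformly in
    \<open>w\<close>.\<close>
  define \<delta> where "\<delta> = \<epsilon> / (2 * L)"
  have \<delta>: "\<delta> > 0" using \<epsilon> L by (simp add: \<delta>_def)
  have osc1: "cmod (G1 z w - G1 z' w) \<le> \<epsilon>" if "cmod (z - z') < 2 * \<delta>" "w \<in> W" for z z' w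
  proof -
    have "L * cmod (z - z') \<le> L * (2 * \<delta>)" using that L by (intro mult_left_mono) auto
    then show ?thesis using L(2)[OF that(2), of z z'] L(1) by (simp add: \<delta>_def)
  qed
  obtain R where R: "\<And>z. z \<in> K \<Longrightarrow> cmod z \<le> R" using compact_imp_bounded[OF K] unfolding bounded_iff by blast
  obtain N :: nat where N': "(R + 1) / \<delta> \<le> N" using real_arch_simple by blast
  \<comment> \<open>The margin 1 matches the distance from \<open>K\<close> within which all later
    approximants are supported.\<close>
  have N: "R + 1 \<le> real N * \<delta>" using N' \<delta> by (simp add: field_simps)
  define Vj where "Vj j = ball (gridpt \<delta> j) (2 * \<delta>) - K" for j
  define P where "P j q \<longleftrightarrow> (\<forall>l<3. Cc_in (Vj j) (q l)) \<and>
    (\<forall>\<rho> M \<zeta>. Cc_in (Vj j) \<rho> \<longrightarrow> (\<forall>\<zeta>. cmod (cauchy \<rho> \<zeta>) \<le> M) \<longrightarrow>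
      cmod (cauchy \<rho> \<zeta> - (\<Sum>l<3. moment (gridpt \<delta> j) l \<rho> * cauchy (q l) \<zeta>)) \<le> 27 * M \<and>
      (cmod (\<zeta> - gridpt \<delta> j) \<ge> 2 * \<delta> \<longrightarrow>
      cmod (cauchy \<rho> \<zeta> - (\<Sum>l<3. moment (gridpt \<delta> j) l \<rho> * cauchy (q l) \<zeta>)) \<le> 27 * M * (2 * \<delta> / cmod (\<zeta> - gridpt \<delta> j))^4))"
    for j and q :: "nat \<Rightarrow> complex \<Rightarrow> complex"
  have "\<forall>j. \<exists>q. P j q"
  proof
    fix j
    have V: "Vj j \<subseteq> ball (gridpt \<delta> j) (2 * \<delta>)" by (auto simp: Vj_def)
    have r: "2 * \<delta> > 0" using \<delta> by simp
    show "\<exists>q. P j q" unfolding P_def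
      by (rule localized_correctors[OF V r]) blast
  qed
  then obtain q where "\<forall>j. P j (q j)" using choice by blast
  then have q: "P j (q j)" for j by blast
  have qin: "Cc_in (Vj j) (q j l)" if "l < 3" for j l using q[of j] that unfolding P_def by blast
  have q1: "cmod (cauchy \<rho> \<zeta> - (\<Sum>l<3. moment (gridpt \<delta> j) l \<rho> * cauchy (q j l) \<zeta>)) \<le> 27 * M"
    if "Cc_in (Vj j) \<rho>" "\<And>\<zeta>. cmod (cauchy \<rho> \<zeta>) \<le> M" for j \<rho> M \<zeta> using q[of j] that unfolding P_def by blast
  have q2: "cmod (cauchy \<rho> \<zeta> - (\<Sum>l<3. moment (gridpt \<delta> j) l \<rho> * cauchy (q j l) \<zeta>)) \<le> 27 * M * (2 * \<delta> / cmod (\<zeta> - gridpt \<delta> j))^4"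
    if "Cc_in (Vj j) \<rho>" "\<And>\<zeta>. cmod (cauchy \<rho> \<zeta>) \<le> M" "cmod (\<zeta> - gridpt \<delta> j) \<ge> 2 * \<delta>" for j \<rho> M \<zeta> using q[of j] that unfolding P_def by blast
  define B where "B j l = (SOME B. B \<ge> 0 \<and> (\<forall>\<zeta>. cmod (cauchy (q j l) \<zeta>) \<le> B))" for j l
  have B_ex: "\<exists>B. B \<ge> 0 \<and> (\<forall>\<zeta>. cmod (cauchy (q j l) \<zeta>) \<le> B)" if "l < 3" for j l
    using Cc_cauchy_bounded[OF Cc_in_Cc[OF qin[OF that]]] by (metis less_imp_le)
  have B: "\<And>j l. l < 3 \<Longrightarrow> B j l \<ge> 0" "\<And>j l \<zeta>. l < 3 \<Longrightarrow> cmod (cauchy (q j l) \<zeta>) \<le> B j l"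
    using someI_ex[OF B_ex] unfolding B_def by blast+
  define kern where "kern j l z = pou_dbar \<delta> j z * (z - gridpt \<delta> j)^l" for j l z
  have kC: "Cc (kern j l)" for j l
    unfolding kern_def by (intro Cc_mult Cc_pou \<delta> continuous_intros)
  define A where "A j l = (LINT z|lborel. cmod (kern j l z))" for j l
  have A0: "A j l \<ge> 0" for j l unfolding A_def by simp
  define S where "S = (\<Sum>j\<in>grid N. \<Sum>l<3. A j l * B j l)"
  have S0: "S \<ge> 0" unfolding S_def using A0 B by (intro sum_nonneg mult_nonneg_nonneg) auto
  \<comment> \<open>\<open>S\<close> weighs the \<open>L1\<close> norm of each moment kernel with
    the sup norm of the transform of its corrector. A uniform error \<open>2 * \<epsilon>'\<close>
    in the function therefore changes the whole approximant by at most
    \<open>2 * \<epsilon>' * S \<le> \<epsilon>\<close>.\<close>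
  define \<epsilon>' where "\<epsilon>' = min \<epsilon> (\<epsilon> / (2 * S + 1))"
  have \<epsilon>': "\<epsilon>' > 0" "\<epsilon>' \<le> \<epsilon>" "2 * \<epsilon>' * S \<le> \<epsilon>"
  proof -
    have d: "2 * S + 1 > 0" using S0 by simp
    show "\<epsilon>' > 0" "\<epsilon>' \<le> \<epsilon>" using \<epsilon> d by (auto simp: \<epsilon>'_def)
    have "\<epsilon>' * (2 * S + 1) \<le> \<epsilon> / (2 * S + 1) * (2 * S + 1)" using d by (intro mult_right_mono) (auto simp: \<epsilon>'_def)
    then have "\<epsilon>' * (2 * S + 1) \<le> \<epsilon>" using d by simp
    then show "2 * \<epsilon>' * S \<le> \<epsilon>" using \<open>\<epsilon>' > 0\<close> by (simp add: algebra_simps)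
  qed
  \<comment> \<open>Approximating \<open>f\<close> anew to accuracy \<open>\<epsilon>'\<close> could
    oscillate too much at the fixed scale \<open>\<delta>\<close>. Only the residual is
    approximated: it is at most \<open>\<epsilon>\<close> on \<open>K\<close>, so however rapidly
    \<open>G2\<close> varies, it adds at most \<open>2 * \<epsilon>\<close> to the oscillation of
    \<open>G1\<close>.\<close>
  define f2 where "f2 z w = f z w - G1 z w" for z w
  have bd2: "\<And>z w. z \<in> K \<Longrightarrow> w \<in> W \<Longrightarrow> cmod (f2 z w) \<le> \<epsilon>" using a1 by (simp add: f2_def G1_def)
  have equi2: "\<exists>d>0. \<forall>z\<in>K. \<forall>z'\<in>K. cmod (z - z') < d \<longrightarrow> (\<forall>w\<in>W. cmod (f2 z w - f2 z' w) \<le> \<eta>)" if \<eta>: "\<eta> > 0" for \<eta>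
  proof -
    obtain d where d: "d > 0" "\<And>z z' w. z \<in> K \<Longrightarrow> z' \<in> K \<Longrightarrow> cmod (z - z') < d \<Longrightarrow> w \<in> W \<Longrightarrow> cmod (f z w - f z' w) \<le> \<eta> / 2"
      using equi[of "\<eta> / 2"] \<eta> by auto
    show ?thesis
    proof (intro exI[of _ "min d (\<eta> / (2 * L))"] conjI ballI impI)
      show "0 < min d (\<eta> / (2 * L))" using d \<eta> L by simp
      fix z z' w assume h: "z \<in> K" "z' \<in> K" "cmod (z - z') < min d (\<eta> / (2 * L))" "w \<in> W"
      have "L * cmod (z - z') \<le> L * (\<eta> / (2 * L))" using h L by (intro mult_left_mono) auto
      then have "cmod (G1 z w - G1 z' w) \<le> \<eta> / 2" using L(2)[OF h(4), of z z'] L(1) by simp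
      moreover have "cmod (f z w - f z' w) \<le> \<eta> / 2" using h by (intro d(2)) auto
      moreover have "f2 z w - f2 z' w = (f z w - f z' w) - (G1 z w - G1 z' w)" by (simp add: f2_def)
      ultimately show "cmod (f2 z w - f2 z' w) \<le> \<eta>"
        using norm_triangle_ineq4[of "f z w - f z' w" "G1 z w - G1 z' w"] by simp
    qed
  qed
  have \<epsilon>0: "\<epsilon> \<ge> 0" using \<epsilon> by simp
  obtain \<delta>2 A2 p2 where \<delta>2: "0 < \<delta>2" and A2: "finite A2" and p2: "\<And>j. j \<in> A2 \<Longrightarrow> p2 j \<in> K"
    and s2: "\<And>j z. j \<in> A2 \<Longrightarrow> pou \<delta>2 j z \<noteq> 0 \<Longrightarrow> cmod (z - p2 j) < 1"
    and a2: "\<And>z w. z \<in> K \<Longrightarrow> w \<in> W \<Longrightarrow> cmod (f2 z w - (\<Sum>j\<in>A2. of_real (pou \<delta>2 j z) * f2 (p2 j) w)) \<le> \<epsilon>'"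
    and m2: "\<And>z w. w \<in> W \<Longrightarrow> cmod (\<Sum>j\<in>A2. of_real (pou \<delta>2 j z) * f2 (p2 j) w) \<le> \<epsilon>"
    by (rule finite_rank_approx[OF K \<epsilon>0 \<epsilon>'(1) equi2 bd2]) blast+
  define G2 where "G2 z w = (\<Sum>j\<in>A2. of_real (pou \<delta>2 j z) * f2 (p2 j) w)" for z w
  define F where "F z w = G1 z w + G2 z w" for z w
  have F_approx: "cmod (f z w - F z w) \<le> \<epsilon>'" if "z \<in> K" "w \<in> W" for z w
    using a2[OF that] by (simp add: F_def f2_def G2_def diff_diff_eq)
  have F_osc: "cmod (F z w - F z' w) \<le> 3 * \<epsilon>" if "cmod (z - z') < 2 * \<delta>" "w \<in> W" for z z' w
  proof -
    have "F z w - F z' w = (G1 z w - G1 z' w) + (G2 z w - G2 z' w)" by (simp add: F_def)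
    then have "cmod (F z w - F z' w) \<le> cmod (G1 z w - G1 z' w) + (cmod (G2 z w) + cmod (G2 z' w))"
      using norm_triangle_ineq[of "G1 z w - G1 z' w" "G2 z w - G2 z' w"] norm_triangle_ineq4[of "G2 z w" "G2 z' w"] by simp
    then show ?thesis using osc1[OF that] m2[OF that(2), of z] m2[OF that(2), of z'] by (simp add: G2_def)
  qed
  have F_supp: "cmod z \<le> R + 1" if "F z w \<noteq> 0" for z w
  proof -
    have "\<exists>x\<in>K. cmod (z - x) < 1"
    proof (rule ccontr)
      assume no: "\<not> (\<exists>x\<in>K. cmod (z - x) < 1)"
      have "\<forall>j\<in>A1. pou \<delta>1 j z = 0" using no s1 p1 by blast
      moreover have "\<forall>j\<in>A2. pou \<delta>2 j z = 0" using no s2 p2 by blast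
      ultimately have "G1 z w = 0" "G2 z w = 0" by (simp_all add: G1_def G2_def)
      then show False using that by (simp add: F_def)
    qed
    then obtain x where "x \<in> K" "cmod (z - x) < 1" by blast
    then show ?thesis using R[of x] norm_triangle_ineq2[of z x] by linarith
  qed
  have F_C1: "\<exists>Fx Fy. C1_on UNIV (\<lambda>z. F z w) Fx Fy" for w
    unfolding F_def G1_def G2_def
    by (rule exI, rule exI, rule C1_on_add[OF C1_on_sum C1_on_sum,
      OF C1_on_mult[OF C1_pou[OF \<delta>1] C1_on_const] C1_on_mult[OF C1_pou[OF \<delta>2] C1_on_const]])
  \<comment> \<open>The moments of the finite-rank \<open>F\<close>, not of the
    \<open>w\<close>-dependent extension \<open>G\<close> built below; this is what keeps
    \<open>b k\<close> linear in the slices of \<open>f\<close>.\<close>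
  define b where "b k w = (LINT z|lborel. F z w * kern (fst k) (snd k) z) / of_real ?pc" for k w
  have bX: "b k \<in> X" for k
  proof -
    define c1 where "c1 j = (LINT z|lborel. of_real (pou \<delta>1 j z) * kern (fst k) (snd k) z) / of_real ?pc" for j
    define c2 where "c2 j = (LINT z|lborel. of_real (pou \<delta>2 j z) * kern (fst k) (snd k) z) / of_real ?pc" for j
    have beq: "b k = (\<lambda>w. (\<Sum>j\<in>A1. c1 j * f (p1 j) w) + 1 * (\<Sum>j\<in>A2. c2 j * f2 (p2 j) w))"
    proof
      fix w
      have "(LINT z|lborel. F z w * kern (fst k) (snd k) z) =
        (LINT z|lborel. G1 z w * kern (fst k) (snd k) z) + (LINT z|lborel. G2 z w * kern (fst k) (snd k) z)"
        unfolding F_def distrib_right G1_def G2_def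
        by (intro Bochner_Integration.integral_add integral_finite_rank \<delta>1 \<delta>2 kC)
      then show "b k w = (\<Sum>j\<in>A1. c1 j * f (p1 j) w) + 1 * (\<Sum>j\<in>A2. c2 j * f2 (p2 j) w)"
        unfolding b_def G1_def G2_def c1_def c2_def integral_finite_rank(2)[OF \<delta>1 kC] integral_finite_rank(2)[OF \<delta>2 kC]
        by (simp add: add_divide_distrib sum_divide_distrib)
    qed
    have f2X: "f2 z \<in> X" if "z \<in> K" for z
    proof -
      have "f2 z = (\<lambda>w. f z w + (-1) * (\<Sum>j\<in>A1. of_real (pou \<delta>1 j z) * f (p1 j) w))"
        by (simp add: f2_def G1_def fun_eq_iff)
      also have "\<dots> \<in> X" using fX that p1 by (intro Xl Xsum A1) auto
      finally show ?thesis .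
    qed
    show ?thesis unfolding beq by (intro Xl Xsum A1 A2 fX p1 f2X p2)
  qed
  show ?thesis
  proof (rule that[of "grid N \<times> {..<3}" "\<lambda>k. q (fst k) (snd k)" b])
    show "finite (grid N \<times> {..<3::nat})" by simp
    show "Cc_in (- K) (q (fst k) (snd k))" if "k \<in> grid N \<times> {..<3}" for k
    proof -
      have "Cc_in (Vj (fst k)) (q (fst k) (snd k))" using that by (intro qin) auto
      moreover have "Vj (fst k) \<subseteq> - K" by (auto simp: Vj_def)
      ultimately show ?thesis unfolding Cc_in_def by (meson order_trans)
    qed
    show "b k \<in> X" for k by (rule bX)
    fix \<zeta> w assume \<zeta>: "\<zeta> \<in> K" and w: "w \<in> W"
    have "\<forall>e>0. \<exists>U h. open U \<and> K \<subseteq> U \<and> h holomorphic_on U \<and> (\<forall>z\<in>K. cmod (f z w - h z) < e)"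
      using fO[OF w] by (simp add: O_bar_def)
    from this[rule_format, OF \<epsilon>'(1)] obtain U h where U: "open U" "K \<subseteq> U" "h holomorphic_on U"
      and h: "\<And>z. z \<in> K \<Longrightarrow> cmod (f z w - h z) < \<epsilon>'"
      by blast
    obtain Fx Fy where FC: "C1_on UNIV (\<lambda>z. F z w) Fx Fy" using F_C1 by blast
    have Fc: "continuous_on UNIV (\<lambda>z. F z w)" using C1_on_continuous[OF FC] .
    \<comment> \<open>The neighbourhood of \<open>K\<close> on which replacing \<open>F\<close> by
      \<open>h\<close> costs at most \<open>2 * \<epsilon>'\<close>; the ball keeps the modified
      function supported inside the grid.\<close>
    define V where "V = (U \<inter> (\<lambda>z. cmod (h z - F z w)) -` {..<2 * \<epsilon>'}) \<inter> ball 0 (R + 1)"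
    have "open V" unfolding V_def
      using U by (intro open_Int continuous_open_preimage continuous_intros holomorphic_on_imp_continuous_on continuous_on_subset[OF Fc]) auto
    moreover have "K \<subseteq> V"
    proof
      fix z assume z: "z \<in> K"
      have "h z - F z w = (f z w - F z w) - (f z w - h z)" by simp
      then have "cmod (h z - F z w) < 2 * \<epsilon>'"
        using F_approx[OF z w] h[OF z] norm_triangle_ineq4[of "f z w - F z w" "f z w - h z"] by simp
      moreover have "z \<in> ball 0 (R + 1)" using R[OF z] by simp
      ultimately show "z \<in> V" using z U by (auto simp: V_def)
    qed
    ultimately obtain \<psi> \<psi>x \<psi>y V0 T where \<psi>: "C1_on UNIV (\<lambda>z. of_real (\<psi> z)) \<psi>x \<psi>y"
      "\<And>z. 0 \<le> \<psi> z" "\<And>z. \<psi> z \<le> 1" and V0: "open V0" "K \<subseteq> V0" "\<And>z. z \<in> V0 \<Longrightarrow> \<psi> z = 1"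
      and T: "compact T" "T \<subseteq> V" "\<And>z. z \<notin> T \<Longrightarrow> \<psi> z = 0"
      using smooth_cutoff[OF K] by metis
    \<comment> \<open>\<open>G\<close> equals \<open>h\<close> near \<open>K\<close>, so its density
      is supported off \<open>K\<close>, and stays within \<open>2 * \<epsilon>'\<close> of
      \<open>F\<close> everywhere.\<close>
    define G where "G z = (if z \<in> U then F z w + of_real (\<psi> z) * (h z - F z w) else F z w)" for z
    have TU: "T \<subseteq> U" using T by (auto simp: V_def)
    have T0: "\<And>z. z \<notin> T \<Longrightarrow> complex_of_real (\<psi> z) = 0" using T by simp
    obtain gx gy where GC: "C1_on UNIV G gx gy"
      using C1_paste_holomorphic[OF \<psi>(1) T(1) TU T0 U(1,3) FC] unfolding G_def[abs_def] by metis
    have GF: "cmod (G z - F z w) \<le> 2 * \<epsilon>'" for z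
    proof (cases "z \<in> T")
      case True
      then have "z \<in> U" "cmod (h z - F z w) < 2 * \<epsilon>'" using T(2) by (auto simp: V_def)
      then have "cmod (G z - F z w) \<le> 1 * (2 * \<epsilon>')"
        using \<psi>(2,3)[of z] unfolding G_def by (simp add: norm_mult) (intro mult_left_le_one_le[THEN order_trans]; simp)
      then show ?thesis by simp
    qed (use T0 \<epsilon>' in \<open>auto simp: G_def\<close>)
    have Gsupp: "cmod z \<le> R + 1" if "G z \<noteq> 0" for z
    proof (cases "z \<in> T")
      case True then show ?thesis using T(2) by (auto simp: V_def)
    next
      case False then have "F z w \<noteq> 0" using that T0 by (auto simp: G_def split: if_splits)
      then show ?thesis by (rule F_supp)
    qed
    then have Gb: "bounded {z. G z \<noteq> 0}" unfolding bounded_iff by blast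
    interpret smooth_compact G gx gy by unfold_locales (rule GC Gb)+
    have dbar0: "dbar z = 0" if "z \<in> V0" for z
    proof (rule dbar_zero[OF V0(1) _ _ that])
      have V0T: "V0 \<subseteq> T" using V0(3) T(3) by (metis subsetI zero_neq_one)
      show "G z = h z" if "z \<in> V0" for z using V0(3)[OF that] V0T TU that by (auto simp: G_def)
      show "h holomorphic_on V0" using U(3) V0T TU by (meson holomorphic_on_subset order_trans)
    qed
    \<comment> \<open>\<open>7 = 2 + 3 + 2\<close>: the oscillation \<open>3 * \<epsilon>\<close> of
      \<open>F\<close> plus two errors \<open>2 * \<epsilon>'\<close>, with
      \<open>\<epsilon>' \<le> \<epsilon>\<close>.\<close>
    have Gosc: "cmod (G z - G z') \<le> 7 * \<epsilon>" if "cmod (z - z') < 2 * \<delta>" for z z'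
    proof -
      have "G z - G z' = (G z - F z w) + (F z w - F z' w) - (G z' - F z' w)" by simp
      then have "cmod (G z - G z') \<le> cmod (G z - F z w) + cmod (F z w - F z' w) + cmod (G z' - F z' w)"
        by (metis norm_triangle_ineq norm_triangle_ineq4 add_right_mono order_trans)
      then show ?thesis using GF[of z] GF[of z'] F_osc[OF that w] \<epsilon>' by linarith
    qed
    have Gsupp': "\<And>z. G z \<noteq> 0 \<Longrightarrow> cmod z \<le> real N * \<delta>" using Gsupp N by (meson order_trans)
    have est: "cmod (of_real ?pc * G \<zeta> + (\<Sum>j\<in>grid N. \<Sum>l<3. moment (gridpt \<delta> j) l (piece \<delta> j) * cauchy (q j l) \<zeta>))
      \<le> 5625 * (27 * ((?pc + 160) * (7 * \<epsilon>)))"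
      by (rule vitushkin_estimate[OF \<delta> Gsupp' Gosc V0(1,2) dbar0]) (assumption | rule q1[unfolded Vj_def] q2[unfolded Vj_def])+
    define m where "m j l = (LINT z|lborel. G z * kern j l z)" for j l
    have mom: "moment (gridpt \<delta> j) l (piece \<delta> j) = - m j l" for j l
      unfolding m_def kern_def by (rule moment_piece[OF \<delta>])
    have est': "cmod (of_real ?pc * G \<zeta> - (\<Sum>j\<in>grid N. \<Sum>l<3. m j l * cauchy (q j l) \<zeta>)) \<le> 7 * C2 * \<epsilon>"
    proof -
      have n1: "(\<Sum>j\<in>grid N. \<Sum>l<3. - m j l * cauchy (q j l) \<zeta>) = - (\<Sum>j\<in>grid N. \<Sum>l<3. m j l * cauchy (q j l) \<zeta>)"
        by (simp only: mult_minus_left sum_negf)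
      have n2: "5625 * (27 * ((?pc + 160) * (7 * \<epsilon>))) = 7 * C2 * \<epsilon>" by (simp add: C2_def)
      show ?thesis using est unfolding mom n1 n2 add_uminus_conv_diff .
    qed
    \<comment> \<open>The only place where the coefficients of \<open>G\<close> and of
      \<open>F\<close> are compared; uniform closeness suffices because the kernels carry all the
      derivatives.\<close>
    have mb: "cmod (m j l - of_real ?pc * b (j, l) w) \<le> 2 * \<epsilon>' * A j l" for j l
    proof -
      have i1: "integrable lborel (\<lambda>z. G z * kern j l z)"
        using Cc(1) kC[of j l] by (intro Cc_integrable Cc_mult) (auto simp: Cc_def)
      have i2: "integrable lborel (\<lambda>z. F z w * kern j l z)"
        unfolding F_def distrib_right G1_def G2_def
        by (intro Bochner_Integration.integrable_add integral_finite_rank \<delta>1 \<delta>2 kC)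
      have "m j l - of_real ?pc * b (j, l) w = (LINT z|lborel. G z * kern j l z - F z w * kern j l z)"
        unfolding m_def b_def using pc i1 i2 by simp
      also have "cmod \<dots> \<le> (LINT z|lborel. cmod (G z * kern j l z - F z w * kern j l z))"
        by (rule integral_norm_bound)
      also have "\<dots> \<le> (LINT z|lborel. 2 * \<epsilon>' * cmod (kern j l z))"
      proof (rule integral_mono)
        show "integrable lborel (\<lambda>z. cmod (G z * kern j l z - F z w * kern j l z))" using i1 i2 by auto
        show "integrable lborel (\<lambda>z. 2 * \<epsilon>' * cmod (kern j l z))" using Cc_integrable[OF kC] by auto
        show "cmod (G z * kern j l z - F z w * kern j l z) \<le> 2 * \<epsilon>' * cmod (kern j l z)" for z
          using GF[of z] unfolding left_diff_distrib[symmetric] norm_mult by (intro mult_right_mono) auto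
      qed
      also have "\<dots> = 2 * \<epsilon>' * A j l" by (simp add: A_def)
      finally show ?thesis .
    qed
    define Q where "Q = (\<Sum>j\<in>grid N. \<Sum>l<3. cauchy (q j l) \<zeta> * b (j, l) w)"
    have "cmod ((\<Sum>j\<in>grid N. \<Sum>l<3. m j l * cauchy (q j l) \<zeta>) - of_real ?pc * Q) \<le> \<epsilon>"
    proof -
      have "(\<Sum>j\<in>grid N. \<Sum>l<3. m j l * cauchy (q j l) \<zeta>) - of_real ?pc * Q =
        (\<Sum>j\<in>grid N. \<Sum>l<3. (m j l - of_real ?pc * b (j, l) w) * cauchy (q j l) \<zeta>)"
        unfolding Q_def sum_distrib_left sum_subtractf[symmetric] by (simp add: algebra_simps)
      also have "cmod \<dots> \<le> (\<Sum>j\<in>grid N. \<Sum>l<3. (2 * \<epsilon>' * A j l) * B j l)"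
      proof (intro sum_norm_le)
        fix j and l :: nat assume "l \<in> {..<3}"
        then have l: "l < 3" by simp
        have nn: "0 \<le> (2::real)" "0 \<le> \<epsilon>'" using \<epsilon>'(1) by simp_all
        show "cmod ((m j l - of_real ?pc * b (j, l) w) * cauchy (q j l) \<zeta>) \<le> (2 * \<epsilon>' * A j l) * B j l"
          unfolding norm_mult by (intro mult_mono mb B(2) l mult_nonneg_nonneg A0 norm_ge_zero nn)
      qed
      also have "\<dots> = 2 * \<epsilon>' * S" by (simp add: S_def sum_distrib_left mult_ac)
      finally show ?thesis using \<epsilon>'(3) by simp
    qed
    then have "cmod (of_real ?pc * G \<zeta> - of_real ?pc * Q) \<le> 7 * C2 * \<epsilon> + \<epsilon>"
      using est' norm_triangle_ineq[of "of_real ?pc * G \<zeta> - (\<Sum>j\<in>grid N. \<Sum>l<3. m j l * cauchy (q j l) \<zeta>)"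
        "(\<Sum>j\<in>grid N. \<Sum>l<3. m j l * cauchy (q j l) \<zeta>) - of_real ?pc * Q"] by simp
    then have GQ: "cmod (G \<zeta> - Q) \<le> (7 * C2 * \<epsilon> + \<epsilon>) / ?pc"
      unfolding right_diff_distrib[symmetric] norm_mult using pc by (simp add: field_simps)
    have "G \<zeta> = h \<zeta>"
    proof -
      have "\<zeta> \<in> U" "\<psi> \<zeta> = 1" using \<zeta> U V0 by auto
      then show ?thesis by (simp add: G_def)
    qed
    then have "cmod (f \<zeta> w - Q) \<le> \<epsilon> + (7 * C2 * \<epsilon> + \<epsilon>) / ?pc"
      using h[OF \<zeta>] \<epsilon>'(2) GQ norm_triangle_ineq[of "f \<zeta> w - h \<zeta>" "h \<zeta> - Q"] by simp
    moreover have "Q = (\<Sum>k\<in>grid N \<times> {..<3}. cauchy (q (fst k) (snd k)) \<zeta> * b k w)"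
      unfolding Q_def by (simp add: sum.cartesian_product case_prod_beta)
    ultimately show "cmod (f \<zeta> w - (\<Sum>k\<in>grid N \<times> {..<3}. cauchy (q (fst k) (snd k)) \<zeta> * b k w)) \<le> e"
      unfolding \<epsilon>e by simp
  qed
qed

section \<open>Algebra of approximable functions and pole pushing\<close>

lemma rat_prods_mult:
  assumes "g \<in> rat_prods I L" "h \<in> rat_prods I L" shows "(\<lambda>x. g x * h x) \<in> rat_prods I L"
  using assms(1)
proof induction
  case (const c)
  show ?case using assms(2)
  proof induction
    case (const d)
    show ?case using rat_prods.const[of "c * d" I L] by simp
  next
    case (mult g i r)
    then show ?case using rat_prods.mult[of "\<lambda>x. c * g x" I L i r] by (simp add: mult.left_commute)
  qed
next
  case (mult g i r)
  then show ?case using rat_prods.mult[of "\<lambda>x. g x * h x" I L i r] by (simp add: mult.assoc)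
qed

lemma rat_prods_in_sums: "g \<in> rat_prods I L \<Longrightarrow> g \<in> rat_sums I L"
  using rat_sums.add[OF _ rat_sums.zero, of g I L] by simp

lemma rat_sums_add:
  assumes "g \<in> rat_sums I L" "h \<in> rat_sums I L" shows "(\<lambda>x. g x + h x) \<in> rat_sums I L"
  using assms(1)
proof induction
  case (add g1 h1)
  then show ?case using rat_sums.add[of g1 I L "\<lambda>x. h1 x + h x"] by (simp add: add.assoc)
qed (simp add: assms)

lemma rat_sums_mult:
  assumes "g \<in> rat_sums I L" "h \<in> rat_sums I L" shows "(\<lambda>x. g x * h x) \<in> rat_sums I L"
proof -
  have p: "(\<lambda>x. p x * h x) \<in> rat_sums I L" if "p \<in> rat_prods I L" for p
    using assms(2)
  proof induction
    case (add g1 h1)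
    then show ?case using rat_sums_add[OF rat_prods_in_sums[OF rat_prods_mult[OF that add(1)]] add(3)]
      by (simp add: distrib_left)
  qed (simp add: rat_sums.zero)
  show ?thesis using assms(1)
  proof induction
    case (add g1 h1)
    then show ?case using rat_sums_add[OF p[OF add(1)] add(3)] by (simp add: distrib_right)
  qed (simp add: rat_sums.zero)
qed

locale compact_product =
  fixes I :: "'i set" and K :: "'i \<Rightarrow> complex set" and L :: "'i \<Rightarrow> complex option set"
  assumes compact_K: "\<And>i. i \<in> I \<Longrightarrow> compact (K i)"
    and hits: "\<And>i. i \<in> I \<Longrightarrow> hits_components (K i) (L i)"
begin

definition approximable :: "(('i \<Rightarrow> complex) \<Rightarrow> complex) \<Rightarrow> bool" where
  "approximable f \<longleftrightarrow> (\<forall>e>0. \<exists>g\<in>rat_sums I L. \<forall>x\<in>PiE I K. cmod (f x - g x) < e)"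

lemma rat_poles_bounded:
  assumes "i \<in> I" "rat_poles (L i) r" obtains B where "B \<ge> 0" "\<And>z. z \<in> K i \<Longrightarrow> cmod (r z) \<le> B"
proof -
  obtain p q where pq: "\<And>z. poly q z = 0 \<Longrightarrow> Some z \<in> L i" "r = (\<lambda>z. poly p z / poly q z)"
    using assms(2) unfolding rat_poles_def by blast
  have "poly q z \<noteq> 0" if "z \<in> K i" for z
    using pq(1)[of z] hits[OF assms(1)] that unfolding hits_components_def by blast
  then have "continuous_on (K i) r" unfolding pq(2) by (intro continuous_intros) auto
  then have "bounded (r ` K i)" using compact_K[OF assms(1)] by (intro compact_imp_bounded compact_continuous_image)
  then obtain B where "B > 0" "\<forall>z\<in>K i. cmod (r z) \<le> B" unfolding bounded_pos by auto
  then show ?thesis using that[of B] by simp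
qed

lemma rat_sums_bounded:
  assumes "g \<in> rat_sums I L" shows "\<exists>B\<ge>0. \<forall>x\<in>PiE I K. cmod (g x) \<le> B"
proof -
  have p: "\<exists>B\<ge>0. \<forall>x\<in>PiE I K. cmod (p x) \<le> B" if "p \<in> rat_prods I L" for p
    using that
  proof induction
    case (const c)
    show ?case by (intro exI[of _ "cmod c"]) auto
  next
    case (mult g i r)
    obtain B where B: "B \<ge> 0" "\<And>z. z \<in> K i \<Longrightarrow> cmod (r z) \<le> B" using rat_poles_bounded[OF mult(2,3)] by blast
    obtain B' where B': "B' \<ge> 0" "\<forall>x\<in>PiE I K. cmod (g x) \<le> B'" using mult by blast
    show ?case
    proof (intro exI[of _ "B * B'"] conjI ballI)
      fix x assume x: "x \<in> PiE I K"
      then have "x i \<in> K i" using mult(2) by auto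
      then show "cmod (r (x i) * g x) \<le> B * B'" unfolding norm_mult using B B' x by (intro mult_mono) auto
    qed (use B B' in auto)
  qed
  show ?thesis using assms
  proof induction
    case (add g h)
    obtain B where B: "B \<ge> 0" "\<forall>x\<in>PiE I K. cmod (g x) \<le> B" using p[OF add(1)] by blast
    obtain B' where B': "B' \<ge> 0" "\<forall>x\<in>PiE I K. cmod (h x) \<le> B'" using add by blast
    show ?case
      by (intro exI[of _ "B + B'"] conjI ballI norm_triangle_le add_mono) (use B B' in auto)
  qed auto
qed

lemma approximable_rat: "g \<in> rat_sums I L \<Longrightarrow> approximable g"
  unfolding approximable_def by force

lemma approximable_const: "approximable (\<lambda>x. c)"
  by (intro approximable_rat rat_prods_in_sums rat_prods.const)

lemma approximable_coord: "i \<in> I \<Longrightarrow> rat_poles (L i) r \<Longrightarrow> approximable (\<lambda>x. r (x i))"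
  using rat_prods.mult[OF rat_prods.const[of 1 I L], of i r] by (intro approximable_rat rat_prods_in_sums) simp

lemma approximable_cong: "approximable f \<Longrightarrow> (\<And>x. x \<in> PiE I K \<Longrightarrow> f x = g x) \<Longrightarrow> approximable g"
  unfolding approximable_def by (metis (no_types, lifting))

lemma approximable_limit:
  assumes "\<And>e. e > 0 \<Longrightarrow> \<exists>h. approximable h \<and> (\<forall>x\<in>PiE I K. cmod (f x - h x) \<le> e)"
  shows "approximable f"
  unfolding approximable_def
proof (intro allI impI)
  fix e :: real assume e: "e > 0"
  obtain h where h: "approximable h" "\<forall>x\<in>PiE I K. cmod (f x - h x) \<le> e / 2" using assms[of "e/2"] e by auto
  obtain g where g: "g \<in> rat_sums I L" "\<forall>x\<in>PiE I K. cmod (h x - g x) < e / 2"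
    using h(1) e unfolding approximable_def by (meson half_gt_zero)
  have "cmod (f x - g x) < e" if "x \<in> PiE I K" for x
    using norm_triangle_ineq[of "f x - h x" "h x - g x"] bspec[OF h(2) that] bspec[OF g(2) that] by simp
  then show "\<exists>g\<in>rat_sums I L. \<forall>x\<in>PiE I K. cmod (f x - g x) < e" using g by blast
qed

lemma approximable_add:
  assumes "approximable f" "approximable g" shows "approximable (\<lambda>x. f x + g x)"
  unfolding approximable_def
proof (intro allI impI)
  fix e :: real assume e: "e > 0"
  obtain f' where f: "f' \<in> rat_sums I L" "\<forall>x\<in>PiE I K. cmod (f x - f' x) < e / 2"
    using assms(1) e unfolding approximable_def by (meson half_gt_zero)
  obtain g' where g: "g' \<in> rat_sums I L" "\<forall>x\<in>PiE I K. cmod (g x - g' x) < e / 2"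
    using assms(2) e unfolding approximable_def by (meson half_gt_zero)
  have "cmod (f x + g x - (f' x + g' x)) < e" if "x \<in> PiE I K" for x
    using norm_triangle_ineq[of "f x - f' x" "g x - g' x"] bspec[OF f(2) that] bspec[OF g(2) that]
    by (simp add: algebra_simps)
  then show "\<exists>g'\<in>rat_sums I L. \<forall>x\<in>PiE I K. cmod (f x + g x - g' x) < e"
    using rat_sums_add[OF f(1) g(1)] by (intro bexI[of _ "\<lambda>x. f' x + g' x"]) auto
qed

lemma approximable_bounded:
  assumes "approximable f" obtains B where "B \<ge> 0" "\<And>x. x \<in> PiE I K \<Longrightarrow> cmod (f x) \<le> B"
proof -
  obtain f' where f: "f' \<in> rat_sums I L" "\<forall>x\<in>PiE I K. cmod (f x - f' x) < 1"
    using assms unfolding approximable_def by (meson zero_less_one)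
  obtain B where B: "B \<ge> 0" "\<forall>x\<in>PiE I K. cmod (f' x) \<le> B" using rat_sums_bounded[OF f(1)] by blast
  have "cmod (f x) \<le> B + 1" if "x \<in> PiE I K" for x
    using norm_triangle_ineq[of "f x - f' x" "f' x"] bspec[OF f(2) that] bspec[OF B(2) that] by simp
  then show ?thesis using that[of "B + 1"] B by simp
qed

lemma approximable_mult:
  assumes "approximable f" "approximable g" shows "approximable (\<lambda>x. f x * g x)"
  unfolding approximable_def
proof (intro allI impI)
  fix e :: real assume e: "e > 0"
  obtain B where B: "B \<ge> 0" "\<And>x. x \<in> PiE I K \<Longrightarrow> cmod (g x) \<le> B" using approximable_bounded[OF assms(2)] by blast
  have eB: "e / (2 * (B + 1)) > 0" using e B by auto
  obtain f' where f: "f' \<in> rat_sums I L" "\<forall>x\<in>PiE I K. cmod (f x - f' x) < e / (2 * (B + 1))"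
    using assms(1) eB unfolding approximable_def by meson
  obtain B' where B': "B' \<ge> 0" "\<forall>x\<in>PiE I K. cmod (f' x) \<le> B'" using rat_sums_bounded[OF f(1)] by blast
  have eB': "e / (2 * (B' + 1)) > 0" using e B' by auto
  obtain g' where g: "g' \<in> rat_sums I L" "\<forall>x\<in>PiE I K. cmod (g x - g' x) < e / (2 * (B' + 1))"
    using assms(2) eB' unfolding approximable_def by meson
  have "cmod (f x * g x - f' x * g' x) < e" if x: "x \<in> PiE I K" for x
  proof -
    have "f x * g x - f' x * g' x = (f x - f' x) * g x + f' x * (g x - g' x)" by (simp add: algebra_simps)
    then have "cmod (f x * g x - f' x * g' x) \<le> cmod (f x - f' x) * cmod (g x) + cmod (f' x) * cmod (g x - g' x)"
      by (metis norm_mult norm_triangle_ineq)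
    also have "\<dots> \<le> cmod (f x - f' x) * (B + 1) + (B' + 1) * cmod (g x - g' x)"
      using B(2)[OF x] bspec[OF B'(2) x] by (intro add_mono mult_left_mono mult_right_mono) auto
    also have "\<dots> < e / 2 + e / 2"
    proof (rule add_strict_mono)
      have "cmod (f x - f' x) * (B + 1) < e / (2 * (B + 1)) * (B + 1)"
        using bspec[OF f(2) x] B by (intro mult_strict_right_mono) auto
      also have "\<dots> = e / 2" using B by (simp add: field_simps)
      finally show "cmod (f x - f' x) * (B + 1) < e / 2" .
      have "(B' + 1) * cmod (g x - g' x) < (B' + 1) * (e / (2 * (B' + 1)))"
        using bspec[OF g(2) x] B' by (intro mult_strict_left_mono) auto
      also have "\<dots> = e / 2" using B' by (simp add: field_simps)
      finally show "(B' + 1) * cmod (g x - g' x) < e / 2" .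
    qed
    finally show ?thesis by simp
  qed
  then show "\<exists>g'\<in>rat_sums I L. \<forall>x\<in>PiE I K. cmod (f x * g x - g' x) < e"
    using rat_sums_mult[OF f(1) g(1)] by (intro bexI[of _ "\<lambda>x. f' x * g' x"]) auto
qed

lemma approximable_sum: "(\<And>k. k \<in> A \<Longrightarrow> approximable (f k)) \<Longrightarrow> approximable (\<lambda>x. \<Sum>k\<in>A. f k x)"
  by (induction A rule: infinite_finite_induct) (auto intro: approximable_const approximable_add)

lemma approximable_power: "approximable f \<Longrightarrow> approximable (\<lambda>x. f x ^ n)"
  by (induction n) (auto intro: approximable_const approximable_mult)

section \<open>Geometric series and pole pushing\<close>

lemma approximable_geometric:
  assumes u: "approximable u" and \<theta>: "\<And>x. x \<in> PiE I K \<Longrightarrow> cmod (u x) \<le> \<theta>" "0 \<le> \<theta>" "\<theta> < 1"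
  shows "approximable (\<lambda>x. 1 / (1 - u x))"
proof (rule approximable_limit)
  fix e :: real assume e: "e > 0"
  obtain n where n: "\<theta>^n < e * (1 - \<theta>)" using real_arch_pow_inv[of "e * (1 - \<theta>)" \<theta>] e \<theta> by auto
  show "\<exists>h. approximable h \<and> (\<forall>x\<in>PiE I K. cmod (1 / (1 - u x) - h x) \<le> e)"
  proof (intro exI[of _ "\<lambda>x. \<Sum>k<n. u x ^ k"] conjI ballI)
    show "approximable (\<lambda>x. \<Sum>k<n. u x ^ k)" by (intro approximable_sum approximable_power u)
    fix x assume x: "x \<in> PiE I K"
    have "cmod (u x) < 1" using \<theta> x by (meson le_less_trans)
    then have u1: "u x \<noteq> 1" by auto
    have "1 / (1 - u x) - (\<Sum>k<n. u x ^ k) = u x ^ n / (1 - u x)"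
      using u1 sum_gp_strict[of "u x" n] by (simp add: field_simps)
    then have "cmod (1 / (1 - u x) - (\<Sum>k<n. u x ^ k)) = cmod (u x) ^ n / cmod (1 - u x)"
      by (simp add: norm_divide norm_power)
    also have "\<dots> \<le> \<theta>^n / (1 - \<theta>)"
    proof (rule frac_le)
      show "cmod (u x) ^ n \<le> \<theta> ^ n" using \<theta>(1)[OF x] by (intro power_mono) auto
      show "1 - \<theta> \<le> cmod (1 - u x)" using norm_triangle_ineq2[of 1 "u x"] \<theta>(1)[OF x] by simp
    qed (use \<theta> in auto)
    also have "\<dots> \<le> e" using n \<theta> by (simp add: pos_divide_le_eq)
    finally show "cmod (1 / (1 - u x) - (\<Sum>k<n. u x ^ k)) \<le> e" .
  qed
qed

text \<open>Factor \<open>1 / (x - b)\<close> as \<open>1 / (x - a)\<close> times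
  \<open>1 / (1 - (b - a) / (x - a))\<close>. As \<open>a\<close> and \<open>b\<close> lie within
  \<open>e / 3\<close> of \<open>p\<close>,
  \<open>cmod (b - a) < 2 * e / 3 \<le> cmod (x - a)\<close>, so the geometric series converges
  uniformly.\<close>

lemma approximable_move_pole:
  assumes i: "i \<in> I" and p: "ball p e \<subseteq> - K i" and a: "cmod (a - p) < e / 3" and b: "cmod (b - p) < e / 3"
    and ap: "approximable (\<lambda>x. 1 / (x i - a))"
  shows "approximable (\<lambda>x. 1 / (x i - b))"
proof -
  have e: "e > 0" using a norm_ge_zero[of "a - p"] by linarith
  have ba: "cmod (b - a) < 2 * e / 3"
    using norm_triangle_ineq4[of "b - p" "a - p"] a b by simp
  have far: "cmod (x i - a) \<ge> 2 * e / 3" if "x \<in> PiE I K" for x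
  proof -
    have "x i \<in> K i" using that i by auto
    then have "x i \<notin> ball p e" using p by blast
    then have "e \<le> cmod (x i - p)" by (simp add: dist_norm norm_minus_commute)
    then show ?thesis using norm_triangle_ineq[of "x i - a" "a - p"] a by simp
  qed
  define \<theta> where "\<theta> = cmod (b - a) / (2 * e / 3)"
  have "approximable (\<lambda>x. 1 / (1 - (b - a) * (1 / (x i - a))))"
  proof (rule approximable_geometric[where \<theta>=\<theta>])
    show "approximable (\<lambda>x. (b - a) * (1 / (x i - a)))" by (intro approximable_mult approximable_const ap)
    show "cmod ((b - a) * (1 / (x i - a))) \<le> \<theta>" if "x \<in> PiE I K" for x
    proof -
      have "cmod (b - a) / cmod (x i - a) \<le> cmod (b - a) / (2 * e / 3)"
        using far[OF that] e by (intro divide_left_mono mult_pos_pos) auto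
      then show ?thesis by (simp add: \<theta>_def norm_mult norm_divide)
    qed
    show "0 \<le> \<theta>" "\<theta> < 1" using ba e by (auto simp: \<theta>_def divide_less_eq)
  qed
  from approximable_mult[OF ap this] show ?thesis
  proof (rule approximable_cong)
    fix x assume x: "x \<in> PiE I K"
    have "x i - a \<noteq> 0" using far[OF x] e by auto
    then have "(x i - a) * (1 - (b - a) * (1 / (x i - a))) = x i - b" by (simp add: field_simps)
    then show "1 / (x i - a) * (1 / (1 - (b - a) * (1 / (x i - a)))) = 1 / (x i - b)"
      by (metis mult_1 times_divide_times_eq)
  qed
qed

text \<open>The local step moves poles in both directions, so the set \<open>S\<close> of admissible
  poles and its complement in \<open>- K i\<close> are both open. A component of
  \<open>- K i\<close> that meets \<open>S\<close> therefore lies in \<open>S\<close>; the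
  hypothesis on \<open>L i\<close> provides a point of \<open>S\<close> in every component.\<close>

lemma approximable_pole:
  assumes i: "i \<in> I" and a: "a \<notin> K i"
  shows "approximable (\<lambda>x. 1 / (x i - a))"
proof -
  define S where "S = {a. a \<notin> K i \<and> approximable (\<lambda>x. 1 / (x i - a))}"
  have cl: "closed (K i)" using compact_K[OF i] compact_imp_closed by blast
  have near: "\<exists>d>0. ball p d \<subseteq> - K i \<and> (\<forall>a\<in>ball p d. \<forall>b\<in>ball p d. a \<in> S \<longrightarrow> b \<in> S)" if p: "p \<in> - K i" for p
  proof -
    obtain e where e: "e > 0" "ball p e \<subseteq> - K i" using p cl by (meson open_Compl openE)
    have sub: "ball p (e / 3) \<subseteq> ball p e" using e by auto
    have st: "b \<in> S" if "a \<in> ball p (e/3)" "b \<in> ball p (e/3)" "a \<in> S" for a b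
    proof -
      have "b \<notin> K i" using that sub e(2) by blast
      then show ?thesis using approximable_move_pole[OF i e(2), of a b] that
        by (auto simp: S_def dist_norm norm_minus_commute)
    qed
    have "0 < e / 3" using e by simp
    moreover have "ball p (e / 3) \<subseteq> - K i" using sub e(2) by (rule order_trans)
    ultimately show ?thesis using st by blast
  qed
  have oS: "open S" unfolding open_contains_ball
  proof
    fix p assume "p \<in> S"
    moreover from this obtain d where "d > 0" "\<forall>a\<in>ball p d. \<forall>b\<in>ball p d. a \<in> S \<longrightarrow> b \<in> S"
      using near[of p] by (auto simp: S_def)
    ultimately show "\<exists>d>0. ball p d \<subseteq> S" by (meson centre_in_ball subsetI)
  qed
  have oC: "open (- K i - S)" unfolding open_contains_ball
  proof
    fix p assume p: "p \<in> - K i - S"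
    then obtain d where "d > 0" "ball p d \<subseteq> - K i" "\<forall>a\<in>ball p d. \<forall>b\<in>ball p d. a \<in> S \<longrightarrow> b \<in> S"
      using near[of p] by auto
    then show "\<exists>d>0. ball p d \<subseteq> - K i - S" using p by (metis DiffD2 DiffI centre_in_ball subset_iff)
  qed
  define C where "C = connected_component_set (- K i) a"
  have aC: "a \<in> C" and C: "C \<in> components (- K i)" unfolding C_def using a by (auto simp: components_def)
  have CK: "C \<subseteq> - K i" and conn: "connected C" using C in_components_subset in_components_connected by blast+
  have pole: "z \<in> S" if "Some z \<in> L i" for z
  proof -
    have "rat_poles (L i) (\<lambda>w. 1 / (w - z))" unfolding rat_poles_def
      by (intro exI[of _ 1] exI[of _ "[:-z, 1:]"]) (use that in \<open>auto simp: add_eq_0_iff\<close>)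
    then show ?thesis using approximable_coord[OF i] hits[OF i] that by (auto simp: S_def hits_components_def)
  qed
  have "\<exists>z. z \<in> C \<inter> S"
  proof (cases "\<exists>z\<in>C. Some z \<in> L i")
    case True
    then show ?thesis using pole by blast
  next
    case False
    then have nb: "\<not> bounded C" and N: "None \<in> L i" using hits[OF i] C unfolding hits_components_def by blast+
    obtain R where R: "R > 0" "\<And>z. z \<in> K i \<Longrightarrow> cmod z \<le> R"
      using compact_imp_bounded[OF compact_K[OF i]] unfolding bounded_pos by blast
    \<comment> \<open>The component is served by infinity alone, so polynomials are allowed. For a
      point \<open>c\<close> this far out, \<open>cmod (x i / c) \<le> 1/2\<close>, and
      \<open>1 / (x i - c)\<close> is a uniform limit of polynomials in \<open>x i\<close>.\<close>
    obtain c where c: "c \<in> C" "2 * R < cmod c" using nb unfolding bounded_iff by (meson not_le)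
    have c0: "c \<noteq> 0" using c R by auto
    have "rat_poles (L i) (\<lambda>w. w)" unfolding rat_poles_def
      by (intro exI[of _ "[:0, 1:]"] exI[of _ 1]) (use N in auto)
    from approximable_coord[OF i this] have co: "approximable (\<lambda>x. x i)" .
    have "approximable (\<lambda>x. 1 / (1 - (1 / c) * x i))"
    proof (rule approximable_geometric[where \<theta>="1/2"])
      show "approximable (\<lambda>x. 1 / c * x i)" by (intro approximable_mult approximable_const co)
      show "cmod (1 / c * x i) \<le> 1 / 2" if "x \<in> PiE I K" for x
      proof -
        have "cmod (x i) \<le> R" using that i R by auto
        then have "2 * cmod (x i) \<le> cmod c" using c by linarith
        then show ?thesis using c0 by (simp add: norm_mult norm_divide field_simps)
      qed
    qed auto
    from approximable_mult[OF approximable_const this, of "- 1 / c"]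
    have "approximable (\<lambda>x. 1 / (x i - c))"
    proof (rule approximable_cong)
      fix x assume x: "x \<in> PiE I K"
      have "c * (1 - 1 / c * x i) = c - x i" using c0 by (simp add: field_simps)
      then show "- 1 / c * (1 / (1 - 1 / c * x i)) = 1 / (x i - c)"
        by (metis minus_diff_eq minus_divide_left minus_divide_right mult.right_neutral times_divide_times_eq)
    qed
    then show ?thesis using c CK by (auto simp: S_def)
  qed
  then have "C \<subseteq> S"
    using connectedD[OF conn oS oC] CK by blast
  then show ?thesis using aC by (auto simp: S_def)
qed

text \<open>A Riemann sum over partition patches: the nodes \<open>p j\<close> lie in the support of
  \<open>\<rho>\<close>, at distance at least \<open>d\<close> from \<open>K i\<close>, and the
  kernel varies by at most \<open>4 * \<delta> / d^2\<close> over a patch. Each node contributes a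
  simple pole off \<open>K i\<close>, handled by \<open>approximable_pole\<close>.\<close>

lemma approximable_cauchy:
  assumes i: "i \<in> I" and \<rho>: "Cc_in (- K i) \<rho>"
  shows "approximable (\<lambda>x. cauchy \<rho> (x i))"
proof (rule approximable_limit)
  fix e :: real assume e: "e > 0"
  obtain S where S: "compact S" "S \<subseteq> - K i" "\<And>z. z \<notin> S \<Longrightarrow> \<rho> z = 0" using \<rho> unfolding Cc_in_def by blast
  note \<rho>C = Cc_in_Cc[OF \<rho>]
  have "S \<inter> K i = {}" using S by blast
  then obtain d where d: "d > 0" "\<And>z x. z \<in> S \<Longrightarrow> x \<in> K i \<Longrightarrow> d \<le> cmod (z - x)"
    using separate_compact_closed[OF S(1) compact_imp_closed[OF compact_K[OF i]]] by (auto simp: dist_norm)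
  define J where "J = (LINT z|lborel. cmod (\<rho> z))"
  have J0: "J \<ge> 0" unfolding J_def by simp
  \<comment> \<open>Solves \<open>4 * \<delta> / d^2 * (J + 1) = e\<close>; \<open>J + 1\<close>
    replaces \<open>J\<close>, which may be 0.\<close>
  define \<delta> where "\<delta> = e * d^2 / (4 * (J + 1))"
  have \<delta>: "\<delta> > 0" using e d J0 by (simp add: \<delta>_def)
  have \<delta>e: "4 * \<delta> / d^2 * J \<le> e"
  proof -
    have "4 * \<delta> / d^2 * J \<le> 4 * \<delta> / d^2 * (J + 1)" using \<delta> by (intro mult_left_mono) auto
    moreover have gen: "4 * (e * D / (4 * j)) / D * j = e" if "D \<noteq> 0" "j \<noteq> 0" for D j :: real using that by simp
    have "4 * \<delta> / d^2 * (J + 1) = e" unfolding \<delta>_def by (rule gen) (use d(1) J0 in auto)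
    ultimately show ?thesis by simp
  qed
  obtain R where R: "\<And>z. z \<in> S \<Longrightarrow> cmod z \<le> R" using compact_imp_bounded[OF S(1)] unfolding bounded_iff by blast
  obtain N :: nat where N: "R / \<delta> \<le> N" using real_arch_simple by blast
  have RN: "R \<le> real N * \<delta>" using N \<delta> by (simp add: field_simps)
  define A where "A = {j \<in> grid N. \<exists>z\<in>S. pou \<delta> j z \<noteq> 0}"
  define p where "p j = (SOME z. z \<in> S \<and> pou \<delta> j z \<noteq> 0)" for j
  have p: "p j \<in> S" "pou \<delta> j (p j) \<noteq> 0" if "j \<in> A" for j
    using that someI_ex[of "\<lambda>z. z \<in> S \<and> pou \<delta> j z \<noteq> 0"] unfolding A_def p_def by blast+
  have fA: "finite A" unfolding A_def by simp
  have sum1: "(\<Sum>j\<in>A. pou \<delta> j z) = 1" if "z \<in> S" for z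
  proof -
    have "(\<Sum>j\<in>A. pou \<delta> j z) = (\<Sum>j\<in>grid N. pou \<delta> j z)"
      using that by (intro sum.mono_neutral_left) (auto simp: A_def)
    also have "\<dots> = 1" using R[OF that] RN by (intro sum_pou_eq_1 \<delta>) auto
    finally show ?thesis .
  qed
  \<comment> \<open>The sign turns \<open>1 / (x i - p j)\<close> into the kernel
    \<open>1 / (p j - x i)\<close> of \<open>cauchy\<close>.\<close>
  define c where "c j = - (LINT z|lborel. \<rho> z * of_real (pou \<delta> j z))" for j
  show "\<exists>h. approximable h \<and> (\<forall>x\<in>PiE I K. cmod (cauchy \<rho> (x i) - h x) \<le> e)"
  proof (intro exI[of _ "\<lambda>x. \<Sum>j\<in>A. c j * (1 / (x i - p j))"] conjI ballI)
    show "approximable (\<lambda>x. \<Sum>j\<in>A. c j * (1 / (x i - p j)))"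
      using p S by (intro approximable_sum approximable_mult approximable_const approximable_pole i) blast
    fix x assume "x \<in> PiE I K"
    then have x: "x i \<in> K i" using i by auto
    define t where "t j z = \<rho> z * of_real (pou \<delta> j z) * (1 / (p j - x i))" for j z
    have it: "integrable lborel (t j)" for j
      unfolding t_def using C1_on_continuous[OF C1_pou[OF \<delta>]]
      by (intro integrable_mult_left Cc_integrable Cc_mult \<rho>C)
    have "(\<Sum>j\<in>A. c j * (1 / (x i - p j))) = (\<Sum>j\<in>A. LINT z|lborel. t j z)"
    proof (rule sum.cong[OF refl])
      fix j assume "j \<in> A"
      have "1 / (p j - x i) = - (1 / (x i - p j))" by (metis minus_diff_eq minus_divide_right)
      then show "c j * (1 / (x i - p j)) = (LINT z|lborel. t j z)"
        unfolding t_def c_def integral_mult_left_zero by simp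
    qed
    also have "\<dots> = (LINT z|lborel. (\<Sum>j\<in>A. t j z))" using it by (subst Bochner_Integration.integral_sum) auto
    finally have "cauchy \<rho> (x i) - (\<Sum>j\<in>A. c j * (1 / (x i - p j))) = (LINT z|lborel. \<rho> z / (z - x i) - (\<Sum>j\<in>A. t j z))"
      unfolding cauchy_def using Cc_cauchy_integrable(1)[OF \<rho>C] it
      by (subst Bochner_Integration.integral_diff) auto
    also have "cmod \<dots> \<le> (LINT z|lborel. cmod (\<rho> z / (z - x i) - (\<Sum>j\<in>A. t j z)))"
      by (rule integral_norm_bound)
    also have "\<dots> \<le> (LINT z|lborel. 4 * \<delta> / d^2 * cmod (\<rho> z))"
    proof (rule integral_mono)
      show "integrable lborel (\<lambda>z. cmod (\<rho> z / (z - x i) - (\<Sum>j\<in>A. t j z)))"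
        using Cc_cauchy_integrable(1)[OF \<rho>C] it
        by (intro integrable_norm Bochner_Integration.integrable_diff Bochner_Integration.integrable_sum) auto
      show "integrable lborel (\<lambda>z. 4 * \<delta> / d^2 * cmod (\<rho> z))"
        by (intro integrable_mult_right integrable_norm Cc_integrable \<rho>C)
      show "cmod (\<rho> z / (z - x i) - (\<Sum>j\<in>A. t j z)) \<le> 4 * \<delta> / d^2 * cmod (\<rho> z)" for z
      proof (cases "z \<in> S")
        case True
        have eq: "\<rho> z / (z - x i) = (\<Sum>j\<in>A. of_real (pou \<delta> j z) * (\<rho> z / (z - x i)))"
          unfolding sum_distrib_right[symmetric] of_real_sum[symmetric] sum1[OF True] by simp
        have "\<rho> z / (z - x i) - (\<Sum>j\<in>A. t j z) = (\<Sum>j\<in>A. of_real (pou \<delta> j z) * (\<rho> z * (1 / (z - x i) - 1 / (p j - x i))))"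
          by (subst eq, unfold t_def sum_subtractf[symmetric], rule sum.cong) (simp_all add: algebra_simps)
        also have "cmod \<dots> \<le> (\<Sum>j\<in>A. pou \<delta> j z * (4 * \<delta> / d^2 * cmod (\<rho> z)))"
        proof (rule sum_norm_le)
          fix j assume j: "j \<in> A"
          show "cmod (of_real (pou \<delta> j z) * (\<rho> z * (1 / (z - x i) - 1 / (p j - x i)))) \<le> pou \<delta> j z * (4 * \<delta> / d^2 * cmod (\<rho> z))"
          proof (cases "pou \<delta> j z = 0")
            case False
            then have "cmod (z - gridpt \<delta> j) < 2 * \<delta>" "cmod (p j - gridpt \<delta> j) < 2 * \<delta>"
              using pou_support[OF \<delta>] p[OF j] by blast+
            then have zp: "cmod (p j - z) \<le> 4 * \<delta>"
              using norm_triangle_ineq4[of "p j - gridpt \<delta> j" "z - gridpt \<delta> j"] by simp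
            have dz: "d \<le> cmod (z - x i)" "d \<le> cmod (p j - x i)" using d(2) x True p[OF j] by auto
            then have nz: "z - x i \<noteq> 0" "p j - x i \<noteq> 0" using d(1) by auto
            have "1 / (z - x i) - 1 / (p j - x i) = (p j - z) / ((z - x i) * (p j - x i))"
              using nz by (simp add: divide_simps)
            then have "cmod (1 / (z - x i) - 1 / (p j - x i)) = cmod (p j - z) / (cmod (z - x i) * cmod (p j - x i))"
              by (simp add: norm_divide norm_mult)
            also have "\<dots> \<le> 4 * \<delta> / d^2"
              unfolding power2_eq_square using zp dz d(1) \<delta> by (intro frac_le mult_mono) auto
            finally have "cmod (1 / (z - x i) - 1 / (p j - x i)) \<le> 4 * \<delta> / d^2" .
            then show ?thesis unfolding norm_mult norm_of_real abs_of_nonneg[OF pou_nonneg]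
              mult.commute[of "4 * \<delta> / d^2"]
              by (intro mult_left_mono pou_nonneg norm_ge_zero)
          qed simp
        qed
        also have "\<dots> = 4 * \<delta> / d^2 * cmod (\<rho> z)"
          unfolding sum_distrib_right[symmetric] sum1[OF True] by simp
        finally show ?thesis .
      qed (use S(3) in \<open>simp add: t_def\<close>)
    qed
    also have "\<dots> = 4 * \<delta> / d^2 * J" by (simp add: J_def)
    also have "\<dots> \<le> e" by (rule \<delta>e)
    finally show "cmod (cauchy \<rho> (x i) - (\<Sum>j\<in>A. c j * (1 / (x i - p j)))) \<le> e" .
  qed
qed

end

section \<open>Reduction to finitely many coordinates\<close>

lemma continuous_on_fun_upd_prod:
  "continuous_on S (\<lambda>(z :: complex, w :: 'i \<Rightarrow> complex). w(i := z))"
  unfolding case_prod_beta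
proof (rule continuous_on_coordinatewise_then_product)
  fix j
  show "continuous_on S (\<lambda>p. ((snd p)(i := fst p)) j)"
  proof (cases "j = i")
    case False
    have "continuous_on UNIV (\<lambda>w :: 'i \<Rightarrow> complex. w j)" by (rule continuous_on_product_coordinates)
    then have "continuous_on S (\<lambda>p :: complex \<times> ('i \<Rightarrow> complex). snd p j)"
      by (rule continuous_on_compose2) (auto intro: continuous_intros)
    then show ?thesis using False by simp
  qed (auto intro: continuous_intros)
qed

text \<open>Elements of \<open>PiE I K\<close> are \<open>undefined\<close> off \<open>I\<close>, so
  the set is a full product with singleton factors off \<open>I\<close>, to which Tychonoff's
  theorem in the function space applies.\<close>

lemma compact_PiE_fun:
  fixes K :: "'i \<Rightarrow> complex set"
  assumes "\<And>i. i \<in> I \<Longrightarrow> compact (K i)" shows "compact (PiE I K)"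
proof -
  have "PiE I K = PiE UNIV (\<lambda>i. if i \<in> I then K i else {undefined})"
    by (auto simp: PiE_def Pi_def extensional_def split: if_splits)
  moreover have "compactin (product_topology (\<lambda>i. euclidean) UNIV) (PiE UNIV (\<lambda>i. if i \<in> I then K i else {undefined}))"
    using assms by (subst compactin_PiE) auto
  ultimately show ?thesis by (simp add: euclidean_product_topology)
qed

text \<open>Basic open sets of the product topology constrain finitely many coordinates.\<close>
lemma continuous_almost_finite_coordinates:
  fixes f :: "('i \<Rightarrow> complex) \<Rightarrow> complex"
  assumes comp: "compact (PiE I K)" and f: "continuous_on (PiE I K) f" and e: "e > 0"
  shows "\<exists>F. finite F \<and> F \<subseteq> I \<and>
    (\<forall>x\<in>PiE I K. \<forall>y\<in>PiE I K. (\<forall>i\<in>F. x i = y i) \<longrightarrow> cmod (f x - f y) \<le> e)"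
proof -
  \<comment> \<open>A pair \<open>p\<close> is a neighbourhood of \<open>x\<close> with a finite set
    of coordinates. The point \<open>z\<close> is not assumed to lie in the neighbourhood: agreement
    with such a \<open>y\<close> on those coordinates must already force \<open>f z\<close> close to
    \<open>f x\<close>.\<close>
  define R where "R x p \<longleftrightarrow> open (fst p) \<and> x \<in> fst p \<and> finite (snd p) \<and>
     (\<forall>y\<in>fst p \<inter> PiE I K. \<forall>z\<in>PiE I K. (\<forall>i\<in>snd p \<inter> I. y i = z i) \<longrightarrow> cmod (f y - f x) \<le> e/2 \<and> cmod (f z - f x) \<le> e/2)"
    for x :: "'i \<Rightarrow> complex" and p :: "('i \<Rightarrow> complex) set \<times> 'i set"
  have "\<forall>x\<in>PiE I K. \<exists>p. R x p"
  proof
    fix x assume x: "x \<in> PiE I K"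
    obtain V where V: "open V" "V \<inter> PiE I K = f -` ball (f x) (e/2) \<inter> PiE I K"
      using f unfolding continuous_on_open_invariant by (meson open_ball)
    have xV: "x \<in> V" using V(2) x e by auto
    have "openin (product_topology (\<lambda>i. euclidean) UNIV) V" using V(1) by (simp add: euclidean_product_topology)
    from product_topology_open_contains_basis[OF this xV] obtain X where X: "x \<in> PiE UNIV X" "\<And>i. open (X i)"
      "finite {i. X i \<noteq> UNIV}" "PiE UNIV X \<subseteq> V" by auto
    define F where "F = {i. X i \<noteq> UNIV}"
    have "openin (product_topology (\<lambda>i. euclidean) UNIV) (PiE UNIV X)"
      using X by (intro product_topology_basis) auto
    then have oX: "open (PiE UNIV X)" by (simp add: euclidean_product_topology)
    have close: "cmod (f y - f x) \<le> e/2" if "y \<in> PiE UNIV X" "y \<in> PiE I K" for y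
    proof -
      have "f y \<in> ball (f x) (e/2)" using that X(4) V(2) by blast
      then show ?thesis by (simp add: dist_norm norm_minus_commute)
    qed
    \<comment> \<open>Agreement on \<open>F \<inter> I\<close> suffices: at indices of
      \<open>F\<close> outside \<open>I\<close> both points take the value
      \<open>undefined\<close>.\<close>
    have stay: "z \<in> PiE UNIV X" if "y \<in> PiE UNIV X" "y \<in> PiE I K" "z \<in> PiE I K" "\<forall>i\<in>F \<inter> I. y i = z i" for y z
    proof (rule PiE_I)
      fix i
      show "z i \<in> X i"
      proof (cases "i \<in> F")
        case True
        then have "z i = y i"
          using that(4) PiE_arb[OF that(2), of i] PiE_arb[OF that(3), of i] by (cases "i \<in> I") auto
        then show ?thesis using that(1) by auto
      qed (simp add: F_def)
    qed simp
    show "\<exists>p. R x p" unfolding R_def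
    proof (intro exI[of _ "(PiE UNIV X, F)"] conjI ballI impI, unfold fst_conv snd_conv)
      show "open (PiE UNIV X)" "x \<in> PiE UNIV X" "finite F" using oX X(1,3) by (simp_all add: F_def)
      fix y z assume h: "y \<in> PiE UNIV X \<inter> PiE I K" "z \<in> PiE I K" "\<forall>i\<in>F \<inter> I. y i = z i"
      show "cmod (f y - f x) \<le> e/2" using close h(1) by blast
      show "cmod (f z - f x) \<le> e/2" using close stay h by blast
    qed
  qed
  from bchoice[OF this] obtain p where p: "\<And>x. x \<in> PiE I K \<Longrightarrow> R x (p x)" by blast
  define U F where "U x = fst (p x)" and "F x = snd (p x)" for x
  have U: "\<And>x. x \<in> PiE I K \<Longrightarrow> open (U x)" "\<And>x. x \<in> PiE I K \<Longrightarrow> x \<in> U x"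
     "\<And>x. x \<in> PiE I K \<Longrightarrow> finite (F x)"
    using p unfolding R_def U_def F_def by blast+
  have UF: "\<And>x y z. x \<in> PiE I K \<Longrightarrow> y \<in> U x \<Longrightarrow> y \<in> PiE I K \<Longrightarrow> z \<in> PiE I K \<Longrightarrow> (\<forall>i\<in>F x \<inter> I. y i = z i) \<Longrightarrow>
       cmod (f y - f x) \<le> e/2 \<and> cmod (f z - f x) \<le> e/2"
    using p unfolding R_def U_def F_def by blast
  obtain D where D: "D \<subseteq> PiE I K" "finite D" "PiE I K \<subseteq> (\<Union>x\<in>D. U x)"
  proof (rule compactE_image[OF comp, of "PiE I K" U])
    show "open (U x)" if "x \<in> PiE I K" for x by (rule U(1)[OF that])
    show "PiE I K \<subseteq> (\<Union>x\<in>PiE I K. U x)" using U(2) by blast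
  qed
  show ?thesis
  proof (intro exI[of _ "(\<Union>x\<in>D. F x) \<inter> I"] conjI ballI impI)
    show "finite ((\<Union>x\<in>D. F x) \<inter> I)" using D U(3) by (intro finite_Int) blast
    fix y z assume yz: "y \<in> PiE I K" "z \<in> PiE I K" "\<forall>i\<in>(\<Union>x\<in>D. F x) \<inter> I. y i = z i"
    obtain x where x: "x \<in> D" "y \<in> U x" using D(3) yz(1) by blast
    have "x \<in> PiE I K" using x(1) D(1) by blast
    moreover have "\<forall>i\<in>F x \<inter> I. y i = z i" using yz(3) x(1) by blast
    ultimately have "cmod (f y - f x) \<le> e/2 \<and> cmod (f z - f x) \<le> e/2" by (intro UF x(2) yz(1,2))
    then show "cmod (f y - f z) \<le> e" using norm_triangle_ineq4[of "f y - f x" "f z - f x"] by simp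
  qed auto
qed

section \<open>Operations preserving \<open>A_D\<close>\<close>

lemma A_D_slice:
  assumes "f \<in> A_D I K" "i \<in> I" "w \<in> PiE I K" shows "(\<lambda>z. f (w(i := z))) \<in> A_alg (K i)"
  using assms unfolding A_D_def by blast

lemma A_D_const: "(\<lambda>x. c) \<in> A_D I K"
  unfolding A_D_def A_alg_def by auto

lemma A_D_linear:
  assumes "f \<in> A_D I K" "g \<in> A_D I K" shows "(\<lambda>x. f x + c * g x) \<in> A_D I K"
  using assms unfolding A_D_def A_alg_def
  by (auto intro!: continuous_intros holomorphic_intros)

lemma fun_upd_PiE: "x \<in> PiE I K \<Longrightarrow> i \<in> I \<Longrightarrow> z \<in> K i \<Longrightarrow> x(i := z) \<in> PiE I K"
  by (auto simp: PiE_def Pi_def extensional_def)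

lemma A_D_fix_coordinate:
  assumes f: "f \<in> A_D I K" and i: "i \<in> I" and z: "z \<in> K i"
  shows "(\<lambda>x. f (x(i := z))) \<in> A_D I K"
proof -
  have "continuous_on (PiE I K) (\<lambda>x. (z, x))" by (intro continuous_intros)
  from continuous_on_compose2[OF continuous_on_fun_upd_prod[of UNIV i] this]
  have c: "continuous_on (PiE I K) (\<lambda>x. x(i := z))" by simp
  have "continuous_on (PiE I K) f" using f unfolding A_D_def by blast
  then have 1: "continuous_on (PiE I K) (\<lambda>x. f (x(i := z)))"
    by (rule continuous_on_compose2[OF _ c]) (intro image_subsetI fun_upd_PiE i z)
  have 2: "(\<lambda>t. f ((w(i0 := t))(i := z))) \<in> A_alg (K i0)" if "i0 \<in> I" "w \<in> PiE I K" for i0 w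
  proof (cases "i0 = i")
    case True then show ?thesis by (simp add: A_alg_def)
  next
    case False
    then have "(\<lambda>t. f ((w(i0 := t))(i := z))) = (\<lambda>t. f ((w(i := z))(i0 := t)))" by (simp add: fun_upd_twist)
    then show ?thesis using A_D_slice[OF f that(1) fun_upd_PiE[OF that(2) i z]] by simp
  qed
  show ?thesis unfolding A_D_def mem_Collect_eq by (intro conjI ballI 1 2)
qed

lemma A_D_freeze:
  assumes f: "f \<in> A_D I K" and w0: "w0 \<in> PiE I K"
  shows "(\<lambda>x. f (\<lambda>i. if i \<in> F then x i else w0 i)) \<in> A_D I K"
proof -
  let ?m = "\<lambda>x i. if i \<in> F then x i else w0 i"
  have c: "continuous_on (PiE I K) ?m"
  proof (rule continuous_on_coordinatewise_then_product)
    fix i show "continuous_on (PiE I K) (\<lambda>x. if i \<in> F then x i else w0 i)"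
      by (cases "i \<in> F") (auto intro: continuous_on_subset[OF continuous_on_product_coordinates])
  qed
  have m: "?m x \<in> PiE I K" if "x \<in> PiE I K" for x using that w0 by (auto simp: PiE_def Pi_def extensional_def)
  have "continuous_on (PiE I K) f" using f unfolding A_D_def by blast
  then have 1: "continuous_on (PiE I K) (\<lambda>x. f (?m x))"
    by (rule continuous_on_compose2[OF _ c]) (intro image_subsetI m)
  have 2: "(\<lambda>t. f (?m (w(i0 := t)))) \<in> A_alg (K i0)" if "i0 \<in> I" "w \<in> PiE I K" for i0 w
  proof (cases "i0 \<in> F")
    case False
    then have "?m (w(i0 := t)) = ?m w" for t by auto
    then show ?thesis by (simp add: A_alg_def)
  next
    case True
    then have "?m (w(i0 := t)) = (?m w)(i0 := t)" for t by auto
    then show ?thesis using A_D_slice[OF f that(1) m[OF that(2)]] by simp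
  qed
  show ?thesis unfolding A_D_def mem_Collect_eq by (intro conjI ballI 1 2)
qed

context compact_product begin

text \<open>For uncountable \<open>I\<close> the product need not be metrizable, so uniformity is
  obtained in two stages: compactness of \<open>PiE I K\<close> gives each \<open>z\<close> a
  neighbourhood that works for all \<open>w\<close>, and a Lebesgue number of this cover of
  \<open>K i\<close> gives \<open>d\<close>.\<close>

lemma A_D_equicontinuous:
  assumes f: "f \<in> A_D I K" and i: "i \<in> I" and e: "e > 0"
  shows "\<exists>d>0. \<forall>z\<in>K i. \<forall>z'\<in>K i. cmod (z - z') < d \<longrightarrow> (\<forall>w\<in>PiE I K. cmod (f (w(i := z)) - f (w(i := z'))) \<le> e)"
proof -
  have comp: "compact (PiE I K)" by (rule compact_PiE_fun[OF compact_K])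
  define g where "g p = f ((snd p)(i := fst p))" for p
  have "continuous_on (PiE I K) f" using f unfolding A_D_def by blast
  then have gc: "continuous_on (K i \<times> PiE I K) g" unfolding g_def
    by (rule continuous_on_compose2[OF _ continuous_on_fun_upd_prod[of _ i, unfolded case_prod_beta]])
       (intro image_subsetI fun_upd_PiE i; simp add: mem_Times_iff)
  have e2: "e / 2 > 0" using e by simp
  have "\<exists>V. z \<in> V \<and> open V \<and> (\<forall>z'\<in>V \<inter> K i. \<forall>w\<in>PiE I K. dist (g (z', w)) (g (z, w)) \<le> e / 2)" if "z \<in> K i" for z
    using continuous_on_prod_compactE[OF gc comp that e2] by metis
  then obtain V where V: "\<And>z. z \<in> K i \<Longrightarrow> z \<in> V z" "\<And>z. z \<in> K i \<Longrightarrow> open (V z)"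
    "\<And>z z' w. z \<in> K i \<Longrightarrow> z' \<in> V z \<Longrightarrow> z' \<in> K i \<Longrightarrow> w \<in> PiE I K \<Longrightarrow> dist (g (z', w)) (g (z, w)) \<le> e / 2"
    by (metis IntI)
  have "K i \<subseteq> \<Union> (V ` K i)" using V(1) by blast
  from Heine_Borel_lemma[OF compact_K[OF i] this] V(2)
  obtain d where d: "d > 0" "\<And>z. z \<in> K i \<Longrightarrow> \<exists>G\<in>V ` K i. ball z d \<subseteq> G" by blast
  show ?thesis
  proof (intro exI[of _ d] conjI ballI impI d(1))
    fix z z' w assume h: "z \<in> K i" "z' \<in> K i" "cmod (z - z') < d" "w \<in> PiE I K"
    obtain c where c: "c \<in> K i" "ball z d \<subseteq> V c" using d(2)[OF h(1)] by blast
    have "z \<in> V c" "z' \<in> V c" using c(2) d(1) h(3) by (auto simp: dist_norm)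
    then have "dist (g (z, w)) (g (c, w)) \<le> e/2" "dist (g (z', w)) (g (c, w)) \<le> e/2" using V(3)[OF c(1)] h by blast+
    then show "cmod (f (w(i := z)) - f (w(i := z'))) \<le> e"
      using norm_triangle_ineq4[of "g (z, w) - g (c, w)" "g (z', w) - g (c, w)"] by (simp add: g_def dist_norm)
  qed
qed

text \<open>Induction on the number of relevant coordinates. Separating \<open>z = x i\<close>
  writes \<open>f\<close> approximately as a finite sum of Cauchy transforms in \<open>x i\<close>,
  approximable by pole pushing, times coefficients that depend on the remaining coordinates only,
  approximable by induction.\<close>

lemma approximable_finite_coordinates:
  assumes OA: "\<And>i. i \<in> I \<Longrightarrow> O_bar (K i) = A_alg (K i)"
    and "finite F" "F \<subseteq> I" "f \<in> A_D I K"
    "\<And>x y. x \<in> PiE I K \<Longrightarrow> y \<in> PiE I K \<Longrightarrow> (\<And>i. i \<in> F \<Longrightarrow> x i = y i) \<Longrightarrow> f x = f y"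
  shows "approximable f"
  using assms(2-)
proof (induction F arbitrary: f rule: finite_induct)
  case empty
  show ?case
  proof (cases "PiE I K = {}")
    case False
    then obtain w where w: "w \<in> PiE I K" by blast
    show ?thesis by (rule approximable_cong[OF approximable_const[of "f w"]]) (use empty(3) w in blast)
  qed (auto intro: approximable_cong[OF approximable_const[of 0]])
next
  case (insert i F)
  then have i: "i \<in> I" by simp
  \<comment> \<open>The functions covered by the induction hypothesis. They form a linear space
    containing all slices of \<open>f\<close> in the coordinate \<open>i\<close>, as
    \<open>planar_finite_rank\<close> requires of its coefficient space.\<close>
  define X where "X = {h \<in> A_D I K. \<forall>x\<in>PiE I K. \<forall>y\<in>PiE I K. (\<forall>i\<in>F. x i = y i) \<longrightarrow> h x = h y}"
  have X_inv: "h x = h y" if "h \<in> X" "x \<in> PiE I K" "y \<in> PiE I K" "\<And>i. i \<in> F \<Longrightarrow> x i = y i" for h x y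
    using that unfolding X_def by blast
  have X: "approximable h" if "h \<in> X" for h
  proof (rule insert(3))
    show "F \<subseteq> I" using insert(4) by simp
    show "h \<in> A_D I K" using that unfolding X_def by blast
    show "h x = h y" if "x \<in> PiE I K" "y \<in> PiE I K" "\<And>i. i \<in> F \<Longrightarrow> x i = y i" for x y
      by (rule X_inv[OF \<open>h \<in> X\<close> that])
  qed
  define \<phi> where "\<phi> z w = f (w(i := z))" for z w
  have comp: "compact (PiE I K)" by (rule compact_PiE_fun[OF compact_K])
  have "continuous_on (PiE I K) f" using insert(5) unfolding A_D_def by blast
  then have "bounded (f ` PiE I K)" using comp by (intro compact_imp_bounded compact_continuous_image)
  then obtain M where M: "\<And>x. x \<in> PiE I K \<Longrightarrow> cmod (f x) \<le> M" unfolding bounded_iff by blast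
  have \<phi>M: "cmod (\<phi> z w) \<le> M" if "z \<in> K i" "w \<in> PiE I K" for z w
    unfolding \<phi>_def using fun_upd_PiE[OF that(2) i that(1)] by (rule M)
  have X0: "(\<lambda>x. 0) \<in> X" unfolding X_def using A_D_const[of 0 I K] by simp
  have Xl: "(\<lambda>x. g x + c * h x) \<in> X" if "g \<in> X" "h \<in> X" for g h c
  proof -
    have "(\<lambda>x. g x + c * h x) \<in> A_D I K" using that A_D_linear[of g I K h c] unfolding X_def by blast
    moreover have "g x + c * h x = g y + c * h y" if "x \<in> PiE I K" "y \<in> PiE I K" "\<forall>i\<in>F. x i = y i" for x y
      using X_inv[OF \<open>g \<in> X\<close>, of x y] X_inv[OF \<open>h \<in> X\<close>, of x y] that by simp
    ultimately show ?thesis unfolding X_def by blast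
  qed
  have \<phi>X: "\<phi> z \<in> X" if z: "z \<in> K i" for z
  proof -
    have "\<phi> z \<in> A_D I K" unfolding \<phi>_def using A_D_fix_coordinate[OF insert(5) i z] .
    moreover have "\<phi> z x = \<phi> z y" if "x \<in> PiE I K" "y \<in> PiE I K" "\<forall>j\<in>F. x j = y j" for x y
      unfolding \<phi>_def using that by (intro insert(6) fun_upd_PiE i z) auto
    ultimately show ?thesis unfolding X_def by blast
  qed
  have \<phi>O: "(\<lambda>z. \<phi> z w) \<in> O_bar (K i)" if "w \<in> PiE I K" for w
    unfolding OA[OF i] \<phi>_def by (rule A_D_slice[OF insert(5) i that])
  show ?case
  proof (rule approximable_limit)
    fix e :: real assume e: "e > 0"
    obtain J :: "((int \<times> int) \<times> nat) set" and \<rho> b where J: "\<And>k. k \<in> J \<Longrightarrow> Cc_in (- K i) (\<rho> k)" "\<And>k. k \<in> J \<Longrightarrow> b k \<in> X"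
      and est: "\<And>z w. z \<in> K i \<Longrightarrow> w \<in> PiE I K \<Longrightarrow> cmod (\<phi> z w - (\<Sum>k\<in>J. cauchy (\<rho> k) z * b k w)) \<le> e"
      by (rule planar_finite_rank[OF compact_K[OF i] e X0 Xl A_D_equicontinuous[OF insert(5) i, folded \<phi>_def] \<phi>M \<phi>X \<phi>O]) blast+
    show "\<exists>h. approximable h \<and> (\<forall>x\<in>PiE I K. cmod (f x - h x) \<le> e)"
    proof (intro exI[of _ "\<lambda>x. \<Sum>k\<in>J. cauchy (\<rho> k) (x i) * b k x"] conjI ballI)
      show "approximable (\<lambda>x. \<Sum>k\<in>J. cauchy (\<rho> k) (x i) * b k x)"
        by (intro approximable_sum approximable_mult approximable_cauchy i J X)
      fix x assume x: "x \<in> PiE I K"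
      then have "x i \<in> K i" using i by auto
      from est[OF this x] show "cmod (f x - (\<Sum>k\<in>J. cauchy (\<rho> k) (x i) * b k x)) \<le> e"
        by (simp add: \<phi>_def)
    qed
  qed
qed

end

theorem mainTheorem16:
  fixes I :: "'i set" and K :: "'i \<Rightarrow> complex set" and L :: "'i \<Rightarrow> complex option set"
  assumes "\<forall>i\<in>I. compact (K i)"
    and "\<forall>i\<in>I. O_bar (K i) = A_alg (K i)"
    and "\<forall>i\<in>I. hits_components (K i) (L i)"
  shows "\<forall>f\<in>A_D I K. \<forall>e>0. \<exists>g\<in>rat_sums I L. \<forall>x\<in>PiE I K. cmod (f x - g x) < e"
proof -
  interpret compact_product I K L by unfold_locales (use assms in auto)
  have "approximable f" if f: "f \<in> A_D I K" for f
  proof (cases "PiE I K = {}")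
    case False
    then obtain w0 where w0: "w0 \<in> PiE I K" by blast
    show ?thesis
    proof (rule approximable_limit)
      fix e :: real assume e: "e > 0"
      have comp: "compact (PiE I K)" by (rule compact_PiE_fun[OF compact_K])
      have fc: "continuous_on (PiE I K) f" using f unfolding A_D_def by blast
      from continuous_almost_finite_coordinates[OF comp fc e] obtain F where F: "finite F" "F \<subseteq> I"
        "\<forall>x\<in>PiE I K. \<forall>y\<in>PiE I K. (\<forall>i\<in>F. x i = y i) \<longrightarrow> cmod (f x - f y) \<le> e"
        by (elim exE conjE)
      \<comment> \<open>Freezing the coordinates outside \<open>F\<close> at a base point of the
        product changes \<open>f\<close> by at most \<open>e\<close> and leaves a member of
        \<open>A_D\<close> that depends on \<open>F\<close> only.\<close>
      define m where "m x i = (if i \<in> F then x i else w0 i)" for x i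
      have m: "m x \<in> PiE I K" if "x \<in> PiE I K" for x
        using that w0 by (auto simp: m_def PiE_def Pi_def extensional_def)
      have "approximable (\<lambda>x. f (m x))"
      proof (rule approximable_finite_coordinates[OF _ F(1,2)])
        show "(\<lambda>x. f (m x)) \<in> A_D I K" unfolding m_def by (rule A_D_freeze[OF f w0])
        show "f (m x) = f (m y)" if "\<And>i. i \<in> F \<Longrightarrow> x i = y i" for x y
          using that unfolding m_def by (intro arg_cong[where f=f]) auto
      qed (use assms in auto)
      moreover have "cmod (f x - f (m x)) \<le> e" if "x \<in> PiE I K" for x
        by (rule F(3)[rule_format, OF that m[OF that]]) (simp add: m_def)
      ultimately show "\<exists>h. approximable h \<and> (\<forall>x\<in>PiE I K. cmod (f x - h x) \<le> e)" by blast
    qed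
  qed (auto intro: approximable_cong[OF approximable_const[of 0]])
  then show ?thesis unfolding approximable_def by blast
qed

end
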